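(* There is an absolutely normal real number $x$ such that for each integer $b \geq 2$ there are numbers $N_0(b)$ and $C_b$ such that for all $N \geq N_0(b)$, $$D_N\big( (\{b^j x\})_{j\geq 0}\big) \leq \frac{C_b}{\sqrt{N}}.$$ For the constant $C_b$ one can choose $C_b = 3433 \cdot b$. Moreover, there is an algorithm that computes the first $N$ digits of the expansion of $x$ (the same $x$) in base $2$ after performing a number of mathematical operations that is exponential in $N$.
   Context: For a real number $y$, $\{y\} = y - \lfloor y \rfloor$ denotes its fractional part. For a sequence $(x_j)_{j\geq 0}$ of real numbers in the unit interval, the discrepancy of the first $N$ elements is $$D_N((x_j)_{j\geq 0})= \sup_{0\leq \alpha_1 < \alpha_2 \leq 1} \left| \frac{1}{N} \#\{ j : 0 \leq j \leq N-1 \text{ and } \alpha_1 \leq x_j < \alpha_2 \} - (\alpha_2-\alpha_1) \right|.$$ Such a sequence is uniformly distributed if and only if $\lim_{N\to\infty} D_N((x_j)_{j\geq 0}) = 0$. A real number $x$ is normal with respect to an integer base $b \geq 2$ if $(\{b^j x\})_{j\geq 0}$ is uniformly distributed in the unit interval, and $x$ is absolutely normal if it is normal to all integer bases $b\ge 2$. "Exponential in $N$" means bounded by $2^{O(N)}$. *)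

theory Defs
  imports Complex_Main "HOL-Library.Landau_Symbols"
begin

section \<open>Discrepancy and normality\<close>

definition discrepancy :: "(nat \<Rightarrow> real) \<Rightarrow> nat \<Rightarrow> real" where
  "discrepancy u N =
     (SUP (\<alpha>\<^sub>1, \<alpha>\<^sub>2) \<in> {(\<alpha>\<^sub>1, \<alpha>\<^sub>2). 0 \<le> \<alpha>\<^sub>1 \<and> \<alpha>\<^sub>1 < \<alpha>\<^sub>2 \<and> \<alpha>\<^sub>2 \<le> (1::real)}.
        \<bar>1 / real N * real (card {j. j < N \<and> \<alpha>\<^sub>1 \<le> u j \<and> u j < \<alpha>\<^sub>2}) - (\<alpha>\<^sub>2 - \<alpha>\<^sub>1)\<bar>)"

definition uniformly_distributed :: "(nat \<Rightarrow> real) \<Rightarrow> bool" where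
  "uniformly_distributed u \<longleftrightarrow> (\<lambda>N. discrepancy u N) \<longlonglongrightarrow> 0"

definition normal_in_base :: "nat \<Rightarrow> real \<Rightarrow> bool" where
  "normal_in_base b x \<longleftrightarrow> uniformly_distributed (\<lambda>j. frac (real b ^ j * x))"

definition absolutely_normal :: "real \<Rightarrow> bool" where
  "absolutely_normal x \<longleftrightarrow> (\<forall>b\<ge>2. normal_in_base b x)"

text \<open>
  The \<open>k\<close>-th digit after the radix point of the base-\<open>b\<close> expansion, counted from \<open>k = 0\<close>.
  For an irrational \<open>x\<close> (in particular, for a normal one) the expansion is unique.
\<close>

definition digit :: "nat \<Rightarrow> real \<Rightarrow> nat \<Rightarrow> int" where
  "digit b x k = \<lfloor>real b ^ Suc k * x\<rfloor> mod int b"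


section \<open>Algorithms and the number of operations they perform\<close>

text \<open>
  Algorithms are programs of an imperative language over unbounded integers with dynamically
  indexed arrays. A store maps an array name and an index to an integer; a scalar variable is
  cell 0 of an array. Programs are finite syntactic objects whose only constants are integers, so
  they compute only computable functions.

  Every constant, memory access, arithmetic or logical operation, assignment and branch counts as
  one operation, independently of the size of the integers involved.
\<close>

type_synonym vname = string
type_synonym store = "vname \<Rightarrow> int \<Rightarrow> int"

datatype aexp =
    Const int
  | Read vname aexp
  | Add aexp aexp
  | Sub aexp aexp
  | Mul aexp aexp
  | Div aexp aexp
  | Mod aexp aexp

datatype bexp =
    Less aexp aexp
  | Equal aexp aexp
  | Neg bexp
  | Conj bexp bexp

datatype com =
    Skip
  | Assign vname aexp aexp
  | Seq com com
  | Cond bexp com com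
  | While bexp com

fun aval :: "aexp \<Rightarrow> store \<Rightarrow> int" where
  "aval (Const n) s = n"
| "aval (Read x i) s = s x (aval i s)"
| "aval (Add a b) s = aval a s + aval b s"
| "aval (Sub a b) s = aval a s - aval b s"
| "aval (Mul a b) s = aval a s * aval b s"
| "aval (Div a b) s = aval a s div aval b s"
| "aval (Mod a b) s = aval a s mod aval b s"

fun bval :: "bexp \<Rightarrow> store \<Rightarrow> bool" where
  "bval (Less a b) s \<longleftrightarrow> aval a s < aval b s"
| "bval (Equal a b) s \<longleftrightarrow> aval a s = aval b s"
| "bval (Neg p) s \<longleftrightarrow> \<not> bval p s"
| "bval (Conj p q) s \<longleftrightarrow> bval p s \<and> bval q s"

fun aops :: "aexp \<Rightarrow> nat" where
  "aops (Const n) = 1"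
| "aops (Read x i) = aops i + 1"
| "aops (Add a b) = aops a + aops b + 1"
| "aops (Sub a b) = aops a + aops b + 1"
| "aops (Mul a b) = aops a + aops b + 1"
| "aops (Div a b) = aops a + aops b + 1"
| "aops (Mod a b) = aops a + aops b + 1"

fun bops :: "bexp \<Rightarrow> nat" where
  "bops (Less a b) = aops a + aops b + 1"
| "bops (Equal a b) = aops a + aops b + 1"
| "bops (Neg p) = bops p + 1"
| "bops (Conj p q) = bops p + bops q + 1"

text \<open>
  \<open>exec c s t s'\<close>: started in store \<open>s\<close>, program \<open>c\<close> terminates in store \<open>s'\<close> after performing
  exactly \<open>t\<close> operations.
\<close>

inductive exec :: "com \<Rightarrow> store \<Rightarrow> nat \<Rightarrow> store \<Rightarrow> bool" where
  Skip: "exec Skip s 1 s"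
| Assign: "exec (Assign x i a) s (aops i + aops a + 1) (s(x := (s x)(aval i s := aval a s)))"
| Seq: "exec c\<^sub>1 s t\<^sub>1 s' \<Longrightarrow> exec c\<^sub>2 s' t\<^sub>2 s'' \<Longrightarrow> exec (Seq c\<^sub>1 c\<^sub>2) s (t\<^sub>1 + t\<^sub>2) s''"
| CondTrue: "bval p s \<Longrightarrow> exec c\<^sub>1 s t s' \<Longrightarrow> exec (Cond p c\<^sub>1 c\<^sub>2) s (bops p + 1 + t) s'"
| CondFalse: "\<not> bval p s \<Longrightarrow> exec c\<^sub>2 s t s' \<Longrightarrow> exec (Cond p c\<^sub>1 c\<^sub>2) s (bops p + 1 + t) s'"
| WhileFalse: "\<not> bval p s \<Longrightarrow> exec (While p c) s (bops p + 1) s"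
| WhileTrue: "bval p s \<Longrightarrow> exec c s t\<^sub>1 s' \<Longrightarrow> exec (While p c) s' t\<^sub>2 s'' \<Longrightarrow>
    exec (While p c) s (bops p + 1 + t\<^sub>1 + t\<^sub>2) s''"

inductive_cases SkipE: "exec Skip s t s'"
inductive_cases AssignE: "exec (Assign x i a) s t s'"
inductive_cases SeqE: "exec (Seq c\<^sub>1 c\<^sub>2) s t s'"
inductive_cases CondE: "exec (Cond p c\<^sub>1 c\<^sub>2) s t s'"
inductive_cases WhileE: "exec (While p c) s t s'"

lemma exec_deterministic:
  "exec c s t s' \<Longrightarrow> exec c s u s'' \<Longrightarrow> u = t \<and> s'' = s'"
proof (induction arbitrary: u s'' rule: exec.induct)
  case (Skip s)
  then show ?case by (auto elim: SkipE)
next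
  case (Assign x i a s)
  then show ?case by (auto elim: AssignE)
next
  case (Seq c\<^sub>1 s t\<^sub>1 s\<^sub>1 c\<^sub>2 t\<^sub>2 s\<^sub>2)
  from Seq.prems show ?case by (rule SeqE) (metis Seq.IH)
next
  case (CondTrue p s c\<^sub>1 t s\<^sub>1 c\<^sub>2)
  from CondTrue.prems show ?case
    by (rule CondE) (use CondTrue.hyps(1) in \<open>auto dest!: CondTrue.IH\<close>)+
next
  case (CondFalse p s c\<^sub>2 t s\<^sub>1 c\<^sub>1)
  from CondFalse.prems show ?case
    by (rule CondE) (use CondFalse.hyps(1) in \<open>auto dest!: CondFalse.IH\<close>)+
next
  case (WhileFalse p s c)
  from WhileFalse.prems show ?case
    by (rule WhileE) (use WhileFalse.hyps in auto)+
next
  case (WhileTrue p s c t\<^sub>1 s\<^sub>1 t\<^sub>2 s\<^sub>2)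
  from WhileTrue.prems show ?case
    by (rule WhileE) (use WhileTrue.hyps(1) in \<open>auto dest!: WhileTrue.IH\<close>)+
qed

definition input_store :: "nat \<Rightarrow> store" where
  "input_store N = (\<lambda>x i. if x = ''N'' \<and> i = 0 then int N else 0)"

text \<open>
  On input \<open>N\<close>, the program \<open>c\<close> writes the first \<open>N\<close> base-\<open>b\<close> digits of \<open>x\<close> to the array
  \<open>d\<close> and stops after \<open>T N\<close> operations.
\<close>

definition computes_digits :: "com \<Rightarrow> nat \<Rightarrow> real \<Rightarrow> (nat \<Rightarrow> nat) \<Rightarrow> bool" where
  "computes_digits c b x T \<longleftrightarrow>
     (\<forall>N. \<exists>s. exec c (input_store N) (T N) s \<and> (\<forall>k<N. s ''d'' (int k) = digit b x k))"

definition exponentially_bounded :: "(nat \<Rightarrow> nat) \<Rightarrow> bool" where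
  "exponentially_bounded T \<longleftrightarrow>
     (\<exists>f \<in> O(\<lambda>N. real N). \<forall>N. real (T N) \<le> 2 powr f N)"

end

theory Submission
  imports Defs
begin

text \<open>
  A random real does not have this discrepancy: by the law of the iterated logarithm the counting
  error of its first \<open>N\<close> digits exceeds every multiple of \<open>\<surd>N\<close> infinitely often. But
  the failures are spread over infinitely many scales \<open>N \<approx> 4 ^ k\<close>, and at each single scale
  most choices of the next digits succeed, whatever the earlier digits are. So the digits are
  chosen scale by scale. When the first \<open>4 ^ k\<close> bits are fixed, the next \<open>3 * 4 ^ k\<close> bits are
  chosen such that in every base \<open>b \<le> k\<close> the block of new digits is \<open>balanced\<close>: all its initial
  segments have counting errors \<open>O(\<surd>b 2 ^ k)\<close>, for all intervals that start at 0 and end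
  at a grid point \<open>c / b ^ k\<close>. These bounds form a geometric series, so the error up to \<open>N\<close>
  is of the order of its last term; and if \<open>N\<close> lies in the block of scale \<open>k\<close> then
  \<open>4 ^ k \<le> b (N + 1)\<close>, whence an error of \<open>O(b \<surd>N)\<close>.

  Unbalanced blocks are rare (\<open>card_unbalanced\<close>) by chaining. The deviation for an initial segment
  and a grid point splits into one term for each dyadic time length and each word length \<open>l \<le> k\<close>
  (\<open>dyadic_chaining\<close>, \<open>sum_increment\<close>). A term of word length \<open>l\<close> has
  variance at most of the order \<open>l b\<close> times the segment length divided by \<open>b ^ l\<close>, so thresholds that
  decrease geometrically in both lengths are exceeded with a probability
  (\<open>card_large_window_sum\<close>) that beats the number of terms. No logarithm is lost, and the
  probability of failure in base \<open>b\<close> is at most \<open>1 / (16 b ^ 3)\<close>. The dyadic intervals of the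
  known bits and the \<open>b\<close>-adic intervals of the known digits do not match; this costs a factor
  \<open>8 b\<close>, and \<open>8 b / (16 b ^ 3)\<close> still sums to at most \<open>1 / 2\<close> over \<open>b \<ge> 2\<close>. So some extension
  is good for all bases at once (\<open>exists_good\<close>).

  To be balanced is a finite arithmetic condition. A program can therefore try all extensions and
  take the first good one. With \<open>n = 4 ^ k\<close> known bits there are \<open>2 ^ (3 n)\<close> extensions, and one
  test takes \<open>2 ^ O(n)\<close> operations. A stage begins only if \<open>n < N\<close>, so the total is \<open>2 ^ O(N)\<close>.
\<close>


section \<open>Exponential moments of sums over digit windows\<close>

lemma exp_le_quadratic:
  fixes x :: real
  assumes "\<bar>x\<bar> \<le> 1"
  shows "exp x \<le> 1 + x + x\<^sup>2"
proof (cases "x \<ge> 0")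
  case True
  then show ?thesis using exp_bound[of x] assms by simp
next
  case False
  define y where "y = - x"
  have y: "y \<ge> 0" "x = - y" using False by (auto simp: y_def)
  have "1 * 1 \<le> (1 + y + y\<^sup>2/2) * (1 - y + y\<^sup>2)"
  proof -
    have "(1 + y + y\<^sup>2/2) * (1 - y + y\<^sup>2) = 1 + y^2/2 + y^3/2 + y^4/2"
      by (simp add: field_simps power2_eq_square power3_eq_cube power4_eq_xxxx)
    thus ?thesis using y by simp
  qed
  also have "\<dots> \<le> exp y * (1 - y + y\<^sup>2)"
  proof (rule mult_right_mono)
    show "1 + y + y\<^sup>2/2 \<le> exp y" using exp_lower_Taylor_quadratic[of y] y by simp
    have "0 \<le> (1 - y/2)^2 + 3/4 * y^2" by simp
    also have "\<dots> = 1 - y + y^2" by (simp add: power2_eq_square field_simps)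
    finally show "0 \<le> 1 - y + y\<^sup>2" .
  qed
  finally have "exp (-y) \<le> 1 - y + y^2"
    by (simp add: exp_minus field_simps)
  thus ?thesis by (simp add: y(2))
qed

lemma sum_lessThan_add:
  fixes f :: "nat \<Rightarrow> real"
  shows "(\<Sum>v<n + m. f v) = (\<Sum>v<n. f v) + (\<Sum>w<m. f (n + w))"
  by (induction m) (simp_all add: add.assoc)

text \<open>
  Averages over random digits are written as sums over numbers. Splitting off the last digits in this way
  expresses that they are independent of the others.
\<close>

lemma sum_lessThan_mult:
  fixes f :: "nat \<Rightarrow> real"
  shows "(\<Sum>v<n * m. f v) = (\<Sum>u<n. \<Sum>w<m. f (u * m + w))"
proof (induction n)
  case (Suc n)
  have "(\<Sum>v<Suc n * m. f v) = (\<Sum>v<n * m + m. f v)" by (simp add: add.commute)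
  also have "\<dots> = (\<Sum>v<n*m. f v) + (\<Sum>w<m. f (n * m + w))"
    by (rule sum_lessThan_add)
  finally show ?case using Suc by simp
qed simp

text \<open>
  The base-\<open>B\<close> digits of a uniformly distributed number are independent, so its moment generating
  function is a product.
\<close>

lemma sum_exp_digits:
  fixes g :: "nat \<Rightarrow> real"
  assumes B: "B > 0"
  shows "(\<Sum>y<B ^ Q. exp (\<Sum>q<Q. g (y div B ^ q mod B))) = (\<Sum>d<B. exp (g d)) ^ Q"
proof (induction Q)
  case (Suc Q)
  have "(\<Sum>y<B ^ Suc Q. exp (\<Sum>q<Suc Q. g (y div B ^ q mod B)))
      = (\<Sum>u<B ^ Q. \<Sum>w<B. exp (\<Sum>q<Suc Q. g ((u * B + w) div B ^ q mod B)))"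
    using sum_lessThan_mult[where m = B and n = "B^Q"] by (simp add: mult.commute)
  also have "\<dots> = (\<Sum>u<B ^ Q. \<Sum>w<B. exp (g w) * exp (\<Sum>q<Q. g (u div B ^ q mod B)))"
  proof (intro sum.cong refl)
    fix u w assume w: "w \<in> {..<B}"
    have "(\<Sum>q<Suc Q. g ((u * B + w) div B ^ q mod B))
        = g ((u * B + w) mod B) + (\<Sum>q<Q. g ((u * B + w) div B ^ Suc q mod B))"
      by (subst sum.lessThan_Suc_shift) simp
    also have "\<dots> = g w + (\<Sum>q<Q. g (u div B ^ q mod B))"
      using w B by (simp add: div_mult2_eq)
    finally show "exp (\<Sum>q<Suc Q. g ((u * B + w) div B ^ q mod B)) = exp (g w) * exp (\<Sum>q<Q. g (u div B ^ q mod B))"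
      by (simp add: exp_add)
  qed
  also have "\<dots> = (\<Sum>d<B. exp (g d)) ^ Suc Q"
    by (simp add: sum_distrib_right[symmetric] sum_distrib_left[symmetric] Suc)
  finally show ?case .
qed simp

text \<open>
  Transfers averages over complete words to windows inside a block: the digits outside of the window are
  free.
\<close>

lemma sum_window:
  fixes F :: "nat \<Rightarrow> real"
  assumes b: "b > 0" and H: "i + m \<le> H"
  shows "(\<Sum>v<b ^ H. F (v div b ^ i mod b ^ m)) = real (b ^ (H - m)) * (\<Sum>y<b ^ m. F y)"
proof -
  define r where "r = H - i - m"
  have Hr: "H = r + m + i" using H by (simp add: r_def)
  have "(\<Sum>v<b ^ H. F (v div b ^ i mod b ^ m))
      = (\<Sum>u<b ^ (r + m). \<Sum>w<b^i. F ((u * b^i + w) div b ^ i mod b ^ m))"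
    unfolding Hr using b by (subst power_add) (rule sum_lessThan_mult)
  also have "\<dots> = (\<Sum>u<b ^ (r + m). \<Sum>w<b^i. F (u mod b^m))"
    using b by (intro sum.cong refl) simp
  also have "\<dots> = real (b^i) * (\<Sum>u<b ^ (r + m). F (u mod b^m))"
    by (simp add: sum_distrib_left)
  also have "(\<Sum>u<b ^ (r + m). F (u mod b^m)) = (\<Sum>u<b ^ r. \<Sum>w<b^m. F ((u * b^m + w) mod b^m))"
    using b by (subst power_add) (rule sum_lessThan_mult)
  also have "\<dots> = real (b^r) * (\<Sum>w<b^m. F w)"
    by (simp)
  finally show ?thesis by (simp add: Hr power_add)
qed

text \<open>
  Convexity: replacing the exponential of a sum by the mean of exponentials makes it possible to
  treat dependent summands in separate independent groups, at the price of a factor \<open>l\<close> in the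
  exponent.
\<close>

lemma exp_average_le:
  fixes f :: "nat \<Rightarrow> real"
  assumes l: "l > 0"
  shows "exp (\<Sum>r<l. f r) \<le> (\<Sum>r<l. exp (real l * f r)) / real l"
proof -
  define x where "x = (\<Sum>r<l. f r)"
  \<comment> \<open>The tangent of the exponential function at the mean of the \<open>l * f r\<close>.\<close>
  have "real l * exp x = (\<Sum>r<l. exp x * (1 + (real l * f r - x)))"
    using l by (simp add: sum_distrib_left[symmetric] sum.distrib sum_subtractf x_def)
  also have "\<dots> \<le> (\<Sum>r<l. exp x * exp (real l * f r - x))"
    by (intro sum_mono mult_left_mono) auto
  also have "\<dots> = (\<Sum>r<l. exp (real l * f r))"
    by (simp add: exp_diff)
  finally show ?thesis using l by (simp add: x_def field_simps)
qed

text \<open>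
  The bound on \<open>q\<close> is the number of \<open>i < h\<close> in the residue class of \<open>r\<close> modulo \<open>l\<close>.
\<close>

lemma sum_residue_classes:
  fixes f :: "nat \<Rightarrow> real"
  assumes l: "l > 0"
  shows "(\<Sum>i<h. f i) = (\<Sum>r<l. \<Sum>q<(h + l - 1 - r) div l. f (r + l * q))"
proof (induction h)
  case 0
  have "(l - 1 - r) div l = 0" if "r < l" for r using that by (intro div_less) auto
  thus ?case by (simp)
next
  case (Suc h)
  define r0 where "r0 = h mod l"
  have r0: "r0 < l" using l by (simp add: r0_def)
  have h: "h = r0 + l * (h div l)" by (simp add: r0_def)
  have other: "(Suc h + l - 1 - r) div l = (h + l - 1 - r) div l" if r: "r < l" "r \<noteq> r0" for r
  proof -
    have e: "Suc h + l - 1 - r = Suc (h + l - 1 - r)" using r by simp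
    have "\<not> l dvd Suc (h + l - 1 - r)"
    proof
      assume "l dvd Suc (h + l - 1 - r)"
      moreover have "Suc (h + l - 1 - r) = h + l - r" using r by simp
      ultimately have "l dvd h + l - r" by simp
      then obtain c where "h + l - r = l * c" ..
      hence "h + l = r + l * c" using r by simp
      hence "(h + l) mod l = (r + l * c) mod l" by simp
      thus False using r by (simp add: r0_def)
    qed
    thus ?thesis unfolding e by (simp add: div_Suc dvd_eq_mod_eq_0)
  qed
  have at: "(Suc h + l - 1 - r0) div l = Suc (h div l)" "(h + l - 1 - r0) div l = h div l"
  proof -
    have "Suc h + l - 1 - r0 = l * (h div l) + l" using h r0 by simp
    thus "(Suc h + l - 1 - r0) div l = Suc (h div l)" using l by simp
    have "h + l - 1 - r0 = l - 1 + l * (h div l)" using h r0 l by simp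
    also have "\<dots> div l = h div l" using l div_mult_self2[of l "l - 1" "h div l"] by simp
    finally show "(h + l - 1 - r0) div l = h div l" .
  qed
  have "(\<Sum>r<l. \<Sum>q<(Suc h + l - 1 - r) div l. f (r + l * q))
     = (\<Sum>q<(Suc h + l - 1 - r0) div l. f (r0 + l * q)) + (\<Sum>r\<in>{..<l}-{r0}. \<Sum>q<(Suc h + l - 1 - r) div l. f (r + l * q))"
    using r0 by (subst sum.remove[of _ r0]) auto
  also have "\<dots> = f h + ((\<Sum>q<(h + l - 1 - r0) div l. f (r0 + l * q)) + (\<Sum>r\<in>{..<l}-{r0}. \<Sum>q<(h + l - 1 - r) div l. f (r + l * q)))"
  proof -
    have "r0 + l * (h div l) = h" using h by simp
    moreover have "(\<Sum>r\<in>{..<l}-{r0}. \<Sum>q<(Suc h + l - 1 - r) div l. f (r + l * q))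
      = (\<Sum>r\<in>{..<l}-{r0}. \<Sum>q<(h + l - 1 - r) div l. f (r + l * q))"
      by (intro sum.cong refl) (use other in auto)
    ultimately show ?thesis unfolding at sum.lessThan_Suc by simp
  qed
  also have "\<dots> = f h + (\<Sum>r<l. \<Sum>q<(h + l - 1 - r) div l. f (r + l * q))"
    using r0 by (subst (2) sum.remove[of _ r0]) auto
  finally show ?case using Suc by simp
qed

text \<open>
  Windows of length \<open>l\<close> at positions congruent modulo \<open>l\<close> do not overlap, hence are independent,
  and each class has at most \<open>2 h / l\<close> members. In a class the second order bound on the exponential
  function applies to each factor, because the first order term vanishes by \<open>g0\<close>. Convexity combines
  the \<open>l\<close> classes.
\<close>

lemma exp_moment_windows:
  fixes g :: "nat \<Rightarrow> real"
  assumes b: "b > 0" and l: "l > 0" "l \<le> h" and H: "i0 + h + l \<le> Suc H"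
    and g0: "(\<Sum>d<b ^ l. g d) = 0" and g1: "\<And>d. d < b ^ l \<Longrightarrow> \<bar>g d\<bar> \<le> 1"
    and g2: "(\<Sum>d<b ^ l. (g d)\<^sup>2) \<le> p * real (b ^ l)"
    and \<theta>: "\<bar>\<theta>\<bar> * real l \<le> 1"
  shows "(\<Sum>v<b ^ H. exp (\<theta> * (\<Sum>i<h. g (v div b ^ (i0 + i) mod b ^ l))))
    \<le> real (b ^ H) * exp (2 * real h * real l * p * \<theta>\<^sup>2)"
proof -
  define B where "B = b ^ l"
  define Q where "Q = (\<lambda>r. (h + l - 1 - r) div l)"
  define \<phi> where "\<phi> = \<theta> * real l"
  have B: "B > 0" using b by (simp add: B_def)
  have p: "p \<ge> 0"
  proof -
    have "0 \<le> (\<Sum>d<b ^ l. (g d)\<^sup>2)" by (simp add: sum_nonneg)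
    also have "\<dots> \<le> p * real (b ^ l)" by (rule g2)
    finally have "0 \<le> p * real (b ^ l)" .
    moreover have "real (b ^ l) > 0" using b by simp
    ultimately show ?thesis by (metis zero_le_mult_iff not_less)
  qed
  have single: "(\<Sum>d<B. exp (\<phi> * g d)) \<le> real B * exp (p * \<phi>\<^sup>2)"
  proof -
    have "(\<Sum>d<B. exp (\<phi> * g d)) \<le> (\<Sum>d<B. 1 + \<phi> * g d + (\<phi> * g d)\<^sup>2)"
    proof (intro sum_mono exp_le_quadratic)
      fix d assume "d \<in> {..<B}"
      hence "\<bar>\<phi>\<bar> * \<bar>g d\<bar> \<le> 1 * 1"
        using g1 \<theta> by (intro mult_mono) (auto simp: \<phi>_def B_def abs_mult)
      thus "\<bar>\<phi> * g d\<bar> \<le> 1" by (simp add: abs_mult)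
    qed
    also have "\<dots> = real B + \<phi> * (\<Sum>d<B. g d) + \<phi>\<^sup>2 * (\<Sum>d<B. (g d)\<^sup>2)"
      by (simp add: sum.distrib sum_distrib_left power_mult_distrib)
    also have "\<dots> \<le> real B + \<phi>\<^sup>2 * (p * real B)"
      using g0 g2 by (simp add: B_def mult_left_mono)
    also have "\<dots> = real B * (1 + p * \<phi>\<^sup>2)" by (simp add: algebra_simps)
    also have "\<dots> \<le> real B * exp (p * \<phi>\<^sup>2)"
      using B by (intro mult_left_mono) auto
    finally show ?thesis .
  qed
  have Ql: "real (Q r) * real l \<le> 2 * real h" if "r < l" for r
  proof -
    have "Q r * l \<le> h + l - 1 - r" unfolding Q_def by simp
    also have "\<dots> \<le> 2 * h" using l by simp
    finally have "real (Q r * l) \<le> real (2 * h)" by (rule of_nat_mono)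
    thus ?thesis by simp
  qed
  have class_bound: "(\<Sum>v<b ^ H. exp (\<phi> * (\<Sum>q<Q r. g (v div b ^ (i0 + (r + l * q)) mod b ^ l))))
      \<le> real (b ^ H) * exp (2 * real h * real l * p * \<theta>\<^sup>2)" if r: "r < l" for r
  proof -
    have le: "i0 + r + l * Q r \<le> H"
    proof -
      have "l * Q r \<le> h + l - 1 - r" unfolding Q_def by simp
      thus ?thesis using H r l by linarith
    qed
    define F where "F = (\<lambda>y. exp (\<Sum>q<Q r. \<phi> * g (y div B ^ q mod B)))"
    have "(\<Sum>v<b ^ H. exp (\<phi> * (\<Sum>q<Q r. g (v div b ^ (i0 + (r + l * q)) mod b ^ l))))
        = (\<Sum>v<b ^ H. F (v div b ^ (i0 + r) mod b ^ (l * Q r)))"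
    proof (intro sum.cong refl)
      fix v
      have "v div b ^ (i0 + (r + l * q)) mod b ^ l = v div b ^ (i0 + r) mod b ^ (l * Q r) div B ^ q mod B"
        if q: "q < Q r" for q
      proof -
        define y where "y = v div b ^ (i0 + r)"
        have lq: "b ^ (l * Q r) = b ^ (l * q) * b ^ (l * (Q r - q))"
          using q by (simp add: power_add[symmetric] add_mult_distrib2[symmetric])
        have "y mod b ^ (l * Q r) div b ^ (l * q) = (y div b ^ (l * q)) mod b ^ (l * (Q r - q))"
          unfolding lq mod_mult2_eq using b by simp
        moreover have "b ^ l dvd b ^ (l * (Q r - q))" using q
          by (intro le_imp_power_dvd) (simp add: Suc_le_eq)
        ultimately have "y mod b ^ (l * Q r) div b ^ (l * q) mod b ^ l = y div b ^ (l * q) mod b ^ l"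
          by (simp add: mod_mod_cancel)
        thus ?thesis by (simp add: y_def B_def power_mult[symmetric] div_mult2_eq[symmetric] power_add[symmetric] add.assoc)
      qed
      thus "exp (\<phi> * (\<Sum>q<Q r. g (v div b ^ (i0 + (r + l * q)) mod b ^ l)))
          = F (v div b ^ (i0 + r) mod b ^ (l * Q r))"
        by (simp add: F_def sum_distrib_left)
    qed
    also have "\<dots> = real (b ^ (H - l * Q r)) * (\<Sum>y<b ^ (l * Q r). F y)"
      using le b by (intro sum_window) auto
    also have "(\<Sum>y<b ^ (l * Q r). F y) = (\<Sum>d<B. exp (\<phi> * g d)) ^ Q r"
      unfolding F_def power_mult B_def[symmetric] using sum_exp_digits[OF B, of "\<lambda>d. \<phi> * g d"] by simp
    also have "\<dots> \<le> (real B * exp (p * \<phi>\<^sup>2)) ^ Q r"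
      by (intro power_mono single sum_nonneg) auto
    also have "\<dots> = real (b ^ (l * Q r)) * exp (real (Q r) * (p * \<phi>\<^sup>2))"
      by (simp add: power_mult_distrib B_def exp_of_nat_mult power_mult)
    finally have "(\<Sum>v<b ^ H. exp (\<phi> * (\<Sum>q<Q r. g (v div b ^ (i0 + (r + l * q)) mod b ^ l))))
      \<le> real (b ^ (H - l * Q r)) * (real (b ^ (l * Q r)) * exp (real (Q r) * (p * \<phi>\<^sup>2)))"
      by (simp add: mult_left_mono)
    also have "\<dots> = real (b ^ H) * exp (real (Q r) * (p * \<phi>\<^sup>2))"
      using le by (simp add: power_add[symmetric])
    also have "\<dots> \<le> real (b ^ H) * exp (2 * real h * real l * p * \<theta>\<^sup>2)"
    proof -
      have "real (Q r) * (p * \<phi>\<^sup>2) = (real (Q r) * real l) * (real l * p * \<theta>\<^sup>2)"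
        by (simp add: \<phi>_def power2_eq_square)
      also have "\<dots> \<le> (2 * real h) * (real l * p * \<theta>\<^sup>2)"
        using p by (intro mult_right_mono Ql r) auto
      finally show ?thesis by (intro mult_left_mono) (auto simp: mult.assoc)
    qed
    finally show ?thesis .
  qed
  have "(\<Sum>v<b ^ H. exp (\<theta> * (\<Sum>i<h. g (v div b ^ (i0 + i) mod b ^ l))))
      \<le> (\<Sum>v<b ^ H. (\<Sum>r<l. exp (\<phi> * (\<Sum>q<Q r. g (v div b ^ (i0 + (r + l * q)) mod b ^ l)))) / real l)"
  proof (intro sum_mono)
    fix v
    have "\<theta> * (\<Sum>i<h. g (v div b ^ (i0 + i) mod b ^ l))
       = (\<Sum>r<l. \<theta> * (\<Sum>q<Q r. g (v div b ^ (i0 + (r + l * q)) mod b ^ l)))"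
      unfolding Q_def by (subst sum_residue_classes[OF l(1)]) (simp add: sum_distrib_left)
    thus "exp (\<theta> * (\<Sum>i<h. g (v div b ^ (i0 + i) mod b ^ l)))
      \<le> (\<Sum>r<l. exp (\<phi> * (\<Sum>q<Q r. g (v div b ^ (i0 + (r + l * q)) mod b ^ l)))) / real l"
      using exp_average_le[OF l(1), of "\<lambda>r. \<theta> * (\<Sum>q<Q r. g (v div b ^ (i0 + (r + l * q)) mod b ^ l))"]
      by (simp add: \<phi>_def mult.assoc mult.left_commute)
  qed
  also have "\<dots> = (\<Sum>r<l. \<Sum>v<b ^ H. exp (\<phi> * (\<Sum>q<Q r. g (v div b ^ (i0 + (r + l * q)) mod b ^ l)))) / real l"
    unfolding sum_divide_distrib[symmetric] by (subst sum.swap) simp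
  also have "\<dots> \<le> (\<Sum>r<l. real (b ^ H) * exp (2 * real h * real l * p * \<theta>\<^sup>2)) / real l"
    by (intro divide_right_mono sum_mono class_bound) auto
  also have "\<dots> = real (b ^ H) * exp (2 * real h * real l * p * \<theta>\<^sup>2)"
    using l by simp
  finally show ?thesis .
qed

text \<open>
  The exponential Markov inequality for both signs. The parameter \<open>\<theta>\<close> is left open since the best
  choice depends on the size of \<open>p\<close>.
\<close>

lemma card_large_window_sum:
  fixes g :: "nat \<Rightarrow> real"
  assumes b: "b > 0" and l: "l > 0" "l \<le> h" and H: "i0 + h + l \<le> Suc H"
    and g0: "(\<Sum>d<b ^ l. g d) = 0" and g1: "\<And>d. d < b ^ l \<Longrightarrow> \<bar>g d\<bar> \<le> 1"
    and g2: "(\<Sum>d<b ^ l. (g d)\<^sup>2) \<le> p * real (b ^ l)"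
    and \<theta>: "0 \<le> \<theta>" "\<theta> * real l \<le> 1"
  shows "real (card {v. v < b ^ H \<and> t < \<bar>\<Sum>i<h. g (v div b ^ (i0 + i) mod b ^ l)\<bar>})
    \<le> 2 * real (b ^ H) * exp (2 * real h * real l * p * \<theta>\<^sup>2 - \<theta> * t)"
proof -
  define S where "S = (\<lambda>v. \<Sum>i<h. g (v div b ^ (i0 + i) mod b ^ l))"
  define R where "R = real (b ^ H) * exp (2 * real h * real l * p * \<theta>\<^sup>2)"
  have "real (card {v. v < b ^ H \<and> t < \<bar>S v\<bar>}) * exp (\<theta> * t)
    = (\<Sum>v\<in>{v. v < b ^ H \<and> t < \<bar>S v\<bar>}. exp (\<theta> * t))" by simp
  also have "\<dots> \<le> (\<Sum>v\<in>{v. v < b ^ H \<and> t < \<bar>S v\<bar>}. exp (\<theta> * S v) + exp ((- \<theta>) * S v))"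
  proof (intro sum_mono)
    fix v assume "v \<in> {v. v < b ^ H \<and> t < \<bar>S v\<bar>}"
    hence "\<theta> * t \<le> \<theta> * \<bar>S v\<bar>" using \<theta> by (intro mult_left_mono) auto
    hence "exp (\<theta> * t) \<le> exp (\<theta> * \<bar>S v\<bar>)" by simp
    also have "\<dots> \<le> exp (\<theta> * S v) + exp ((- \<theta>) * S v)" by (cases "S v \<ge> 0") (auto)
    finally show "exp (\<theta> * t) \<le> exp (\<theta> * S v) + exp ((- \<theta>) * S v)" .
  qed
  also have "\<dots> \<le> (\<Sum>v<b ^ H. exp (\<theta> * S v) + exp ((- \<theta>) * S v))"
    by (intro sum_mono2) auto
  also have "\<dots> \<le> R + R"
    unfolding sum.distrib S_def R_def
    using exp_moment_windows[OF b l H g0 g1 g2, of \<theta>] exp_moment_windows[OF b l H g0 g1 g2, of "-\<theta>"] \<theta>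
    by (intro add_mono) auto
  finally have "real (card {v. v < b ^ H \<and> t < \<bar>S v\<bar>}) \<le> 2 * R / exp (\<theta> * t)"
    by (simp add: field_simps)
  thus ?thesis by (simp add: S_def R_def exp_diff mult.assoc)
qed

section \<open>Chaining over dyadic times and word lengths\<close>

text \<open>
  The binary expansion of \<open>q\<close> cuts \<open>{..<q}\<close> into at most one aligned dyadic interval of each length.
  In the induction neighbouring terms are merged, which shifts the lengths by one; an odd \<open>q\<close> leaves
  one term over.
\<close>

lemma dyadic_chaining:
  fixes \<phi> :: "nat \<Rightarrow> real"
  assumes "q < 2 ^ R" "\<And>i. 0 \<le> \<tau> i"
    and "\<And>i s. i < R \<Longrightarrow> Suc s * 2 ^ i \<le> q \<Longrightarrow> \<bar>\<Sum>j<2 ^ i. \<phi> (s * 2 ^ i + j)\<bar> \<le> \<tau> i"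
  shows "\<bar>\<Sum>j<q. \<phi> j\<bar> \<le> (\<Sum>i<R. \<tau> i)"
  using assms
proof (induction R arbitrary: \<phi> \<tau> q)
  case (Suc R)
  define q' where "q' = q div 2"
  define \<psi> where "\<psi> j = \<phi> (2 * j) + \<phi> (2 * j + 1)" for j
  have pair: "(\<Sum>j<2 * n. \<phi> (2 * a + j)) = (\<Sum>j<n. \<psi> (a + j))" for a n
    by (induction n) (auto simp: \<psi>_def algebra_simps)
  have IH: "\<bar>\<Sum>j<q'. \<psi> j\<bar> \<le> (\<Sum>i<R. \<tau> (Suc i))"
  proof (rule Suc.IH)
    show "q' < 2 ^ R" using Suc.prems(1) by (simp add: q'_def)
    show "0 \<le> \<tau> (Suc i)" for i by (rule Suc.prems)
    fix i s assume i: "i < R" and s: "Suc s * 2 ^ i \<le> q'"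
    have "Suc s * 2 ^ Suc i \<le> q" using s by (simp add: q'_def)
    hence "\<bar>\<Sum>j<2 ^ Suc i. \<phi> (s * 2 ^ Suc i + j)\<bar> \<le> \<tau> (Suc i)"
      using i by (intro Suc.prems) auto
    thus "\<bar>\<Sum>j<2 ^ i. \<psi> (s * 2 ^ i + j)\<bar> \<le> \<tau> (Suc i)"
      using pair[of "s * 2 ^ i" "2 ^ i"] by (simp add: mult.left_commute)
  qed
  have split: "(\<Sum>j<q. \<phi> j) = (\<Sum>j<q'. \<psi> j) + (if odd q then \<phi> (2 * q') else 0)"
  proof (cases "odd q")
    case True
    hence "q = Suc (2 * q')" by (simp add: q'_def)
    thus ?thesis using pair[where n = q' and a = 0] True by simp
  next
    case False
    hence "q = 2 * q'" by (simp add: q'_def)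
    thus ?thesis using pair[where n = q' and a = 0] False by simp
  qed
  have "\<bar>if odd q then \<phi> (2 * q') else 0\<bar> \<le> \<tau> 0"
  proof (cases "odd q")
    case True
    hence "Suc (2 * q') = q" by (simp add: q'_def)
    thus ?thesis using Suc.prems(3)[of 0 "2 * q'"] True by simp
  qed (use Suc.prems(2) in simp)
  hence "\<bar>\<Sum>j<q. \<phi> j\<bar> \<le> (\<Sum>i<R. \<tau> (Suc i)) + \<tau> 0"
    unfolding split using IH by linarith
  also have "\<dots> = (\<Sum>i<Suc R. \<tau> i)" by (subst sum.lessThan_Suc_shift) simp
  finally show ?case .
qed simp

text \<open>
  The event that a word \<open>w\<close> of length \<open>l\<close> agrees with \<open>c\<close> except for the last digit, which is smaller
  than that of \<open>c\<close>, minus its probability. It has probability less than \<open>b / b ^ l\<close>.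
\<close>

definition increment :: "nat \<Rightarrow> nat \<Rightarrow> nat \<Rightarrow> nat \<Rightarrow> real" where
  "increment b l c w = of_bool (b * (c div b) \<le> w \<and> w < c) - real (c mod b) / real (b ^ l)"

text \<open>
  A word is smaller than \<open>c\<close> iff it is smaller at the first digit in which they differ; the summand for \<open>i\<close>
  is the centred indicator that it is smaller and that they first differ at place \<open>i\<close>, counted from 0.
\<close>

lemma sum_increment:
  assumes b: "b \<ge> 2" and w: "w < b ^ k" and c: "c < b ^ k"
  shows "of_bool (w < c) - real c / real (b ^ k)
    = (\<Sum>i<k. increment b (Suc i) (c div b ^ (k - Suc i)) (w div b ^ (k - Suc i)))"
  using w c
proof (induction k arbitrary: w c)
  case (Suc k)
  have IH: "of_bool (w div b < c div b) - real (c div b) / real (b ^ k)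
    = (\<Sum>i<k. increment b (Suc i) (c div b div b ^ (k - Suc i)) (w div b div b ^ (k - Suc i)))"
    using Suc.prems b by (intro Suc.IH) (auto simp: less_mult_imp_div_less mult.commute)
  have s: "x div b div b ^ (k - Suc i) = x div b ^ (Suc k - Suc i)" if "i < k" for x i
  proof -
    have "Suc k - Suc i = Suc (k - Suc i)" using that by simp
    thus ?thesis by (simp add: div_mult2_eq)
  qed
  have ind: "of_bool (w < c) = (of_bool (w div b < c div b) + of_bool (b * (c div b) \<le> w \<and> w < c) :: real)"
  proof -
    have "w div b < c div b \<longleftrightarrow> w < b * (c div b)"
      using b by (simp add: div_less_iff_less_mult mult.commute)
    moreover have "b * (c div b) \<le> c" by simp
    ultimately show ?thesis by (auto simp del: times_div_less_eq_dividend)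
  qed
  have frac: "real c / real (b ^ Suc k) = real (c div b) / real (b ^ k) + real (c mod b) / real (b ^ Suc k)"
  proof -
    have "real c = real b * real (c div b) + real (c mod b)"
      by (metis mult_div_mod_eq of_nat_add of_nat_mult)
    also have "\<dots> / real (b ^ Suc k) = real (c div b) / real (b ^ k) + real (c mod b) / real (b ^ Suc k)"
      using b by (simp add: field_simps del: mult_div_mod_eq)
    finally show ?thesis .
  qed
  have "(\<Sum>i<k. increment b (Suc i) (c div b div b ^ (k - Suc i)) (w div b div b ^ (k - Suc i)))
      = (\<Sum>i<k. increment b (Suc i) (c div b ^ (Suc k - Suc i)) (w div b ^ (Suc k - Suc i)))"
    by (intro sum.cong refl) (simp only: s lessThan_iff)
  thus ?case unfolding ind frac sum.lessThan_Suc using IH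
    by (simp add: increment_def)
qed simp

lemma increment_moments:
  assumes b: "b \<ge> 2" and l: "l \<ge> 1" and c: "c < b ^ l"
  shows "(\<Sum>w<b ^ l. increment b l c w) = 0"
    and "\<bar>increment b l c w\<bar> \<le> 1"
    and "(\<Sum>w<b ^ l. (increment b l c w)\<^sup>2) \<le> real b / real (b ^ l) * real (b ^ l)"
proof -
  define q where "q = real (c mod b) / real (b ^ l)"
  have bl: "b ^ l \<ge> b" using b l by (simp add: self_le_power)
  have cb: "c mod b < b" using b by simp
  have q: "0 \<le> q" "q \<le> 1" using less_le_trans[OF cb bl] b unfolding q_def
    by (auto simp: divide_le_eq_1 simp flip: of_nat_power)
  show "\<bar>increment b l c w\<bar> \<le> 1"
    unfolding increment_def q_def[symmetric] using q by auto
  have "{..<b ^ l} \<inter> {w. b * (c div b) \<le> w \<and> w < c} = {b * (c div b)..<c}" using c by auto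
  hence ind: "(\<Sum>w<b ^ l. of_bool (b * (c div b) \<le> w \<and> w < c)) = real (c mod b)"
    by (simp add: sum.If_cases of_bool_def minus_mult_div_eq_mod)
  have qb: "real (b ^ l) * q = real (c mod b)" using b by (simp add: q_def)
  show "(\<Sum>w<b ^ l. increment b l c w) = 0"
    unfolding increment_def q_def[symmetric] sum_subtractf ind using qb by simp
  have "(\<Sum>w<b ^ l. (increment b l c w)\<^sup>2)
     = (\<Sum>w<b ^ l. of_bool (b * (c div b) \<le> w \<and> w < c) - 2 * q * of_bool (b * (c div b) \<le> w \<and> w < c) + q\<^sup>2)"
    unfolding increment_def q_def[symmetric]
    by (intro sum.cong refl) (auto simp: power2_eq_square algebra_simps)
  also have "\<dots> = real (c mod b) - 2 * q * real (c mod b) + real (b ^ l) * q\<^sup>2"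
    unfolding sum.distrib sum_subtractf sum_distrib_left[symmetric] ind by simp
  also have "real (b ^ l) * q\<^sup>2 = q * real (c mod b)"
    using qb by (simp add: power2_eq_square)
  also have "real (c mod b) - 2 * q * real (c mod b) + q * real (c mod b) = real (c mod b) - q * real (c mod b)"
    by simp
  also have "\<dots> \<le> real b"
  proof -
    have "0 \<le> q * real (c mod b)" using q by simp
    moreover have "real (c mod b) \<le> real b" using cb by simp
    ultimately show ?thesis by linarith
  qed
  finally show "(\<Sum>w<b ^ l. (increment b l c w)\<^sup>2) \<le> real b / real (b ^ l) * real (b ^ l)"
    using b by simp
qed

text \<open>
  A block of \<open>H\<close> digits is encoded as a number \<open>v\<close>, first digit most significant, and
  \<open>digit_word b H l v j\<close> consists of its digits \<open>j\<close> to \<open>j + l - 1\<close>. It is meaningful if \<open>j + l \<le> H\<close>.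
\<close>

definition digit_word :: "nat \<Rightarrow> nat \<Rightarrow> nat \<Rightarrow> nat \<Rightarrow> nat \<Rightarrow> nat" where
  "digit_word b H l v j = v div b ^ (H - l - j) mod b ^ l"

definition hits :: "nat \<Rightarrow> nat \<Rightarrow> nat \<Rightarrow> nat \<Rightarrow> nat \<Rightarrow> nat \<Rightarrow> nat" where
  "hits b k H v M c = card {j. j < M \<and> digit_word b H k v j < c}"

text \<open>
  The deviation of the number of hits from its mean \<open>M c / b ^ k\<close> is at most \<open>801 \<surd>b 2 ^ k\<close> for all
  initial segments and grid points; squaring and clearing denominators makes this a statement about
  integers, which a program can test. Exactly the windows with start \<open>j \<le> H - k\<close> fit into the block, hence
  the bound on \<open>M\<close>.
\<close>

definition balanced :: "nat \<Rightarrow> nat \<Rightarrow> nat \<Rightarrow> nat \<Rightarrow> bool" where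
  "balanced b k H v \<longleftrightarrow> (\<forall>M c. M \<le> H + 1 - k \<longrightarrow> c < b ^ k \<longrightarrow>
     (int (hits b k H v M c) * int (b ^ k) - int M * int c)\<^sup>2
       \<le> 801\<^sup>2 * 4 ^ k * int b * (int (b ^ k))\<^sup>2)"

text \<open>
  The permitted deviation for word length \<open>l\<close> and segments of length \<open>4 * 4 ^ k / 2 ^ m\<close>. The sum of
  \<open>(4/5) ^ (l + m)\<close> over \<open>l, m \<ge> 1\<close> is 16, so all thresholds together amount to \<open>800 \<surd>b 2 ^ k\<close>.
\<close>

definition threshold :: "nat \<Rightarrow> nat \<Rightarrow> nat \<Rightarrow> nat \<Rightarrow> real" where
  "threshold b k l m = 50 * sqrt (real b) * 2 ^ k * (4/5) ^ (l + m)"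

lemma digit_word_prefix:
  assumes b: "b > 0" and "l \<le> k" "j + k \<le> H"
  shows "digit_word b H k v j div b ^ (k - l) = digit_word b H l v j"
proof -
  have k: "k = l + (k - l)" and H: "H - l - j = (H - k - j) + (k - l)" using assms by auto
  have "b ^ k = b ^ (k - l) * b ^ l" using k by (metis mult.commute power_add)
  hence "digit_word b H k v j div b ^ (k - l) = v div b ^ (H - k - j) div b ^ (k - l) mod b ^ l"
    unfolding digit_word_def using b by (simp add: mod_mult2_eq)
  also have "\<dots> = digit_word b H l v j"
    unfolding digit_word_def H by (simp add: div_mult2_eq power_add)
  finally show ?thesis .
qed

lemma hits_eq_sum: "real (hits b k H v M c) = (\<Sum>j<M. of_bool (digit_word b H k v j < c))"
proof -
  have "{..<M} \<inter> {j. digit_word b H k v j < c} = {j. j < M \<and> digit_word b H k v j < c}" by auto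
  thus ?thesis by (simp add: hits_def of_bool_def sum.If_cases)
qed

lemma geometric_sum_bounds:
  "(\<Sum>i<n. (4/5::real) ^ Suc i) \<le> 4" "(\<Sum>i<n. (1/2::real) ^ Suc i) \<le> 1"
  "(\<Sum>i<n. (4/5::real) ^ (n - i)) \<le> 4" "(\<Sum>i<n. (1/2::real) ^ (n - i)) \<le> 1"
proof -
  have rev: "(\<Sum>i<n. x ^ (n - i)) = (\<Sum>i<n. x ^ Suc i)" for x :: real
  proof -
    have "(\<Sum>i<n. x ^ Suc i) = (\<Sum>i<n. x ^ Suc (n - Suc i))"
      by (rule sum.nat_diff_reindex[symmetric])
    also have "\<dots> = (\<Sum>i<n. x ^ (n - i))"
      by (intro sum.cong refl) (metis Suc_diff_Suc lessThan_iff)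
    finally show ?thesis by simp
  qed
  have "(\<Sum>i<n. (4/5::real) ^ Suc i) = 4 - 4 * (4/5) ^ n" by (induction n) auto
  thus 1: "(\<Sum>i<n. (4/5::real) ^ Suc i) \<le> 4" by simp
  have "(\<Sum>i<n. (1/2::real) ^ Suc i) = 1 - (1/2) ^ n" by (induction n) auto
  thus 2: "(\<Sum>i<n. (1/2::real) ^ Suc i) \<le> 1" by simp
  show "(\<Sum>i<n. (4/5::real) ^ (n - i)) \<le> 4" "(\<Sum>i<n. (1/2::real) ^ (n - i)) \<le> 1"
    using 1 2 by (simp_all only: rev)
qed

text \<open>
  The \<open>M mod 2 ^ k\<close> last windows contribute at most \<open>2 ^ k\<close> trivially. The others are grouped into units of
  \<open>2 ^ k\<close> windows, to which both chainings apply.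
\<close>

lemma balancedI:
  assumes b: "b \<ge> 2" and k: "k \<ge> 2" and H: "H \<le> 4 ^ Suc k" and v: "v < b ^ H"
    and small: "\<And>l c i s. 1 \<le> l \<Longrightarrow> l \<le> k \<Longrightarrow> c < b ^ l \<Longrightarrow> i < k + 2 \<Longrightarrow> Suc s * 2 ^ (k + i) \<le> H + 1 - k \<Longrightarrow>
      \<bar>\<Sum>j<2 ^ (k + i). increment b l c (digit_word b H l v (s * 2 ^ (k + i) + j))\<bar> \<le> threshold b k l (k + 2 - i)"
  shows "balanced b k H v"
  unfolding balanced_def
proof (intro allI impI)
  fix M c assume M: "M \<le> H + 1 - k" and c: "c < b ^ k"
  define D where "D = (\<lambda>j. of_bool (digit_word b H k v j < c) - real c / real (b ^ k))"
  define q where "q = M div 2 ^ k"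
  have D1: "\<bar>D j\<bar> \<le> 1" for j
  proof -
    have "real c / real (b ^ k) \<le> 1" "0 \<le> real c / real (b ^ k)" using c b by (auto simp: divide_le_eq_1)
    thus ?thesis by (auto simp: D_def)
  qed
  have level: "\<bar>\<Sum>j<q * 2 ^ k. increment b l c' (digit_word b H l v j)\<bar> \<le> (\<Sum>i<k+2. threshold b k l (k + 2 - i))"
    if l: "1 \<le> l" "l \<le> k" and c': "c' < b ^ l" for l c'
  proof -
    define \<phi> where "\<phi> = (\<lambda>a. \<Sum>j<2 ^ k. increment b l c' (digit_word b H l v (a * 2 ^ k + j)))"
    have "\<bar>\<Sum>a<q. \<phi> a\<bar> \<le> (\<Sum>i<k+2. threshold b k l (k + 2 - i))"
    proof (rule dyadic_chaining)
      have "M < 2 ^ (k + 2) * 2 ^ k"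
      proof -
        have "(4::nat) ^ Suc k = 2 ^ (k + 2) * 2 ^ k"
          by (simp add: power_add[symmetric] power_mult[symmetric] mult_2[symmetric])
             (simp add: power_mult)
        moreover have "M < n" if "M \<le> H + 1 - k" "H \<le> n" "0 < n" for n
          using that k by linarith
        ultimately show ?thesis using M H by simp
      qed
      thus "q < 2 ^ (k + 2)" by (simp add: q_def less_mult_imp_div_less)
      show "0 \<le> threshold b k l (k + 2 - i)" for i by (simp add: threshold_def)
      fix i s assume i: "i < k + 2" and s: "Suc s * 2 ^ i \<le> q"
      have "Suc s * 2 ^ (k + i) = Suc s * 2 ^ i * 2 ^ k" by (simp only: power_add mult_ac)
      also have "\<dots> \<le> q * 2 ^ k" using s by (intro mult_right_mono) auto
      also have "\<dots> \<le> M" by (simp add: q_def)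
      finally have s': "Suc s * 2 ^ (k + i) \<le> H + 1 - k" using M by simp
      have "(\<Sum>j<2 ^ (k + i). increment b l c' (digit_word b H l v (s * 2 ^ (k + i) + j)))
          = (\<Sum>j<2 ^ i. \<phi> (s * 2 ^ i + j))"
        unfolding \<phi>_def using sum_lessThan_mult[where m = "2 ^ k" and n = "2 ^ i" and f = "\<lambda>j. increment b l c' (digit_word b H l v (s * 2 ^ (k + i) + j))"]
        by (simp add: power_add mult.commute mult.left_commute add.assoc distrib_left)
      thus "\<bar>\<Sum>j<2 ^ i. \<phi> (s * 2 ^ i + j)\<bar> \<le> threshold b k l (k + 2 - i)"
        using small[OF l c' i s'] by simp
    qed
    thus ?thesis using sum_lessThan_mult[where m = "2 ^ k" and n = q and f = "\<lambda>j. increment b l c' (digit_word b H l v j)"]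
      by (simp add: \<phi>_def)
  qed
  have main: "\<bar>\<Sum>j<q * 2 ^ k. D j\<bar> \<le> 800 * sqrt b * 2 ^ k"
  proof -
    have "(\<Sum>j<q * 2 ^ k. D j) = (\<Sum>j<q * 2 ^ k. \<Sum>i<k. increment b (Suc i) (c div b ^ (k - Suc i)) (digit_word b H (Suc i) v j))"
    proof (intro sum.cong refl)
      fix j assume "j \<in> {..<q * 2 ^ k}"
      hence "j < M" by (simp add: q_def) (metis div_times_less_eq_dividend less_le_trans)
      hence j: "j + k \<le> H" using M by linarith
      have "digit_word b H k v j < b ^ k" using b by (simp add: digit_word_def)
      hence "D j = (\<Sum>i<k. increment b (Suc i) (c div b ^ (k - Suc i)) (digit_word b H k v j div b ^ (k - Suc i)))"
        unfolding D_def using b c by (intro sum_increment) auto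
      also have "\<dots> = (\<Sum>i<k. increment b (Suc i) (c div b ^ (k - Suc i)) (digit_word b H (Suc i) v j))"
        using digit_word_prefix[of b _ k j H v] b j by (intro sum.cong refl) auto
      finally show "D j = (\<Sum>i<k. increment b (Suc i) (c div b ^ (k - Suc i)) (digit_word b H (Suc i) v j))" .
    qed
    also have "\<dots> = (\<Sum>i<k. \<Sum>j<q * 2 ^ k. increment b (Suc i) (c div b ^ (k - Suc i)) (digit_word b H (Suc i) v j))"
      by (rule sum.swap)
    finally have "\<bar>\<Sum>j<q * 2 ^ k. D j\<bar> = \<bar>\<Sum>i<k. \<Sum>j<q * 2 ^ k. increment b (Suc i) (c div b ^ (k - Suc i)) (digit_word b H (Suc i) v j)\<bar>"
      by (rule arg_cong)
    also have "\<dots> \<le> (\<Sum>i<k. \<Sum>m<k+2. threshold b k (Suc i) (k + 2 - m))"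
    proof (rule order.trans[OF sum_abs sum_mono])
      fix i assume "i \<in> {..<k}"
      hence i: "k - Suc i + Suc i = k" by simp
      have "b ^ Suc i * b ^ (k - Suc i) = b ^ k" using i by (metis power_add add.commute)
      hence "c div b ^ (k - Suc i) < b ^ Suc i" using c by (intro less_mult_imp_div_less) simp
      thus "\<bar>\<Sum>j<q * 2 ^ k. increment b (Suc i) (c div b ^ (k - Suc i)) (digit_word b H (Suc i) v j)\<bar>
          \<le> (\<Sum>m<k+2. threshold b k (Suc i) (k + 2 - m))"
        using i by (intro level) auto
    qed
    also have "\<dots> = 50 * sqrt b * 2 ^ k * ((\<Sum>i<k. (4/5) ^ Suc i) * (\<Sum>m<k+2. (4/5) ^ (k + 2 - m)))"
      unfolding sum_product unfolding sum_distrib_left threshold_def power_add[of "4/5::real"]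
      by (rule refl)
    also have "\<dots> \<le> 50 * sqrt b * 2 ^ k * (4 * 4)"
      by (intro mult_left_mono mult_mono geometric_sum_bounds sum_nonneg) auto
    finally show ?thesis by simp
  qed
  have "M = q * 2 ^ k + M mod 2 ^ k" unfolding q_def by (rule div_mult_mod_eq[symmetric])
  hence "(\<Sum>j<M. D j) = (\<Sum>j<q * 2 ^ k. D j) + (\<Sum>j<M mod 2 ^ k. D (q * 2 ^ k + j))"
    by (metis sum_lessThan_add)
  hence "\<bar>\<Sum>j<M. D j\<bar> = \<bar>(\<Sum>j<q * 2 ^ k. D j) + (\<Sum>j<M mod 2 ^ k. D (q * 2 ^ k + j))\<bar>"
    by (rule arg_cong)
  also have "\<dots> \<le> 800 * sqrt b * 2 ^ k + (\<Sum>j<M mod 2 ^ k. 1)"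
    by (intro order.trans[OF abs_triangle_ineq] add_mono main order.trans[OF sum_abs] sum_mono D1)
  also have "\<dots> \<le> 800 * sqrt b * 2 ^ k + 1 * 2 ^ k"
  proof -
    have "M mod 2 ^ k \<le> 2 ^ k" by (simp add: less_imp_le)
    hence "real (M mod 2 ^ k) \<le> real (2 ^ k)" by (rule of_nat_mono)
    thus ?thesis by simp
  qed
  also have "\<dots> \<le> 800 * sqrt b * 2 ^ k + sqrt b * 2 ^ k"
    using b by (intro add_left_mono mult_right_mono) auto
  also have "\<dots> = 801 * sqrt b * 2 ^ k" by simp
  finally have dev: "\<bar>\<Sum>j<M. D j\<bar> \<le> 801 * sqrt b * 2 ^ k" .
  have "(\<Sum>j<M. D j) = real (hits b k H v M c) - real M * (real c / real (b ^ k))"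
    by (simp add: D_def hits_eq_sum sum_subtractf)
  hence "(\<Sum>j<M. D j) * real (b ^ k) = real (hits b k H v M c) * real (b ^ k) - real M * real c"
    using b by (simp add: left_diff_distrib)
  hence "(real (hits b k H v M c) * real (b ^ k) - real M * real c)\<^sup>2 = (\<bar>\<Sum>j<M. D j\<bar> * real (b ^ k))\<^sup>2"
    by (metis power2_abs power_mult_distrib)
  also have "\<dots> \<le> (801 * sqrt b * 2 ^ k * real (b ^ k))\<^sup>2"
    by (intro power_mono mult_right_mono dev) auto
  also have "\<dots> = 801\<^sup>2 * 4 ^ k * real b * (real (b ^ k))\<^sup>2"
    by (simp add: power_mult_distrib power_mult[symmetric] mult.commute[of k]) (simp add: power_mult)
  finally have "real_of_int ((int (hits b k H v M c) * int (b ^ k) - int M * int c)\<^sup>2)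
       \<le> real_of_int (801\<^sup>2 * 4 ^ k * int b * (int (b ^ k))\<^sup>2)"
    by simp
  thus "(int (hits b k H v M c) * int (b ^ k) - int M * int c)\<^sup>2 \<le> 801\<^sup>2 * 4 ^ k * int b * (int (b ^ k))\<^sup>2"
    by (simp only: of_int_le_iff)
qed

section \<open>Unbalanced blocks are rare\<close>

lemma square_le_exp: 
  fixes y :: real
  assumes "y \<ge> 0" shows "y\<^sup>2 \<le> exp y"
proof -
  have "y \<le> 1 + y/2 + (y/2)\<^sup>2 / 2"
    using zero_le_square[of "y/2 - 1"] by (simp add: power2_eq_square field_simps)
  also have "\<dots> \<le> exp (y/2)" using assms by (intro exp_lower_Taylor_quadratic) simp
  finally have "y\<^sup>2 \<le> (exp (y/2))\<^sup>2" using assms by (intro power_mono)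
  thus ?thesis by (simp add: exp_double[symmetric])
qed

lemma two_le_exp_half_sqrt:
  assumes "b \<ge> (2::real)" shows "2 \<le> exp (sqrt b / 2)"
proof -
  have "(2::real) \<le> (119/100) ^ 4" by (simp add: power4_eq_xxxx)
  also have "(119/100::real) ^ 4 \<le> exp (7/40) ^ 4"
    using exp_lower_Taylor_quadratic[of "7/40::real"] by (intro power_mono) (auto simp: power2_eq_square)
  also have "\<dots> = exp (7/10::real)" by (simp flip: exp_of_nat_mult)
  also have "\<dots> \<le> exp (sqrt b / 2)"
  proof -
    have "sqrt ((7/5)\<^sup>2) \<le> sqrt b" using assms by (intro real_sqrt_le_mono) (simp add: power2_eq_square)
    thus ?thesis by simp
  qed
  finally show ?thesis .
qed

text \<open>
  The factor \<open>l\<close> lost by splitting into residue classes is absorbed by the geometric decay of the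
  variance.
\<close>

lemma nat_times_power_le: "real l * (8/9) ^ l \<le> 4"
proof -
  have "real l \<le> 4 * (9/8) ^ l"
  proof (induction l)
    case (Suc l)
    show ?case
    proof (cases "l \<le> 7")
      case True
      have "real (Suc l) \<le> 4 * (1 + real (Suc l) * (1/8))"
        using of_nat_mono[OF True, where 'a = real] by (simp add: field_simps)
      also have "\<dots> \<le> 4 * (9/8) ^ Suc l"
        using Bernoulli_inequality[of "1/8::real" "Suc l"]
        by (intro mult_left_mono) (simp_all del: power_Suc)
      finally show ?thesis .
    next
      case False
      have "real (Suc l) \<le> 9/8 * real l" using False by simp
      also have "\<dots> \<le> 9/8 * (4 * (9/8) ^ l)" using Suc by simp
      finally show ?thesis by simp
    qed
  qed simp
  hence "real l * (8/9) ^ l \<le> 4 * (9/8) ^ l * (8/9) ^ l" by (intro mult_right_mono) auto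
  also have "\<dots> = 4" by (simp add: power_mult_distrib[symmetric] mult.assoc)
  finally show ?thesis .
qed

text \<open>
  The parameter of the Markov inequality. The base \<open>4/3\<close> satisfies \<open>(4/3)\<^sup>2 < 2\<close>, so the variance term
  stays bounded, and \<open>(4/3) * (4/5) > 1\<close>, so the gain grows with \<open>l + m\<close>.
\<close>

definition tilt :: "nat \<Rightarrow> nat \<Rightarrow> nat \<Rightarrow> real" where
  "tilt k l m = (4/3) ^ (l + m) / (2 * 2 ^ k)"

text \<open>
  The left-hand side multiplies the Chernoff bound by \<open>2 ^ m * b ^ l\<close>, which bounds the number of pairs of a segment
  and a word. With \<open>u = l + m\<close> and \<open>y = \<surd>b\<close> the exponent is at most \<open>16 - 25 y - (5/3) y u\<close>, and by
  \<open>b \<le> exp y\<close> and \<open>2 \<le> exp (y / 2)\<close> this outweighs all other factors.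
\<close>

lemma tail_estimate:
  assumes b: "b \<ge> 2" and l: "l \<ge> 1" and m: "m \<le> k + 2"
  shows "2 * exp (2 * real (2 ^ (2 * k + 2 - m)) * real l * (real b / real (b ^ l)) * (tilt k l m)\<^sup>2
       - tilt k l m * threshold b k l m) * real (2 ^ m) * real (b ^ l)
    \<le> (1/2) ^ (l + m) / (16 * real b ^ 3)"
proof -
  define y where "y = sqrt (real b)"
  define u where "u = l + m"
  have y0: "y \<ge> 0" and y2: "y\<^sup>2 = real b" by (auto simp: y_def)
  have y1: "y \<ge> 4/3"
  proof -
    have "sqrt ((4/3)\<^sup>2) \<le> sqrt (real b)" using b by (intro real_sqrt_le_mono) (simp add: power2_eq_square)
    thus ?thesis by (simp add: y_def)
  qed
  have b_exp: "real b \<le> exp y" using square_le_exp[OF y0] y2 by simp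
  have two_exp: "2 \<le> exp (y / 2)" using two_le_exp_half_sqrt[of "real b"] b by (simp add: y_def)
  have var: "2 * real (2 ^ (2 * k + 2 - m)) * real l * (real b / real (b ^ l)) * (tilt k l m)\<^sup>2 \<le> 16"
  proof -
    have bl: "real b / real (b ^ l) \<le> 2 / 2 ^ l"
    proof -
      obtain l' where l': "l = Suc l'" using l by (cases l) auto
      have "(2::real) ^ l' \<le> real b ^ l'" using b by (intro power_mono) auto
      thus ?thesis using b by (simp add: l' field_simps)
    qed
    have hm: "real (2 ^ (2 * k + 2 - m)) = 4 * 4 ^ k / 2 ^ m"
      using m unfolding of_nat_power of_nat_numeral
      by (subst power_diff) (simp_all add: power_add power_mult)
    have t2: "(tilt k l m)\<^sup>2 = (16/9) ^ u / (4 * 4 ^ k)"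
    proof -
      have "((4/3::real) ^ u)\<^sup>2 = (16/9) ^ u"
        unfolding power2_eq_square power_mult_distrib[symmetric] by simp
      moreover have "(2 * 2 ^ k :: real)\<^sup>2 = 4 * 4 ^ k"
        by (simp add: power2_eq_square flip: power_mult_distrib)
      ultimately show ?thesis by (simp only: tilt_def u_def power_divide)
    qed
    have "2 * real (2 ^ (2 * k + 2 - m)) * real l * (real b / real (b ^ l)) * (tilt k l m)\<^sup>2
        \<le> 2 * real (2 ^ (2 * k + 2 - m)) * real l * (2 / 2 ^ l) * (tilt k l m)\<^sup>2"
      by (intro mult_right_mono mult_left_mono bl) auto
    also have "\<dots> = 4 * (real l * ((16/9) ^ u / 2 ^ u))"
      unfolding hm t2 by (simp add: u_def power_add field_simps)
    also have "(16/9::real) ^ u / 2 ^ u = (8/9) ^ l * (8/9) ^ m"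
      unfolding power_divide[symmetric] by (simp add: u_def power_add)
    also have "4 * (real l * ((8/9) ^ l * (8/9) ^ m)) = 4 * (real l * (8/9) ^ l) * (8/9) ^ m" by simp
    also have "\<dots> \<le> 4 * 4 * 1"
      by (intro mult_mono nat_times_power_le power_le_one) auto
    finally show ?thesis by simp
  qed
  have gain: "tilt k l m * threshold b k l m \<ge> 25 * y + 5/3 * y * real u"
  proof -
    have "tilt k l m * threshold b k l m = 25 * y * ((4/3) ^ u * (4/5) ^ u)"
      by (simp add: tilt_def threshold_def y_def u_def)
    also have "(4/3::real) ^ u * (4/5) ^ u = (1 + 1/15) ^ u"
      by (simp add: power_mult_distrib[symmetric])
    also have "25 * y * (1 + 1/15) ^ u \<ge> 25 * y * (1 + real u * (1/15))"
      using y0 by (intro mult_left_mono Bernoulli_inequality) auto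
    finally show ?thesis by (simp add: algebra_simps)
  qed
  have "2 * real (2 ^ m) * real (b ^ l) * (16 * real b ^ 3) * 2 ^ u = 2 ^ (5 + m + u) * real b ^ (l + 3)"
    by (simp add: power_add)
  also have "\<dots> \<le> exp (y / 2) ^ (5 + m + u) * exp y ^ (l + 3)"
    by (intro mult_mono power_mono b_exp two_exp) auto
  also have "\<dots> = exp (real (5 + m + u) * (y/2) + real (l + 3) * y)"
    unfolding exp_of_nat_mult[symmetric] exp_add[symmetric] by simp
  also have "\<dots> \<le> exp (25 * y + 5/3 * y * real u - 16)"
  proof -
    have "0 \<le> y * real l" "0 \<le> y * real m" using y0 by auto
    moreover have "real (5 + m + u) * (y/2) + real (l + 3) * y = 11/2 * y + 3/2 * (y * real l) + y * real m"
      by (simp add: u_def field_simps)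
    moreover have "25 * y + 5/3 * y * real u - 16 = 25 * y + 5/3 * (y * real l) + 5/3 * (y * real m) - 16"
      by (simp add: u_def field_simps)
    ultimately have "real (5 + m + u) * (y/2) + real (l + 3) * y \<le> 25 * y + 5/3 * y * real u - 16"
      using y1 by linarith
    thus ?thesis by simp
  qed
  finally have key: "2 * real (2 ^ m) * real (b ^ l) * (16 * real b ^ 3) * 2 ^ u \<le> exp (25 * y + 5/3 * y * real u - 16)" .
  have "2 * exp (2 * real (2 ^ (2 * k + 2 - m)) * real l * (real b / real (b ^ l)) * (tilt k l m)\<^sup>2
       - tilt k l m * threshold b k l m) * real (2 ^ m) * real (b ^ l)
     \<le> 2 * exp (- (25 * y + 5/3 * y * real u - 16)) * real (2 ^ m) * real (b ^ l)"
    using var gain by (intro mult_right_mono mult_left_mono) auto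
  also have "\<dots> = 2 * real (2 ^ m) * real (b ^ l) / exp (25 * y + 5/3 * y * real u - 16)"
    by (simp add: exp_minus field_simps)
  also have "\<dots> \<le> (1/2) ^ u / (16 * real b ^ 3)"
    using key b by (simp add: field_simps)
  finally show ?thesis by (simp add: u_def)
qed

text \<open>
  From scale 30 on the tilt meets the condition \<open>\<theta> l \<le> 1\<close> of the moment bound for all lengths in use.
\<close>

lemma tilt_small:
  assumes "k \<ge> 30"
  shows "(4/3) ^ (2 * k + 2) * real k \<le> 2 * 2 ^ k"
proof -
  have "(16/9) ^ (k + 1) * real k \<le> 2 * 2 ^ k"
    using assms
  proof (induction k rule: dec_induct)
    case base
    show ?case by (simp add: power_divide divide_le_eq)
  next
    case (step k)
    have "(16/9) ^ (Suc k + 1) * real (Suc k) = (16/9) ^ (k + 1) * (16/9 * real (Suc k))"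
      by simp
    also have "\<dots> \<le> (16/9) ^ (k + 1) * (2 * real k)"
      using step.hyps by (intro mult_left_mono) auto
    also have "\<dots> = 2 * ((16/9) ^ (k + 1) * real k)" by simp
    also have "\<dots> \<le> 2 * (2 * 2 ^ k)" using step.IH by linarith
    finally show ?case by simp
  qed
  moreover have "(4/3::real) ^ (2 * k + 2) = (4/3) ^ (2 * (k + 1))" by simp
  moreover have "(4/3::real) ^ (2 * (k + 1)) = (16/9) ^ (k + 1)"
    unfolding power_mult by (simp add: power2_eq_square)
  ultimately show ?thesis by metis
qed

text \<open>
  A union bound over word lengths, segment lengths, segments and words.
\<close>

lemma card_unbalanced:
  assumes b: "b \<ge> 2" and k: "k \<ge> 30" and H: "H \<le> 4 ^ Suc k"
  shows "real (card {v. v < b ^ H \<and> \<not> balanced b k H v}) \<le> real (b ^ H) / (16 * real b ^ 3)"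
proof -
  have k2: "k \<ge> 2" using k by simp
  define Ev where "Ev = (\<lambda>l i s c. {v. v < b ^ H \<and> threshold b k l (k + 2 - i) <
    \<bar>\<Sum>j<2 ^ (k + i). increment b l c (digit_word b H l v (s * 2 ^ (k + i) + j))\<bar>})"
  define Sh where "Sh = (\<lambda>i. {s. Suc s * 2 ^ (k + i) \<le> H + 1 - k})"
  define \<epsilon> where "\<epsilon> = (\<lambda>l i. (1/2) ^ (l + (k + 2 - i)) / (16 * real b ^ 3))"
  have fin: "finite (Sh i)" and cSh: "card (Sh i) \<le> 2 ^ (k + 2 - i)" if "i < k + 2" for i
  proof -
    have "Sh i \<subseteq> {..<2 ^ (k + 2 - i)}"
    proof
      fix s assume "s \<in> Sh i"
      hence "Suc s * 2 ^ (k + i) \<le> H + 1 - k" by (simp add: Sh_def)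
      also have "\<dots> \<le> 4 ^ Suc k" using H k2 by simp
      also have "(4::nat) ^ Suc k = 2 ^ (2 * Suc k)" by (simp add: power_mult)
      also have "2 * Suc k = (k + 2 - i) + (k + i)" using that by simp
      finally have "Suc s * 2 ^ (k + i) \<le> 2 ^ (k + 2 - i) * 2 ^ (k + i)" by (simp only: power_add)
      hence "Suc s \<le> 2 ^ (k + 2 - i)" by (rule mult_right_le_imp_le) simp
      thus "s \<in> {..<2 ^ (k + 2 - i)}" by simp
    qed
    thus "finite (Sh i)" "card (Sh i) \<le> 2 ^ (k + 2 - i)"
      using finite_subset[of "Sh i"] card_mono[of "{..<2 ^ (k + 2 - i)}" "Sh i"] by auto
  qed
  have Ev_card: "real (card (Ev l i s c)) * real (2 ^ (k + 2 - i)) * real (b ^ l) \<le> real (b ^ H) * \<epsilon> l i"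
    if l: "l \<in> {1..k}" and i: "i < k + 2" and c: "c < b ^ l" and s: "s \<in> Sh i" for l i c s
  proof -
    define h where "h = (2::nat) ^ (k + i)"
    define j0 where "j0 = s * h"
    define m where "m = k + 2 - i"
    have hm: "h = 2 ^ (2 * k + 2 - m)" using i by (simp add: h_def m_def)
    have j0h: "j0 + h \<le> H + 1 - k" using s by (simp add: Sh_def j0_def h_def)
    have hpos: "h > 0" by (simp add: h_def)
    have j0h': "j0 + h + k \<le> H + 1" using j0h hpos by linarith
    define i0 where "i0 = H + 1 - l - j0 - h"
    have i0: "i0 + h + l \<le> Suc H" "i0 + h + l + j0 = H + 1" using j0h' l by (auto simp: i0_def)
    have lh: "l \<le> h"
    proof -
      have "l \<le> k" using l by simp
      also have "k < 2 ^ k" by (rule less_exp)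
      also have "(2::nat) ^ k \<le> h" by (simp add: h_def)
      finally show ?thesis by simp
    qed
    \<comment> \<open>Windows are numbered from the left end of the block, but digit positions count from the right.\<close>
    have refl: "(\<Sum>j<h. increment b l c (digit_word b H l v (j0 + j)))
        = (\<Sum>j<h. increment b l c (v div b ^ (i0 + j) mod b ^ l))" for v
    proof -
      have "(\<Sum>j<h. increment b l c (v div b ^ (i0 + j) mod b ^ l))
         = (\<Sum>j<h. increment b l c (v div b ^ (i0 + (h - Suc j)) mod b ^ l))"
        by (rule sum.nat_diff_reindex[symmetric])
      also have "\<dots> = (\<Sum>j<h. increment b l c (digit_word b H l v (j0 + j)))"
      proof (intro sum.cong refl)
        fix j assume "j \<in> {..<h}"
        hence "i0 + (h - Suc j) = H - l - (j0 + j)" using i0(2) by simp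
        thus "increment b l c (v div b ^ (i0 + (h - Suc j)) mod b ^ l) = increment b l c (digit_word b H l v (j0 + j))"
          by (simp only: digit_word_def)
      qed
      finally show ?thesis by simp
    qed
    have Ev': "Ev l i s c = {v. v < b ^ H \<and> threshold b k l m < \<bar>\<Sum>j<h. increment b l c (v div b ^ (i0 + j) mod b ^ l)\<bar>}"
      unfolding Ev_def refl[symmetric] by (simp add: j0_def h_def m_def)
    have tl: "tilt k l m * real l \<le> 1"
    proof -
      have "(4/3::real) ^ (l + m) * real l \<le> (4/3) ^ (2 * k + 2) * real k"
        using l by (intro mult_mono power_increasing) (auto simp: m_def)
      also have "\<dots> \<le> 2 * 2 ^ k" using k by (rule tilt_small)
      finally show ?thesis by (simp add: tilt_def field_simps)
    qed
    have "real (card (Ev l i s c)) \<le> 2 * real (b ^ H) * exp (2 * real h * real l * (real b / real (b ^ l)) * (tilt k l m)\<^sup>2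
       - tilt k l m * threshold b k l m)"
      unfolding Ev'
      using b l c i0(1) lh tl increment_moments[OF b, of l c]
      by (intro card_large_window_sum) (auto simp: tilt_def)
    hence "real (card (Ev l i s c)) * real (2 ^ m) * real (b ^ l) \<le>
       2 * real (b ^ H) * exp (2 * real h * real l * (real b / real (b ^ l)) * (tilt k l m)\<^sup>2
       - tilt k l m * threshold b k l m) * real (2 ^ m) * real (b ^ l)"
      by (intro mult_right_mono) auto
    also have "\<dots> = real (b ^ H) * (2 * exp (2 * real h * real l * (real b / real (b ^ l)) * (tilt k l m)\<^sup>2
       - tilt k l m * threshold b k l m) * real (2 ^ m) * real (b ^ l))"
      by (simp only: mult_ac)
    also have "\<dots> \<le> real (b ^ H) * ((1/2) ^ (l + m) / (16 * real b ^ 3))"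
      unfolding hm using b l by (intro mult_left_mono tail_estimate) (auto simp: m_def)
    finally show ?thesis by (simp only: m_def \<epsilon>_def)
  qed
  have sub: "{v. v < b ^ H \<and> \<not> balanced b k H v} \<subseteq> (\<Union>l\<in>{1..k}. \<Union>i\<in>{..<k+2}. \<Union>s\<in>Sh i. \<Union>c\<in>{..<b ^ l}. Ev l i s c)"
  proof (rule subsetI, rule ccontr)
    fix v assume v: "v \<in> {v. v < b ^ H \<and> \<not> balanced b k H v}"
      and "v \<notin> (\<Union>l\<in>{1..k}. \<Union>i\<in>{..<k+2}. \<Union>s\<in>Sh i. \<Union>c\<in>{..<b ^ l}. Ev l i s c)"
    hence "balanced b k H v"
      by (intro balancedI[OF b k2 H]) (auto simp: Ev_def Sh_def not_less)
    with v show False by simp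
  qed
  have finEv: "finite (Ev l i s c)" for l i s c
    by (rule finite_subset[of _ "{..<b ^ H}"]) (auto simp: Ev_def)
  have "card {v. v < b ^ H \<and> \<not> balanced b k H v} \<le> card (\<Union>l\<in>{1..k}. \<Union>i\<in>{..<k+2}. \<Union>s\<in>Sh i. \<Union>c\<in>{..<b ^ l}. Ev l i s c)"
    by (intro card_mono sub finite_UN_I finEv fin) auto
  also have "\<dots> \<le> (\<Sum>l\<in>{1..k}. \<Sum>i<k+2. \<Sum>s\<in>Sh i. \<Sum>c<b ^ l. card (Ev l i s c))"
    by (intro order.trans[OF card_UN_le] sum_mono fin order.refl) auto
  finally have "real (card {v. v < b ^ H \<and> \<not> balanced b k H v})
      \<le> (\<Sum>l\<in>{1..k}. \<Sum>i<k+2. \<Sum>s\<in>Sh i. \<Sum>c<b ^ l. real (card (Ev l i s c)))"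
    by (simp only: of_nat_sum[symmetric] of_nat_le_iff)
  also have "\<dots> \<le> (\<Sum>l\<in>{1..k}. \<Sum>i<k+2. real (b ^ H) * \<epsilon> l i)"
  proof (intro sum_mono)
    fix l i assume l: "l \<in> {1..k}" and i': "i \<in> {..<k+2}"
    hence i: "i < k + 2" by simp
    define X where "X = real (b ^ H) * \<epsilon> l i / (real (2 ^ (k + 2 - i)) * real (b ^ l))"
    have X0: "X \<ge> 0" by (simp add: X_def \<epsilon>_def)
    have "(\<Sum>s\<in>Sh i. \<Sum>c<b ^ l. real (card (Ev l i s c))) \<le> (\<Sum>s\<in>Sh i. \<Sum>c<b ^ l. X)"
      using Ev_card[OF l i] b by (intro sum_mono) (simp add: X_def field_simps)
    also have "\<dots> = real (card (Sh i)) * (real (b ^ l) * X)" by simp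
    also have "\<dots> \<le> real (2 ^ (k + 2 - i)) * (real (b ^ l) * X)"
      using X0 cSh[OF i] by (intro mult_right_mono) (simp_all only: of_nat_le_iff mult_nonneg_nonneg of_nat_0_le_iff)
    also have "\<dots> = real (b ^ H) * \<epsilon> l i" using b by (simp add: X_def)
    finally show "(\<Sum>s\<in>Sh i. \<Sum>c<b ^ l. real (card (Ev l i s c))) \<le> real (b ^ H) * \<epsilon> l i" .
  qed
  also have "\<dots> = real (b ^ H) / (16 * real b ^ 3) * ((\<Sum>l\<in>{1..k}. (1/2) ^ l) * (\<Sum>i<k+2. (1/2) ^ (k + 2 - i)))"
    unfolding sum_product unfolding sum_distrib_left \<epsilon>_def power_add[of "1/2::real"]
    by (intro sum.cong refl) simp
  also have "(\<Sum>l\<in>{1..k}. (1/2::real) ^ l) = (\<Sum>l<k. (1/2) ^ Suc l)"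
    by (rule sum.reindex_bij_witness[of _ Suc "\<lambda>l. l - 1"]) auto
  also have "real (b ^ H) / (16 * real b ^ 3) * ((\<Sum>l<k. (1/2) ^ Suc l) * (\<Sum>i<k+2. (1/2) ^ (k + 2 - i)))
     \<le> real (b ^ H) / (16 * real b ^ 3) * (1 * 1)"
    by (intro mult_left_mono mult_mono geometric_sum_bounds sum_nonneg) auto
  finally show ?thesis by simp
qed

section \<open>Choosing the bits scale by scale\<close>

text \<open>
  The number of base-\<open>b\<close> digits that \<open>n\<close> bits carry.
\<close>

definition precision :: "nat \<Rightarrow> nat \<Rightarrow> nat" where
  "precision b n = (GREATEST e. b ^ e \<le> 2 ^ n)"

lemma power_le_two_power_imp_le:
  assumes "b \<ge> 2" "b ^ e \<le> (2::nat) ^ n"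
  shows "e \<le> n"
proof -
  have "(2::nat) ^ e \<le> b ^ e" using assms by (intro power_mono) auto
  also have "\<dots> \<le> 2 ^ n" by (rule assms)
  finally show ?thesis by simp
qed

lemma precision_le: 
  assumes "b \<ge> 2" shows "b ^ precision b n \<le> 2 ^ n"
  unfolding precision_def
  by (rule GreatestI_nat[where k = 0 and b = n]) (use power_le_two_power_imp_le[OF assms] in auto)

lemma precision_greatest:
  assumes "b \<ge> 2" "b ^ e \<le> 2 ^ n" shows "e \<le> precision b n"
  unfolding precision_def
  by (rule Greatest_le_nat[where b = n]) (use power_le_two_power_imp_le[OF assms(1)] assms in auto)

lemma precision_less:
  assumes "b \<ge> 2" shows "2 ^ n < b ^ Suc (precision b n)"
  using precision_greatest[OF assms, of "Suc (precision b n)" n] by (force simp: not_le[symmetric])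

lemma precision_le_self: "b \<ge> 2 \<Longrightarrow> precision b n \<le> n"
  using power_le_two_power_imp_le precision_le by blast

lemma precision_mono:
  assumes "b \<ge> 2" "m \<le> n" shows "precision b m \<le> precision b n"
proof (rule precision_greatest[OF assms(1)])
  have "b ^ precision b m \<le> 2 ^ m" by (rule precision_le[OF assms(1)])
  also have "\<dots> \<le> 2 ^ n" using assms by simp
  finally show "b ^ precision b m \<le> 2 ^ n" .
qed

definition block_length :: "nat \<Rightarrow> nat \<Rightarrow> nat" where
  "block_length b k = precision b (4 ^ Suc k) - precision b (4 ^ k)"

lemma precision_block:
  "b \<ge> 2 \<Longrightarrow> precision b (4 ^ Suc k) = precision b (4 ^ k) + block_length b k"
  unfolding block_length_def using precision_mono[of b "4 ^ k" "4 ^ Suc k"] by simp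

text \<open>
  The first \<open>precision b n\<close> base-\<open>b\<close> digits of \<open>z / 2 ^ n\<close>, as one number.
\<close>

definition base_digits :: "nat \<Rightarrow> nat \<Rightarrow> nat \<Rightarrow> nat" where
  "base_digits b n z = z * b ^ precision b n div 2 ^ n"

text \<open>
  The digits in base \<open>b\<close> of a point of \<open>{y / 2 ^ n..(y + 1) / 2 ^ n}\<close>, up to the precision of \<open>n\<close> bits, are
  those of one of its end points, so it suffices to test these two. Here \<open>n = 4 ^ Suc k\<close>.
\<close>

definition passes :: "nat \<Rightarrow> nat \<Rightarrow> nat \<Rightarrow> bool" where
  "passes k y b \<longleftrightarrow> (\<forall>z\<in>{y, Suc y}. balanced b k (block_length b k) (base_digits b (4 ^ Suc k) z))"

definition good :: "nat \<Rightarrow> nat \<Rightarrow> bool" where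
  "good k y \<longleftrightarrow> (\<forall>b\<in>{2..k}. passes k y b)"

text \<open>
  A window inside the block sees digits of the block only, so the test may be applied to the number formed by all
  digits of a point, instead of that of the last block.
\<close>

lemma digit_word_mod:
  assumes "b > 0" "j + k \<le> H"
  shows "digit_word b H k (v mod b ^ H) j = digit_word b H k v j"
proof -
  have "b ^ H = b ^ (H - k - j) * b ^ (k + j)" using assms by (simp flip: power_add)
  hence "v mod b ^ H div b ^ (H - k - j) = v div b ^ (H - k - j) mod b ^ (k + j)"
    using assms by (simp add: mod_mult2_eq)
  moreover have "b ^ k dvd b ^ (k + j)" by (simp add: le_imp_power_dvd)
  ultimately show ?thesis by (simp add: digit_word_def mod_mod_cancel)
qed

lemma balanced_mod:
  assumes "b > 0"
  shows "balanced b k H (v mod b ^ H) = balanced b k H v"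
proof -
  have "hits b k H (v mod b ^ H) M c = hits b k H v M c" if "M \<le> H + 1 - k" for M c
    unfolding hits_def
  proof (rule arg_cong[where f = card], intro Collect_cong conj_cong refl)
    fix j assume "j < M"
    thus "(digit_word b H k (v mod b ^ H) j < c) = (digit_word b H k v j < c)"
      using digit_word_mod[OF assms, of j k H v] that by simp
  qed
  thus ?thesis by (simp add: balanced_def)
qed

lemma card_div_fibre:
  fixes F Q u :: nat
  assumes "F > 0" "Q > 0"
  shows "finite {z. z * F div Q = u}" "card {z. z * F div Q = u} \<le> Q div F + 1"
proof -
  let ?S = "{z. z * F div Q = u}"
  have least: "?S \<subseteq> {z0..z0 + Q div F}" if z0: "z0 \<in> ?S" "\<forall>z\<in>?S. z0 \<le> z" for z0
  proof
    fix z assume z: "z \<in> ?S"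
    have "z * F < Suc u * Q"
      using z dividend_less_div_times[OF assms(2), of "z * F"] by simp
    also have "Suc u * Q = u * Q + Q" by simp
    also have "u * Q \<le> z0 * F" using z0(1) by (auto simp: div_times_less_eq_dividend)
    finally have "z * F \<le> z0 * F + Q" by simp
    hence "(z - z0) * F \<le> Q" by (simp add: diff_mult_distrib)
    hence "z - z0 \<le> Q div F" using assms by (simp add: less_eq_div_iff_mult_less_eq)
    thus "z \<in> {z0..z0 + Q div F}" using z0(2) z by auto
  qed
  have "\<exists>z0. ?S \<subseteq> {z0..z0 + Q div F}"
  proof (cases "?S = {}")
    case False
    define z0 where "z0 = (LEAST z. z \<in> ?S)"
    have "z0 \<in> ?S" unfolding z0_def using False by (metis (no_types, lifting) LeastI equals0I)
    moreover have "\<forall>z\<in>?S. z0 \<le> z" unfolding z0_def by (auto intro: Least_le)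
    ultimately show ?thesis using least by blast
  next
    case True
    show ?thesis unfolding True by simp
  qed
  then obtain z0 where sub: "?S \<subseteq> {z0..z0 + Q div F}" ..
  show "finite ?S" by (rule finite_subset[OF sub]) simp
  have "card ?S \<le> card {z0..z0 + Q div F}" by (rule card_mono[OF _ sub]) simp
  thus "card ?S \<le> Q div F + 1" by simp
qed

lemma inj_on_mod: "inj_on (\<lambda>u. u mod P) {c..<c + P}" for P :: nat
proof (rule inj_onI)
  have le: "u = u'" if "u \<in> {c..<c + P}" "u' \<in> {c..<c + P}" "u mod P = u' mod P" "u \<le> u'" for u u'
  proof -
    have "P dvd u' - u" using that by (metis mod_eq_dvd_iff_nat)
    moreover have "u' - u < P" using that by auto
    ultimately have "u' - u = 0" by (meson nat_dvd_not_less not_gr_zero)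
    thus ?thesis using that by simp
  qed
  fix u u' assume "u \<in> {c..<c + P}" "u' \<in> {c..<c + P}" "u mod P = u' mod P"
  thus "u = u'" using le[of u u'] le[of u' u] by (cases "u \<le> u'") auto
qed

text \<open>
  The grid points \<open>z\<close> run through an interval of length \<open>1 / 2 ^ (4 ^ k)\<close>, which is at most
  \<open>1 / b ^ precision b (4 ^ k)\<close>. So their digit numbers \<open>G z\<close> lie in at most \<open>b ^ H + 1\<close> consecutive integers:
  every block occurs at most twice. A value of \<open>G\<close> is attained by at most \<open>2 Q / F\<close> grid points. Finally
  \<open>1 / b ^ precision b (4 ^ k)\<close> exceeds \<open>1 / 2 ^ (4 ^ k)\<close> by at most a factor \<open>b\<close>.
\<close>

lemma card_unbalanced_points:
  assumes b: "b \<ge> 2" and k: "k \<ge> 30"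
  shows "real (card {z \<in> {a * 2 ^ (3 * 4 ^ k)..Suc a * 2 ^ (3 * 4 ^ k)}.
      \<not> balanced b k (block_length b k) (base_digits b (4 ^ Suc k) z)})
    \<le> 2 ^ (3 * 4 ^ k) / (4 * real b ^ 2)"
proof -
  define H where "H = block_length b k"
  define e where "e = precision b (4 ^ k)"
  define F where "F = b ^ (e + H)"
  define D where "D = (2::nat) ^ (3 * 4 ^ k)"
  define n where "n = (2::nat) ^ (4 ^ k)"
  define Q where "Q = D * n"
  define P where "P = b ^ H"
  define Bad where "Bad = {v. v < P \<and> \<not> balanced b k H v}"
  define G where "G = (\<lambda>z. z * F div Q)"
  define u0 where "u0 = G (a * D)"
  define U where "U = {u \<in> {u0..u0 + P}. u mod P \<in> Bad}"
  have Q: "2 ^ (4 ^ Suc k) = Q" by (simp add: Q_def D_def n_def power_add[symmetric])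
  have pos: "F > 0" "Q > 0" "P > 0" "D > 0" using b by (auto simp: F_def Q_def P_def D_def n_def)
  have f: "precision b (4 ^ Suc k) = e + H" using precision_block[OF b, of k] by (simp add: e_def H_def)
  have G: "base_digits b (4 ^ Suc k) z = G z" for z
    unfolding base_digits_def G_def f Q F_def ..
  have FQ: "F \<le> Q" using precision_le[OF b, of "4 ^ Suc k"] unfolding f Q F_def .
  have en: "b ^ e \<le> n" using precision_le[OF b] by (simp add: e_def n_def)
  have ne: "n < b ^ Suc e" using precision_less[OF b] by (simp add: e_def n_def)
  have FP: "F = b ^ e * P" by (simp add: F_def P_def power_add)
  have balG: "balanced b k H (G z) \<longleftrightarrow> G z mod P \<notin> Bad" for z
    using balanced_mod[of b k H "G z"] b pos by (auto simp: Bad_def P_def)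
  have Bad: "real (card Bad) \<le> real P / (16 * real b ^ 3)" "finite Bad"
  proof -
    have "H \<le> precision b (4 ^ Suc k)" unfolding f by simp
    hence "H \<le> 4 ^ Suc k" using precision_le_self[OF b] le_trans by blast
    thus "real (card Bad) \<le> real P / (16 * real b ^ 3)"
      unfolding Bad_def P_def by (rule card_unbalanced[OF b k])
  qed (simp add: Bad_def)
  have cU: "card U \<le> 2 * card Bad" "finite U"
  proof -
    have one: "card {u \<in> {c..<c + P}. u mod P \<in> Bad} \<le> card Bad" for c
    proof (rule card_inj_on_le[where f = "\<lambda>u. u mod P"])
      show "inj_on (\<lambda>u. u mod P) {u \<in> {c..<c + P}. u mod P \<in> Bad}"
        by (rule inj_on_subset[OF inj_on_mod]) auto
    qed (use Bad in auto)
    have "U \<subseteq> {u \<in> {u0..<u0 + P}. u mod P \<in> Bad} \<union> {u \<in> {u0 + P..<u0 + P + P}. u mod P \<in> Bad}"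
      using pos by (auto simp: U_def)
    hence "card U \<le> card ({u \<in> {u0..<u0 + P}. u mod P \<in> Bad} \<union> {u \<in> {u0 + P..<u0 + P + P}. u mod P \<in> Bad})"
      by (intro card_mono) auto
    also have "\<dots> \<le> card {u \<in> {u0..<u0 + P}. u mod P \<in> Bad} + card {u \<in> {u0 + P..<u0 + P + P}. u mod P \<in> Bad}"
      by (rule card_Un_le)
    also have "\<dots> \<le> card Bad + card Bad" by (intro add_mono one)
    finally show "card U \<le> 2 * card Bad" by simp
  qed (simp add: U_def)
  have sub: "{z \<in> {a * D..Suc a * D}. \<not> balanced b k H (G z)} \<subseteq> (\<Union>u\<in>U. {z. z * F div Q = u})"
  proof
    fix z assume "z \<in> {z \<in> {a * D..Suc a * D}. \<not> balanced b k H (G z)}"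
    hence z: "a * D \<le> z" "z \<le> Suc a * D" "\<not> balanced b k H (G z)" by auto
    have "u0 \<le> G z" unfolding u0_def G_def using z by (intro div_le_mono mult_right_mono) auto
    moreover have "G z \<le> u0 + P"
    proof -
      have "z * F \<le> Suc a * D * F" using z by simp
      also have "\<dots> = a * D * F + D * (b ^ e * P)" by (simp add: FP distrib_right)
      also have "D * (b ^ e * P) \<le> D * (n * P)" using en by simp
      finally have "z * F \<le> a * D * F + P * Q" by (simp add: Q_def mult_ac)
      hence "G z \<le> (a * D * F + P * Q) div Q" unfolding G_def by (rule div_le_mono)
      also have "\<dots> = u0 + P" using pos by (simp add: u0_def G_def)
      finally show ?thesis .
    qed
    ultimately have "G z \<in> U" using z(3) balG by (simp add: U_def)
    thus "z \<in> (\<Union>u\<in>U. {z. z * F div Q = u})" by (simp add: G_def)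
  qed
  have "card {z \<in> {a * D..Suc a * D}. \<not> balanced b k H (G z)} \<le> card (\<Union>u\<in>U. {z. z * F div Q = u})"
    using cU card_div_fibre(1)[OF pos(1,2)] by (intro card_mono sub) auto
  also have "\<dots> \<le> (\<Sum>u\<in>U. card {z. z * F div Q = u})" by (rule card_UN_le[OF cU(2)])
  also have "\<dots> \<le> (\<Sum>u\<in>U. Q div F + 1)" by (intro sum_mono card_div_fibre pos)
  also have "\<dots> \<le> 2 * card Bad * (Q div F + 1)" using cU(1) by (simp del: mult_Suc_right)
  finally have "real (card {z \<in> {a * D..Suc a * D}. \<not> balanced b k H (G z)}) \<le> real (2 * card Bad * (Q div F + 1))"
    by (rule of_nat_mono)
  also have "\<dots> = 2 * real (card Bad) * (real (Q div F) + 1)" by (simp add: algebra_simps)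
  also have "\<dots> \<le> 2 * (real P / (16 * real b ^ 3)) * (real Q / real F + real Q / real F)"
  proof (intro mult_mono add_mono Bad(1))
    show "real (Q div F) \<le> real Q / real F" by (rule of_nat_div_le_of_nat)
    show "1 \<le> real Q / real F" using FQ pos by simp
  qed auto
  also have "\<dots> = real D * (real n / real (b ^ e)) / (4 * real b ^ 3)"
    using pos b by (simp add: FP Q_def field_simps)
  also have "\<dots> \<le> real D * real b / (4 * real b ^ 3)"
  proof -
    have "real n \<le> real b * real (b ^ e)" using ne
      by (metis less_imp_le of_nat_le_iff of_nat_mult power_Suc)
    hence "real n / real (b ^ e) \<le> real b" using b by (simp add: divide_le_eq)
    thus ?thesis by (intro divide_right_mono mult_left_mono) auto
  qed
  also have "\<dots> = real D / (4 * real b ^ 2)" using b by (simp add: power2_eq_square power3_eq_cube)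
  finally show ?thesis unfolding G H_def D_def of_nat_power of_nat_numeral .
qed

lemma sum_inverse_squares_le: "(\<Sum>b=2..k. 1 / real b ^ 2) \<le> 1"
proof -
  have telescope: "(\<Sum>b=2..Suc k. 1 / real b ^ 2) \<le> 1 - 1 / real (Suc k)" for k
  proof (induction k)
    case (Suc k)
    have "1 / (real (Suc (Suc k)))\<^sup>2 \<le> 1 / real (Suc k) - 1 / real (Suc (Suc k))"
    proof -
      have "1 / (real (Suc (Suc k)))\<^sup>2 \<le> 1 / (real (Suc k) * real (Suc (Suc k)))"
        unfolding power2_eq_square by (intro divide_left_mono mult_right_mono) auto
      also have "\<dots> = 1 / real (Suc k) - 1 / real (Suc (Suc k))"
        by (simp add: field_simps)
      finally show ?thesis .
    qed
    thus ?case using Suc by (simp add: sum.nat_ivl_Suc')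
  qed simp
  show ?thesis
  proof (cases k)
    case (Suc k')
    show ?thesis unfolding Suc by (rule order.trans[OF telescope]) simp
  qed simp
qed

text \<open>
  A candidate fails in base \<open>b\<close> if it or its successor is unbalanced, which concerns a proportion of at
  most \<open>1 / (2 b\<^sup>2)\<close>, and these sum to at most \<open>1 / 2\<close>. There is even a good candidate that is not the last
  one; this will keep the limit strictly below the right end of each interval.
\<close>

lemma exists_good:
  assumes k: "k \<ge> 30"
  shows "\<exists>y. a * 2 ^ (3 * 4 ^ k) \<le> y \<and> Suc y < Suc a * 2 ^ (3 * 4 ^ k) \<and> good k y"
proof (rule ccontr)
  assume none: "\<not> ?thesis"
  define D where "D = (2::nat) ^ (3 * 4 ^ k)"
  define Z where "Z = (\<lambda>b. {z \<in> {a * D..Suc a * D}. \<not> balanced b k (block_length b k) (base_digits b (4 ^ Suc k) z)})"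
  define Y where "Y = (\<lambda>b. Z b \<union> {y. Suc y \<in> Z b})"
  have Z: "real (card (Z b)) \<le> real D / (4 * real b ^ 2)" if "b \<ge> 2" for b
    using card_unbalanced_points[OF that k, of a] by (simp add: Z_def D_def)
  have finZ: "finite (Z b)" for b by (simp add: Z_def)
  have Suc_Z: "{y. Suc y \<in> Z b} = Suc -` Z b" for b by auto
  have finY: "finite (Y b)" for b by (simp add: Y_def finZ Suc_Z finite_vimageI)
  have Y: "real (card (Y b)) \<le> real D / 2 * (1 / real b ^ 2)" if "b \<ge> 2" for b
  proof -
    have "card (Y b) \<le> card (Z b) + card {y. Suc y \<in> Z b}" unfolding Y_def by (rule card_Un_le)
    also have "card {y. Suc y \<in> Z b} \<le> card (Z b)"
      unfolding Suc_Z by (rule card_inj_on_le[where f = Suc]) (auto simp: finZ)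
    finally have "real (card (Y b)) \<le> 2 * real (card (Z b))" by linarith
    thus ?thesis using Z[OF that] by simp
  qed
  have D2: "D \<ge> 8"
  proof -
    have "(2::nat) ^ 3 \<le> 2 ^ (3 * 4 ^ k)" by (intro power_increasing) auto
    thus ?thesis by (simp add: D_def)
  qed
  have "{a * D..<a * D + (D - 1)} \<subseteq> (\<Union>b\<in>{2..k}. Y b)"
  proof
    fix y assume y: "y \<in> {a * D..<a * D + (D - 1)}"
    hence "a * D \<le> y" "Suc y < Suc a * D" by auto
    hence "\<not> good k y" using none by (auto simp: D_def)
    then obtain b z where bz: "b \<in> {2..k}" "z \<in> {y, Suc y}"
      "\<not> balanced b k (block_length b k) (base_digits b (4 ^ Suc k) z)"
      unfolding good_def passes_def by blast
    hence "z \<in> Z b" using y by (auto simp: Z_def)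
    thus "y \<in> (\<Union>b\<in>{2..k}. Y b)" using bz by (auto simp: Y_def)
  qed
  hence "card {a * D..<a * D + (D - 1)} \<le> card (\<Union>b\<in>{2..k}. Y b)"
    by (intro card_mono) (auto simp: finY)
  also have "\<dots> \<le> (\<Sum>b=2..k. card (Y b))" by (rule card_UN_le) simp
  finally have "real (D - 1) \<le> (\<Sum>b=2..k. real (card (Y b)))"
    by (simp flip: of_nat_sum)
  also have "\<dots> \<le> (\<Sum>b=2..k. real D / 2 * (1 / real b ^ 2))"
    by (intro sum_mono Y) auto
  also have "\<dots> = real D / 2 * (\<Sum>b=2..k. 1 / real b ^ 2)" by (simp add: sum_distrib_left)
  also have "\<dots> \<le> real D / 2 * 1" by (intro mult_left_mono sum_inverse_squares_le) auto
  finally have "real (D - 1) \<le> real D / 2" by simp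
  thus False using D2 by (simp add: of_nat_diff)
qed

text \<open>
  The first \<open>4 ^ (30 + i)\<close> bits of the number, as an integer. The first \<open>4 ^ 30\<close> bits are zero.
\<close>

fun approximant :: "nat \<Rightarrow> nat" where
  "approximant 0 = 0"
| "approximant (Suc i) = (LEAST y. approximant i * 2 ^ (3 * 4 ^ (30 + i)) \<le> y \<and> good (30 + i) y)"

lemma approximant_Suc:
  "approximant i * 2 ^ (3 * 4 ^ (30 + i)) \<le> approximant (Suc i)"
  "good (30 + i) (approximant (Suc i))"
  "Suc (approximant (Suc i)) < Suc (approximant i) * 2 ^ (3 * 4 ^ (30 + i))"
proof -
  let ?P = "\<lambda>y. approximant i * 2 ^ (3 * 4 ^ (30 + i)) \<le> y \<and> good (30 + i) y"
  obtain y where y: "?P y" "Suc y < Suc (approximant i) * 2 ^ (3 * 4 ^ (30 + i))"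
    using exists_good[of "30 + i" "approximant i"] by auto
  have "?P (approximant (Suc i))" unfolding approximant.simps by (rule LeastI[of ?P, OF y(1)])
  thus "approximant i * 2 ^ (3 * 4 ^ (30 + i)) \<le> approximant (Suc i)" "good (30 + i) (approximant (Suc i))"
    by blast+
  have "approximant (Suc i) \<le> y" unfolding approximant.simps by (rule Least_le[of ?P, OF y(1)])
  thus "Suc (approximant (Suc i)) < Suc (approximant i) * 2 ^ (3 * 4 ^ (30 + i))" using y(2) by simp
qed

definition bits :: "nat \<Rightarrow> nat" where
  "bits i = 4 ^ (30 + i)"

lemma bits_Suc: "bits (Suc i) = 3 * 4 ^ (30 + i) + bits i"
  unfolding bits_def add_Suc_right power_Suc by simp

definition lower :: "nat \<Rightarrow> real" where
  "lower i = real (approximant i) / 2 ^ bits i"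

definition upper :: "nat \<Rightarrow> real" where
  "upper i = real (Suc (approximant i)) / 2 ^ bits i"

lemma lower_Suc: "lower i \<le> lower (Suc i)"
proof -
  have "real (approximant i * 2 ^ (3 * 4 ^ (30 + i))) \<le> real (approximant (Suc i))"
    by (rule of_nat_mono[OF approximant_Suc(1)])
  thus ?thesis unfolding lower_def bits_Suc power_add by (simp add: field_simps)
qed

lemma upper_Suc: "upper (Suc i) < upper i"
proof -
  have "real (Suc (approximant (Suc i))) < real (Suc (approximant i) * 2 ^ (3 * 4 ^ (30 + i)))"
    using approximant_Suc(3)[of i] by (simp only: of_nat_less_iff)
  also have "\<dots> = real (Suc (approximant i)) * 2 ^ (3 * 4 ^ (30 + i))"
    by (simp only: of_nat_mult of_nat_power of_nat_numeral)
  finally show ?thesis unfolding upper_def bits_Suc power_add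
    by (simp add: field_simps del: of_nat_Suc)
qed

lemma lower_less_upper: "lower i < upper j"
proof -
  have "lower i \<le> lower (max i j)" by (rule lift_Suc_mono_le[of lower]) (auto simp: lower_Suc)
  also have "\<dots> < upper (max i j)" by (simp add: lower_def upper_def divide_strict_right_mono)
  also have "\<dots> \<le> upper j" by (rule lift_Suc_antimono_le[of upper]) (auto simp: upper_Suc less_imp_le)
  finally show ?thesis .
qed

definition normal_number :: real where
  "normal_number = (SUP i. lower i)"

lemma lower_le_normal_number: "lower i \<le> normal_number"
  unfolding normal_number_def
  by (rule cSUP_upper) (auto intro!: bdd_aboveI[of _ "upper 0"] less_imp_le[OF lower_less_upper])

lemma normal_number_less_upper: "normal_number < upper i"
proof -
  have "normal_number \<le> upper (Suc i)"
    unfolding normal_number_def by (rule cSUP_least) (auto intro: less_imp_le[OF lower_less_upper])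
  thus ?thesis using upper_Suc[of i] by simp
qed

section \<open>Discrepancy of the constructed number\<close>

text \<open>
  The counting error of \<open>[0, \<alpha>)\<close> for \<open>M\<close> terms from index \<open>s\<close> on, not divided by \<open>M\<close>. Unlike the
  discrepancy it is additive in time.
\<close>

definition local_discrepancy :: "nat \<Rightarrow> real \<Rightarrow> nat \<Rightarrow> nat \<Rightarrow> real" where
  "local_discrepancy b \<alpha> s M = (\<Sum>j<M. of_bool (frac (real b ^ (s + j) * normal_number) < \<alpha>) - \<alpha>)"

lemma normal_number_nonneg: "0 \<le> normal_number"
  using lower_le_normal_number[of 0] by (simp add: lower_def)

text \<open>
  Although later bits change the number, its digits up to the precision of the chosen bits are those of one of the
  two points tested.
\<close>

lemma balanced_normal_number:
  assumes b: "b \<ge> 2" "b \<le> k" and k: "k \<ge> 30"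
  shows "balanced b k (block_length b k) (nat \<lfloor>real b ^ precision b (4 ^ Suc k) * normal_number\<rfloor>)"
proof -
  define i where "i = k - 30"
  have ki: "k = 30 + i" using k by (simp add: i_def)
  define z where "z = approximant (Suc i)"
  define Q where "Q = (2::nat) ^ (4 ^ Suc k)"
  define F where "F = b ^ precision b (4 ^ Suc k)"
  define V where "V = nat \<lfloor>real F * normal_number\<rfloor>"
  have pos: "Q > 0" "F > 0" using b by (auto simp: Q_def F_def)
  have FQ: "F \<le> Q" using precision_le[OF b(1), of "4 ^ Suc k"] by (simp only: F_def Q_def)
  have bits: "2 ^ bits (Suc i) = real Q" by (simp add: bits_def Q_def ki)
  have lo: "real z / real Q \<le> normal_number"
    using lower_le_normal_number[of "Suc i"] by (simp only: lower_def bits z_def)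
  have up: "normal_number < real (Suc z) / real Q"
    using normal_number_less_upper[of "Suc i"] by (simp only: upper_def bits z_def)
  have "base_digits b (4 ^ Suc k) z \<le> V"
  proof -
    have "real (z * F div Q) \<le> real (z * F) / real Q" by (rule of_nat_div_le_of_nat)
    also have "\<dots> = real F * (real z / real Q)" by simp
    also have "\<dots> \<le> real F * normal_number" by (intro mult_left_mono lo) simp
    finally have "real (z * F div Q) \<le> real F * normal_number" .
    hence "z * F div Q \<le> V" unfolding V_def by (simp add: le_nat_floor)
    thus ?thesis by (simp only: base_digits_def F_def Q_def)
  qed
  moreover have "V \<le> base_digits b (4 ^ Suc k) (Suc z)"
  proof -
    have "real V \<le> real F * normal_number" unfolding V_def
      using normal_number_nonneg by (intro of_nat_floor) simp
    also have "\<dots> \<le> real F * (real (Suc z) / real Q)" using up by (intro mult_left_mono) auto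
    finally have "real V * real Q \<le> real (Suc z) * real F" using pos by (simp add: field_simps del: of_nat_Suc)
    hence "real (V * Q) \<le> real (Suc z * F)" by (simp only: of_nat_mult)
    hence "V * Q \<le> Suc z * F" by (simp only: of_nat_le_iff)
    hence "V \<le> Suc z * F div Q" using pos by (simp only: less_eq_div_iff_mult_less_eq)
    thus ?thesis by (simp only: base_digits_def F_def Q_def)
  qed
  moreover have "base_digits b (4 ^ Suc k) (Suc z) \<le> Suc (base_digits b (4 ^ Suc k) z)"
  proof -
    have "Suc z * F div Q \<le> (z * F + Q) div Q" using FQ by (intro div_le_mono) simp
    also have "\<dots> = Suc (z * F div Q)" using pos by simp
    finally show ?thesis by (simp only: base_digits_def F_def Q_def)
  qed
  ultimately have "V = base_digits b (4 ^ Suc k) z \<or> V = base_digits b (4 ^ Suc k) (Suc z)" by linarith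
  moreover have "good k z" using approximant_Suc(2)[of i] by (simp only: z_def ki)
  ultimately have "balanced b k (block_length b k) V" using b by (auto simp: good_def passes_def)
  thus ?thesis by (simp add: V_def F_def)
qed

text \<open>
  The window at time \<open>j\<close> consists of the first \<open>k\<close> digits of the fractional part of \<open>b ^ (e + j) * x\<close>.
\<close>

lemma digit_word_less_iff:
  fixes x :: real
  assumes b: "b \<ge> 2" and x: "x \<ge> 0" and j: "j + k \<le> H"
  shows "digit_word b H k (nat \<lfloor>real b ^ (e + H) * x\<rfloor>) j < c \<longleftrightarrow> frac (real b ^ (e + j) * x) < real c / real (b ^ k)"
proof -
  define y where "y = real b ^ (e + j) * x"
  define B where "B = b ^ k"
  define r where "r = H - k - j"
  have B: "B > 0" using b by (simp add: B_def)
  have y: "y \<ge> 0" using x by (simp add: y_def)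
  have "real b ^ (e + H) * x / real (b ^ r) = real B * y"
  proof -
    have "e + H = r + (k + (e + j))" using j by (simp add: r_def)
    thus ?thesis using b by (simp add: y_def B_def power_add)
  qed
  hence "\<lfloor>real b ^ (e + H) * x\<rfloor> div int (b ^ r) = \<lfloor>real B * y\<rfloor>"
    using floor_divide_real_eq_div[of "int (b ^ r)" "real b ^ (e + H) * x"] by simp
  hence word: "digit_word b H k (nat \<lfloor>real b ^ (e + H) * x\<rfloor>) j = nat \<lfloor>real B * y\<rfloor> mod B"
    unfolding digit_word_def r_def[symmetric] B_def[symmetric]
    by (metis nat_div_distrib' nat_int of_nat_0_le_iff)
  have "real B * y = real B * frac y + of_int (int B * \<lfloor>y\<rfloor>)"
    by (simp add: frac_def algebra_simps)
  hence fl: "\<lfloor>real B * y\<rfloor> = \<lfloor>real B * frac y\<rfloor> + int B * \<lfloor>y\<rfloor>" by (metis floor_add_int)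
  have lt: "0 \<le> \<lfloor>real B * frac y\<rfloor>" "\<lfloor>real B * frac y\<rfloor> < int B"
    using B frac_lt_1[of y] by (auto simp: floor_less_iff)
  have "int (nat \<lfloor>real B * y\<rfloor> mod B) = \<lfloor>real B * y\<rfloor> mod int B"
    using y by (simp add: zmod_int)
  also have "\<dots> = \<lfloor>real B * frac y\<rfloor>" unfolding fl using lt by simp
  finally have "digit_word b H k (nat \<lfloor>real b ^ (e + H) * x\<rfloor>) j < c \<longleftrightarrow> \<lfloor>real B * frac y\<rfloor> < int c"
    unfolding word by linarith
  also have "\<dots> \<longleftrightarrow> frac y < real c / real B"
    using B by (simp add: floor_less_iff less_divide_eq mult.commute)
  finally show ?thesis by (simp add: y_def B_def)
qed

lemma local_discrepancy_grid:
  assumes b: "b \<ge> 2" "b \<le> k" and k: "k \<ge> 30" and M: "M \<le> block_length b k + 1 - k" and c: "c \<le> b ^ k"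
  shows "\<bar>local_discrepancy b (real c / real (b ^ k)) (precision b (4 ^ k)) M\<bar> \<le> 801 * sqrt (real b) * 2 ^ k"
proof (cases "c = b ^ k")
  case True
  hence "local_discrepancy b (real c / real (b ^ k)) (precision b (4 ^ k)) M = 0"
    using b by (simp add: local_discrepancy_def frac_lt_1)
  thus ?thesis by simp
next
  case False
  hence c': "c < b ^ k" using c by simp
  define H where "H = block_length b k"
  define e where "e = precision b (4 ^ k)"
  define V where "V = nat \<lfloor>real b ^ (e + H) * normal_number\<rfloor>"
  define h where "h = hits b k H V M c"
  have bal: "balanced b k H V"
    using balanced_normal_number[OF b k] precision_block[OF b(1), of k] by (simp add: V_def H_def e_def)
  have B: "real (b ^ k) > 0" using b by simp
  have "real h = (\<Sum>j<M. of_bool (frac (real b ^ (e + j) * normal_number) < real c / real (b ^ k)))"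
    unfolding h_def hits_eq_sum V_def
  proof (intro sum.cong refl)
    fix j assume "j \<in> {..<M}"
    hence "j + k \<le> H" using M by (simp add: H_def)
    thus "of_bool (digit_word b H k (nat \<lfloor>real b ^ (e + H) * normal_number\<rfloor>) j < c)
       = (of_bool (frac (real b ^ (e + j) * normal_number) < real c / real (b ^ k)) :: real)"
      using digit_word_less_iff[OF b(1) normal_number_nonneg] by simp
  qed
  hence ld: "local_discrepancy b (real c / real (b ^ k)) e M = real h - real M * (real c / real (b ^ k))"
    unfolding local_discrepancy_def sum_subtractf by simp
  have "(int h * int (b ^ k) - int M * int c)\<^sup>2 \<le> 801\<^sup>2 * 4 ^ k * int b * (int (b ^ k))\<^sup>2"
    using bal M c' unfolding balanced_def h_def H_def by blast
  hence "real_of_int ((int h * int (b ^ k) - int M * int c)\<^sup>2) \<le> real_of_int (801\<^sup>2 * 4 ^ k * int b * (int (b ^ k))\<^sup>2)"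
    by (simp only: of_int_le_iff)
  hence "(real h * real (b ^ k) - real M * real c)\<^sup>2 \<le> 801\<^sup>2 * 4 ^ k * real b * (real (b ^ k))\<^sup>2"
    by simp
  also have "\<dots> = (801 * sqrt (real b) * 2 ^ k * real (b ^ k))\<^sup>2"
    by (simp add: power_mult_distrib power_mult[symmetric] mult.commute[of k]) (simp add: power_mult)
  finally have "\<bar>real h * real (b ^ k) - real M * real c\<bar> \<le> \<bar>801 * sqrt (real b) * 2 ^ k * real (b ^ k)\<bar>"
    by (simp only: abs_le_square_iff)
  hence "\<bar>real h * real (b ^ k) - real M * real c\<bar> \<le> 801 * sqrt (real b) * 2 ^ k * real (b ^ k)"
    by simp
  moreover have "real h * real (b ^ k) - real M * real c = local_discrepancy b (real c / real (b ^ k)) e M * real (b ^ k)"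
    using b unfolding ld left_diff_distrib by simp
  ultimately have "\<bar>local_discrepancy b (real c / real (b ^ k)) e M\<bar> * real (b ^ k) \<le> 801 * sqrt (real b) * 2 ^ k * real (b ^ k)"
    by (simp add: abs_mult)
  thus ?thesis using B by (simp add: e_def)
qed

text \<open>
  The counting function is monotone in \<open>\<alpha>\<close>, so the error is controlled by the neighbouring grid points. Rounding
  costs \<open>M / b ^ k \<le> 4 * 2 ^ k\<close>, as \<open>M \<le> 4 * 4 ^ k\<close>.
\<close>

lemma local_discrepancy_interior:
  assumes b: "b \<ge> 2" "b \<le> k" and k: "k \<ge> 30" and M: "M \<le> block_length b k + 1 - k"
    and \<alpha>: "0 \<le> \<alpha>" "\<alpha> \<le> 1"
  shows "\<bar>local_discrepancy b \<alpha> (precision b (4 ^ k)) M\<bar> \<le> 805 * sqrt (real b) * 2 ^ k"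
proof (cases "\<alpha> = 1")
  case True
  thus ?thesis by (simp add: local_discrepancy_def frac_lt_1)
next
  case False
  define e where "e = precision b (4 ^ k)"
  define B where "B = b ^ k"
  define c where "c = nat \<lfloor>\<alpha> * real B\<rfloor>"
  define C where "C = (\<lambda>\<beta>. \<Sum>j<M. (of_bool (frac (real b ^ (e + j) * normal_number) < \<beta>) :: real))"
  have ld: "local_discrepancy b \<beta> e M = C \<beta> - real M * \<beta>" for \<beta>
    unfolding local_discrepancy_def C_def sum_subtractf by simp
  have mono: "C \<beta> \<le> C \<gamma>" if "\<beta> \<le> \<gamma>" for \<beta> \<gamma>
    unfolding C_def using that by (intro sum_mono) auto
  have B: "real B > 0" using b by (simp add: B_def)
  have "real c = of_int \<lfloor>\<alpha> * real B\<rfloor>" using \<alpha> by (simp add: c_def)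
  hence c1: "real c \<le> \<alpha> * real B" and c2: "\<alpha> * real B < real (Suc c)"
    unfolding of_nat_Suc by linarith+
  have "real c < real B"
  proof -
    have "\<alpha> * real B < 1 * real B" using False \<alpha> B by (intro mult_strict_right_mono) auto
    thus ?thesis using c1 by simp
  qed
  hence cB: "Suc c \<le> b ^ k" "c \<le> b ^ k" by (auto simp: B_def)
  have g: "\<bar>C (real c / real B) - real M * (real c / real B)\<bar> \<le> 801 * sqrt (real b) * 2 ^ k"
    "\<bar>C (real (Suc c) / real B) - real M * (real (Suc c) / real B)\<bar> \<le> 801 * sqrt (real b) * 2 ^ k"
    using local_discrepancy_grid[OF b k M] cB unfolding e_def[symmetric] ld B_def by blast+
  have d: "real c / real B \<le> \<alpha>" "\<alpha> \<le> real (Suc c) / real B"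
    using c1 c2 B by (simp_all add: divide_le_eq le_divide_eq del: of_nat_Suc)
  have m: "C (real c / real B) \<le> C \<alpha>" "C \<alpha> \<le> C (real (Suc c) / real B)"
    by (intro mono d)+
  have w: "real M * (real (Suc c) / real B) = real M * (real c / real B) + real M / real B"
    by (simp add: add_divide_distrib algebra_simps)
  have a: "real M * (real c / real B) \<le> real M * \<alpha>" "real M * \<alpha> \<le> real M * (real (Suc c) / real B)"
    by (intro mult_left_mono d; simp)+
  have "real M / real B \<le> 4 * sqrt (real b) * 2 ^ k"
  proof -
    have "precision b (4 ^ Suc k) \<le> 4 ^ Suc k" by (rule precision_le_self[OF b(1)])
    hence "M \<le> 4 ^ Suc k" using M k by (simp add: block_length_def)
    hence "real M \<le> real (4 ^ Suc k)" by (rule of_nat_mono)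
    also have "\<dots> = 4 * 2 ^ k * 2 ^ k" by (simp flip: power_mult_distrib)
    also have "\<dots> \<le> 4 * 2 ^ k * real B"
    proof -
      have "(2::real) ^ k \<le> real b ^ k" using b by (intro power_mono) auto
      thus ?thesis by (simp add: B_def)
    qed
    finally have "real M / real B \<le> 4 * 2 ^ k" using B by (simp add: divide_le_eq)
    also have "\<dots> \<le> 4 * sqrt (real b) * 2 ^ k" using b by simp
    finally show ?thesis .
  qed
  moreover have "805 * sqrt (real b) * 2 ^ k = 801 * sqrt (real b) * 2 ^ k + 4 * sqrt (real b) * 2 ^ k" by simp
  ultimately have "\<bar>C \<alpha> - real M * \<alpha>\<bar> \<le> 805 * sqrt (real b) * 2 ^ k"
    using g m w a by linarith
  thus ?thesis unfolding e_def[symmetric] ld .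
qed

lemma local_discrepancy_add:
  "local_discrepancy b \<alpha> s (M + M') = local_discrepancy b \<alpha> s M + local_discrepancy b \<alpha> (s + M) M'"
  unfolding local_discrepancy_def sum_lessThan_add by (simp add: add.assoc)

lemma local_discrepancy_trivial:
  assumes "0 \<le> \<alpha>" "\<alpha> \<le> 1"
  shows "\<bar>local_discrepancy b \<alpha> s M\<bar> \<le> real M"
proof -
  have "\<bar>local_discrepancy b \<alpha> s M\<bar> \<le> (\<Sum>j<M. 1)"
    unfolding local_discrepancy_def
    using assms by (intro order.trans[OF sum_abs] sum_mono) auto
  thus ?thesis by simp
qed

text \<open>
  At most \<open>k\<close> windows reach beyond the end of the block; they are counted trivially.
\<close>

lemma local_discrepancy_block:
  assumes b: "b \<ge> 2" "b \<le> k" and k: "k \<ge> 30" and M: "M \<le> block_length b k"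
    and \<alpha>: "0 \<le> \<alpha>" "\<alpha> \<le> 1"
  shows "\<bar>local_discrepancy b \<alpha> (precision b (4 ^ k)) M\<bar> \<le> 805 * sqrt (real b) * 2 ^ k + real k"
proof -
  define m where "m = min M (block_length b k + 1 - k)"
  have "M = m + (M - m)" by (simp add: m_def)
  hence "local_discrepancy b \<alpha> (precision b (4 ^ k)) M = local_discrepancy b \<alpha> (precision b (4 ^ k)) m
      + local_discrepancy b \<alpha> (precision b (4 ^ k) + m) (M - m)"
    by (metis local_discrepancy_add)
  moreover have "\<bar>local_discrepancy b \<alpha> (precision b (4 ^ k)) m\<bar> \<le> 805 * sqrt (real b) * 2 ^ k"
    by (rule local_discrepancy_interior[OF b k _ \<alpha>]) (simp add: m_def)
  moreover have "\<bar>local_discrepancy b \<alpha> (precision b (4 ^ k) + m) (M - m)\<bar> \<le> real (M - m)"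
    by (rule local_discrepancy_trivial[OF \<alpha>])
  moreover have "M - m \<le> k" using M by (simp add: m_def)
  ultimately show ?thesis by linarith
qed

lemma local_discrepancy_initial:
  assumes b: "b \<ge> 2" and k1: "k1 \<ge> 30" "b \<le> k1" and K: "k1 \<le> K" and N: "N \<le> precision b (4 ^ K)"
    and \<alpha>: "0 \<le> \<alpha>" "\<alpha> \<le> 1"
  shows "\<bar>local_discrepancy b \<alpha> 0 N\<bar> \<le> real (precision b (4 ^ k1)) + (\<Sum>k=k1..<K. 805 * sqrt (real b) * 2 ^ k + real k)"
  using K N
proof (induction K arbitrary: N rule: dec_induct)
  case base
  thus ?case using local_discrepancy_trivial[OF \<alpha>, of b 0 N] by simp
next
  case (step K)
  show ?case
  proof (cases "N \<le> precision b (4 ^ K)")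
    case True
    have "0 \<le> 805 * sqrt (real b) * 2 ^ K + real K" by simp
    thus ?thesis using step.IH[OF True] step.hyps(1)
      unfolding sum.atLeastLessThan_Suc[OF step.hyps(1)] by linarith
  next
    case False
    define M where "M = N - precision b (4 ^ K)"
    have N: "N = precision b (4 ^ K) + M" using False by (simp add: M_def)
    have M: "M \<le> block_length b K" using step.prems precision_block[OF b, of K] by (simp add: M_def)
    have "local_discrepancy b \<alpha> 0 N = local_discrepancy b \<alpha> 0 (precision b (4 ^ K)) + local_discrepancy b \<alpha> (precision b (4 ^ K)) M"
      unfolding N local_discrepancy_add by simp
    moreover have "\<bar>local_discrepancy b \<alpha> (precision b (4 ^ K)) M\<bar> \<le> 805 * sqrt (real b) * 2 ^ K + real K"
      using step.hyps k1 by (intro local_discrepancy_block[OF b _ _ M \<alpha>]) auto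
    ultimately show ?thesis using step.IH[OF order.refl]
      unfolding sum.atLeastLessThan_Suc[OF step.hyps(1)] by linarith
  qed
qed

text \<open>
  The geometric series at most doubles the last term, and the remaining \<open>5 * 2 ^ K\<close> absorbs the constant \<open>E\<close> and
  the windows across block ends.
\<close>

lemma error_sum_le:
  assumes b: "b \<ge> 2" and K: "k1 \<le> K" and E: "E \<le> K"
  shows "real E + (\<Sum>k=k1..<Suc K. 805 * sqrt (real b) * 2 ^ k + real k) \<le> 1615 * sqrt (real b) * 2 ^ K"
proof -
  have geo: "(\<Sum>k<Suc K. (2::real) ^ k) \<le> 2 * 2 ^ K" by (induction K) auto
  have lin: "(\<Sum>k<Suc K. real k) \<le> 4 * 2 ^ K"
  proof (induction K)
    case (Suc K)
    have "Suc K \<le> 2 ^ K" by (rule Suc_leI[OF less_exp])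
    hence "real (Suc K) \<le> 2 ^ K" by (metis of_nat_le_iff of_nat_numeral of_nat_power)
    thus ?case using Suc by simp
  qed simp
  have "E < 2 ^ K" using E less_exp[of K] by linarith
  hence E': "real E \<le> 2 ^ K" by (metis less_imp_le of_nat_less_iff of_nat_numeral of_nat_power)
  have "(\<Sum>k=k1..<Suc K. 805 * sqrt (real b) * 2 ^ k + real k) \<le> (\<Sum>k<Suc K. 805 * sqrt (real b) * 2 ^ k + real k)"
    by (intro sum_mono2) auto
  also have "\<dots> = 805 * sqrt (real b) * (\<Sum>k<Suc K. 2 ^ k) + (\<Sum>k<Suc K. real k)"
    by (simp only: sum.distrib sum_distrib_left)
  also have "\<dots> \<le> 805 * sqrt (real b) * (2 * 2 ^ K) + 4 * 2 ^ K"
    by (intro add_mono mult_left_mono geo lin) auto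
  finally have "real E + (\<Sum>k=k1..<Suc K. 805 * sqrt (real b) * 2 ^ k + real k) \<le> 1610 * sqrt (real b) * 2 ^ K + 5 * (1 * 2 ^ K)"
    using E' by linarith
  also have "\<dots> \<le> 1610 * sqrt (real b) * 2 ^ K + 5 * (sqrt (real b) * 2 ^ K)"
    using b by (intro add_left_mono mult_left_mono mult_right_mono) auto
  finally show ?thesis by simp
qed

text \<open>
  Since \<open>b \<le> 2 ^ b\<close>, \<open>4 ^ K\<close> bits carry about \<open>4 ^ K / b\<close> digits or more. The threshold \<open>\<surd>b 2 ^ K\<close> is thereby
  turned into \<open>b \<surd>N\<close>.
\<close>

lemma four_power_less: 
  assumes b: "b \<ge> 2" shows "4 ^ K < b * (precision b (4 ^ K) + 1)"
proof -
  have "(2::nat) ^ (4 ^ K) < b ^ Suc (precision b (4 ^ K))" by (rule precision_less[OF b])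
  also have "\<dots> \<le> (2 ^ b) ^ Suc (precision b (4 ^ K))" by (intro power_mono less_imp_le[OF less_exp]) auto
  finally have "(2::nat) ^ (4 ^ K) < 2 ^ (b * Suc (precision b (4 ^ K)))" by (simp only: power_mult)
  thus ?thesis by simp
qed

lemma ex_scale:
  assumes b: "b \<ge> 2" and N: "N \<ge> precision b (4 ^ K1)"
  obtains K where "K1 \<le> K" "precision b (4 ^ K) \<le> N" "N \<le> precision b (4 ^ Suc K)"
proof -
  let ?P = "\<lambda>K. N < precision b (4 ^ K)"
  have "?P (b * (N + 2))"
  proof -
    have "b * (N + 2) < 4 ^ (b * (N + 2))" by (rule less_le_trans[OF less_exp power_mono]) auto
    also have "\<dots> < b * (precision b (4 ^ (b * (N + 2))) + 1)" by (rule four_power_less[OF b])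
    finally have "N + 2 < precision b (4 ^ (b * (N + 2))) + 1" by (metis mult_less_cancel1)
    thus ?thesis by simp
  qed
  hence L: "?P (LEAST K. ?P K)" by (rule LeastI)
  have mono: "precision b (4 ^ K) \<le> precision b (4 ^ K')" if "K \<le> K'" for K K'
    using that by (intro precision_mono[OF b] power_increasing) auto
  have "K1 < (LEAST K. ?P K)"
  proof (rule ccontr)
    assume "\<not> ?thesis"
    hence "precision b (4 ^ (LEAST K. ?P K)) \<le> precision b (4 ^ K1)" by (intro mono) simp
    thus False using L N by simp
  qed
  then obtain K where K: "(LEAST K. ?P K) = Suc K" "K1 \<le> K" by (metis less_Suc_eq_le gr0_conv_Suc less_zeroE not0_implies_Suc)
  have "\<not> ?P K" using K(1) by (metis lessI not_less_Least)
  thus ?thesis using that[of K] K L by simp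
qed

text \<open>
  The scale \<open>K1\<close> is so large that the errors of the scales at which \<open>b\<close> was not yet tested are negligible.
\<close>

lemma local_discrepancy_le:
  assumes b: "b \<ge> 2"
  obtains N0 where "N0 \<ge> 8"
    "\<And>N \<alpha>. N \<ge> N0 \<Longrightarrow> 0 \<le> \<alpha> \<Longrightarrow> \<alpha> \<le> 1 \<Longrightarrow> \<bar>local_discrepancy b \<alpha> 0 N\<bar> \<le> 1615 * real b * sqrt (real N + 1)"
proof -
  define k1 where "k1 = max 30 b"
  define E where "E = precision b (4 ^ k1)"
  define K1 where "K1 = k1 + E"
  show ?thesis
  proof (rule that[of "precision b (4 ^ K1) + 8"])
    fix N and \<alpha> :: real
    assume N: "N \<ge> precision b (4 ^ K1) + 8" and \<alpha>: "0 \<le> \<alpha>" "\<alpha> \<le> 1"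
    have "N \<ge> precision b (4 ^ K1)" using N by simp
    then obtain K where K: "K1 \<le> K" "precision b (4 ^ K) \<le> N" "N \<le> precision b (4 ^ Suc K)"
      by (rule ex_scale[OF b])
    have "\<bar>local_discrepancy b \<alpha> 0 N\<bar> \<le> real E + (\<Sum>k=k1..<Suc K. 805 * sqrt (real b) * 2 ^ k + real k)"
      unfolding E_def using K by (intro local_discrepancy_initial[OF b _ _ _ K(3) \<alpha>]) (auto simp: k1_def K1_def)
    also have "\<dots> \<le> 1615 * sqrt (real b) * 2 ^ K"
      using K by (intro error_sum_le[OF b]) (auto simp: K1_def)
    also have "\<dots> \<le> 1615 * sqrt (real b) * (sqrt (real b) * sqrt (real N + 1))"
    proof (intro mult_left_mono)
      have "4 ^ K \<le> b * (N + 1)"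
        using four_power_less[OF b, of K] K(2)
        by (meson add_le_mono1 less_imp_le less_le_trans mult_le_mono2)
      hence "real (4 ^ K) \<le> real (b * (N + 1))" by (rule of_nat_mono)
      hence "sqrt ((2 ^ K)\<^sup>2) \<le> sqrt (real b * (real N + 1))"
        by (intro real_sqrt_le_mono) (simp add: power2_eq_square algebra_simps flip: power_mult_distrib)
      thus "2 ^ K \<le> sqrt (real b) * sqrt (real N + 1)" by (simp add: real_sqrt_mult)
    qed auto
    also have "\<dots> = 1615 * real b * sqrt (real N + 1)" by simp
    finally show "\<bar>local_discrepancy b \<alpha> 0 N\<bar> \<le> 1615 * real b * sqrt (real N + 1)" .
  qed simp
qed

text \<open>
  An interval is a difference of two intervals that start at 0, whence the constant \<open>2 * 1615 = 3230\<close>; for \<open>N \<ge> 8\<close>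
  the quotient \<open>3433 / 3230\<close> covers the step from \<open>N + 1\<close> to \<open>N\<close>.
\<close>

lemma discrepancy_normal_number:
  assumes b: "b \<ge> 2"
  obtains N0 where
    "\<And>N. N \<ge> N0 \<Longrightarrow> discrepancy (\<lambda>j. frac (real b ^ j * normal_number)) N \<le> 3433 * real b / sqrt (real N)"
    "\<And>N. N \<ge> N0 \<Longrightarrow> 0 \<le> discrepancy (\<lambda>j. frac (real b ^ j * normal_number)) N"
proof -
  obtain N0 where N0: "N0 \<ge> 8"
    "\<And>N \<alpha>. N \<ge> N0 \<Longrightarrow> 0 \<le> \<alpha> \<Longrightarrow> \<alpha> \<le> 1 \<Longrightarrow> \<bar>local_discrepancy b \<alpha> 0 N\<bar> \<le> 1615 * real b * sqrt (real N + 1)"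
    using local_discrepancy_le[OF b] by metis
  define u where "u = (\<lambda>j. frac (real b ^ j * normal_number))"
  define A where "A = {(\<alpha>\<^sub>1, \<alpha>\<^sub>2). 0 \<le> \<alpha>\<^sub>1 \<and> \<alpha>\<^sub>1 < \<alpha>\<^sub>2 \<and> \<alpha>\<^sub>2 \<le> (1::real)}"
  define f where "f = (\<lambda>N (\<alpha>\<^sub>1, \<alpha>\<^sub>2). \<bar>1 / real N * real (card {j. j < N \<and> \<alpha>\<^sub>1 \<le> u j \<and> u j < \<alpha>\<^sub>2}) - (\<alpha>\<^sub>2 - \<alpha>\<^sub>1)\<bar>)"
  have disc: "discrepancy u N = (SUP a\<in>A. f N a)" for N
    unfolding discrepancy_def A_def f_def by (simp add: case_prod_beta')
  have A0: "(0, 1) \<in> A" by (simp add: A_def)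
  have bound: "f N a \<le> 3433 * real b / sqrt (real N)" if N: "N \<ge> N0" and a: "a \<in> A" for N a
  proof -
    obtain \<alpha> \<beta> where a': "a = (\<alpha>, \<beta>)" by (cases a)
    have ab: "0 \<le> \<alpha>" "\<alpha> < \<beta>" "\<beta> \<le> 1" using a by (auto simp: A_def a')
    have N8: "N \<ge> 8" using N N0(1) by simp
    have "real (card {j. j < N \<and> \<alpha> \<le> u j \<and> u j < \<beta>}) = (\<Sum>j<N. of_bool (\<alpha> \<le> u j \<and> u j < \<beta>))"
    proof -
      have "{..<N} \<inter> {j. \<alpha> \<le> u j \<and> u j < \<beta>} = {j. j < N \<and> \<alpha> \<le> u j \<and> u j < \<beta>}" by auto
      thus ?thesis by (simp add: of_bool_def sum.If_cases)
    qed
    also have "\<dots> = (\<Sum>j<N. of_bool (u j < \<beta>) - of_bool (u j < \<alpha>))"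
      using ab by (intro sum.cong refl) (auto simp: of_bool_def)
    also have "\<dots> = local_discrepancy b \<beta> 0 N - local_discrepancy b \<alpha> 0 N + real N * (\<beta> - \<alpha>)"
      unfolding local_discrepancy_def sum_subtractf u_def by (simp add: algebra_simps)
    finally have "real (card {j. j < N \<and> \<alpha> \<le> u j \<and> u j < \<beta>}) - real N * (\<beta> - \<alpha>)
       = local_discrepancy b \<beta> 0 N - local_discrepancy b \<alpha> 0 N"
      by simp
    hence "real N * (1 / real N * real (card {j. j < N \<and> \<alpha> \<le> u j \<and> u j < \<beta>}) - (\<beta> - \<alpha>))
       = local_discrepancy b \<beta> 0 N - local_discrepancy b \<alpha> 0 N"
      using N8 by (simp add: right_diff_distrib)
    hence "real N * f N a = \<bar>local_discrepancy b \<beta> 0 N - local_discrepancy b \<alpha> 0 N\<bar>"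
      unfolding f_def a' by (simp only: prod.case) (metis abs_mult abs_of_nat)
    also have "\<dots> \<le> 1615 * real b * sqrt (real N + 1) + 1615 * real b * sqrt (real N + 1)"
      using N0(2)[OF N, of \<alpha>] N0(2)[OF N, of \<beta>] ab by linarith
    also have "\<dots> = real b * (3230 * sqrt (real N + 1))" by simp
    also have "\<dots> \<le> real b * (3433 * sqrt (real N))"
    proof (intro mult_left_mono)
      have "sqrt (3230\<^sup>2 * (real N + 1)) \<le> sqrt (3433\<^sup>2 * real N)"
        using N8 by (intro real_sqrt_le_mono) simp
      thus "3230 * sqrt (real N + 1) \<le> 3433 * sqrt (real N)"
        unfolding real_sqrt_mult real_sqrt_abs by simp
    qed auto
    finally have "real N * f N a \<le> real b * (3433 * sqrt (real N))" .
    moreover have "real N = sqrt (real N) * sqrt (real N)" by simp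
    ultimately have "sqrt (real N) * (sqrt (real N) * f N a) \<le> sqrt (real N) * (3433 * real b)"
      by (metis mult.assoc mult.commute)
    hence "sqrt (real N) * f N a \<le> 3433 * real b" using N8 by simp
    thus ?thesis using N8 by (simp add: le_divide_eq mult.commute)
  qed
  show ?thesis
  proof (rule that[of N0, folded u_def])
    fix N assume N: "N \<ge> N0"
    show "discrepancy u N \<le> 3433 * real b / sqrt (real N)"
      unfolding disc using A0 by (intro cSUP_least bound[OF N]) auto
    have "0 \<le> f N (0, 1)" by (simp add: f_def)
    also have "\<dots> \<le> discrepancy u N"
      unfolding disc using bound[OF N] A0 by (intro cSUP_upper) (auto intro!: bdd_aboveI2)
    finally show "0 \<le> discrepancy u N" .
  qed
qed

lemma absolutely_normal_normal_number: "absolutely_normal normal_number"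
  unfolding absolutely_normal_def normal_in_base_def uniformly_distributed_def
proof (intro allI impI)
  fix b :: nat assume "b \<ge> 2"
  then obtain N0 where N0:
    "\<And>N. N \<ge> N0 \<Longrightarrow> discrepancy (\<lambda>j. frac (real b ^ j * normal_number)) N \<le> 3433 * real b / sqrt (real N)"
    "\<And>N. N \<ge> N0 \<Longrightarrow> 0 \<le> discrepancy (\<lambda>j. frac (real b ^ j * normal_number)) N"
    by (rule discrepancy_normal_number) blast
  have lim: "(\<lambda>N. 3433 * real b / sqrt (real N)) \<longlonglongrightarrow> 0"
    by (rule tendsto_divide_0[OF tendsto_const])
      (rule filterlim_at_top_imp_at_infinity[OF filterlim_compose[OF sqrt_at_top filterlim_real_sequentially]])
  show "(\<lambda>N. discrepancy (\<lambda>j. frac (real b ^ j * normal_number)) N) \<longlonglongrightarrow> 0"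
    by (rule tendsto_sandwich[OF _ _ tendsto_const lim])
      (auto simp: eventually_at_top_linorder intro!: exI[of _ N0] N0)
qed

section \<open>Reachability with a bound on the number of operations\<close>

text \<open>
  A total-correctness triple for one initial store, with a bound on the operations; the rules below
  compose such triples along the syntax.
\<close>

definition reach :: "com \<Rightarrow> store \<Rightarrow> nat \<Rightarrow> (store \<Rightarrow> bool) \<Rightarrow> bool" where
  "reach p s T R \<longleftrightarrow> (\<exists>t s'. exec p s t s' \<and> t \<le> T \<and> R s')"

lemma reach_mono: "reach p s T Q \<Longrightarrow> T \<le> T' \<Longrightarrow> (\<And>s'. Q s' \<Longrightarrow> R s') \<Longrightarrow> reach p s T' R"
  unfolding reach_def by (meson le_trans)

lemma reach_Seq: "reach p s T Q \<Longrightarrow> (\<And>s'. Q s' \<Longrightarrow> reach q s' T' R) \<Longrightarrow> reach (Seq p q) s (T + T') R"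
  unfolding reach_def by (meson exec.Seq add_mono)

text \<open>
  Loop-free programs are evaluated by the simplifier instead of being derived rule by rule.
\<close>

fun loop_free :: "com \<Rightarrow> bool" where
  "loop_free Skip = True"
| "loop_free (Assign x i a) = True"
| "loop_free (Seq p q) = (loop_free p \<and> loop_free q)"
| "loop_free (Cond g p q) = (loop_free p \<and> loop_free q)"
| "loop_free (While g p) = False"

fun run :: "com \<Rightarrow> store \<Rightarrow> store" where
  "run Skip s = s"
| "run (Assign x i a) s = s(x := (s x)(aval i s := aval a s))"
| "run (Seq p q) s = run q (run p s)"
| "run (Cond g p q) s = (if bval g s then run p s else run q s)"
| "run (While g p) s = s"

fun cost :: "com \<Rightarrow> nat" where
  "cost Skip = 1"
| "cost (Assign x i a) = aops i + aops a + 1"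
| "cost (Seq p q) = cost p + cost q"
| "cost (Cond g p q) = bops g + 1 + max (cost p) (cost q)"
| "cost (While g p) = 0"

lemma exec_loop_free: "loop_free p \<Longrightarrow> \<exists>t\<le>cost p. exec p s t (run p s)"
proof (induction p arbitrary: s)
  case Skip
  show ?case using exec.Skip by auto
next
  case (Assign x i a)
  show ?case unfolding cost.simps run.simps using exec.Assign[of x i a s] by blast
next
  case (Seq p q)
  then obtain t u where "t \<le> cost p" "exec p s t (run p s)" "u \<le> cost q" "exec q (run p s) u (run q (run p s))"
    by fastforce
  thus ?case by (auto intro!: exI[of _ "t + u"] exec.Seq)
next
  case (Cond g p q)
  obtain t u where t: "t \<le> cost p" "exec p s t (run p s)" and u: "u \<le> cost q" "exec q s u (run q s)"
    using Cond by fastforce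
  show ?case
  proof (cases "bval g s")
    case True
    have "exec (Cond g p q) s (bops g + 1 + t) (run (Cond g p q) s)"
      using exec.CondTrue[OF True t(2)] True by simp
    thus ?thesis by (rule exI[of _ "bops g + 1 + t", OF conjI, rotated]) (use t in simp)
  next
    case False
    have "exec (Cond g p q) s (bops g + 1 + u) (run (Cond g p q) s)"
      using exec.CondFalse[OF False u(2)] False by simp
    thus ?thesis by (rule exI[of _ "bops g + 1 + u", OF conjI, rotated]) (use u in simp)
  qed
qed simp

lemma reach_loop_free: "loop_free p \<Longrightarrow> cost p \<le> T \<Longrightarrow> R (run p s) \<Longrightarrow> reach p s T R"
  unfolding reach_def using exec_loop_free by (meson le_trans)

text \<open>
  For loops with a known number \<open>n\<close> of iterations. The bound uses an upper estimate \<open>X\<close> of \<open>n\<close>: all loops of the search will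
  be measured against the same \<open>X\<close>, so that the final bound is a polynomial in \<open>X\<close>.
\<close>

lemma reach_While:
  assumes "Inv 0 s"
    and step: "\<And>i s. i < n \<Longrightarrow> Inv i s \<Longrightarrow> bval g s \<and> reach p s T (Inv (Suc i))"
    and stop: "\<And>s. Inv n s \<Longrightarrow> \<not> bval g s"
    and X: "n \<le> X" "1 \<le> X"
  shows "reach (While g p) s (X * (T + 2 * bops g + 2)) (Inv n)"
proof -
  have "reach (While g p) s ((n - i) * (T + bops g + 1) + bops g + 1) (Inv n)" if "i \<le> n" "Inv i s" for i s
    using that
  proof (induction "n - i" arbitrary: i s)
    case 0
    hence "Inv n s" by simp
    thus ?case using exec.WhileFalse[OF stop[OF \<open>Inv n s\<close>]] unfolding reach_def by fastforce
  next
    case (Suc m)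
    hence i: "i < n" and m: "m = n - Suc i" by auto
    from step[OF i Suc.prems(2)] obtain t s' where 1: "bval g s" "exec p s t s'" "t \<le> T" "Inv (Suc i) s'"
      unfolding reach_def by blast
    from Suc.hyps(1)[OF m _ 1(4)] i obtain u s'' where 2: "exec (While g p) s' u s''"
      "u \<le> (n - Suc i) * (T + bops g + 1) + bops g + 1" "Inv n s''"
      unfolding reach_def by auto
    have "exec (While g p) s (bops g + 1 + t + u) s''" by (rule exec.WhileTrue[OF 1(1,2) 2(1)])
    moreover have "n - i = Suc (n - Suc i)" using i by simp
    ultimately show ?case unfolding reach_def using 1(3) 2(2,3) by (auto intro!: exI[of _ "bops g + 1 + t + u"])
  qed
  from this[of 0 s] assms(1) have "reach (While g p) s (n * (T + bops g + 1) + bops g + 1) (Inv n)" by simp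
  moreover have "n * (T + bops g + 1) + bops g + 1 \<le> X * (T + 2 * bops g + 2)"
  proof -
    have "n * (T + bops g + 1) + 1 * (bops g + 1) \<le> X * (T + bops g + 1) + X * (bops g + 1)"
      by (intro add_mono mult_right_mono X) auto
    thus ?thesis by (simp add: algebra_simps)
  qed
  ultimately show ?thesis by (rule reach_mono)
qed

definition same_except :: "vname set \<Rightarrow> store \<Rightarrow> store \<Rightarrow> bool" where
  "same_except W s s' \<longleftrightarrow> (\<forall>x. x \<notin> W \<longrightarrow> s' x = s x)"

lemma same_exceptD: "same_except W s s' \<Longrightarrow> x \<notin> W \<Longrightarrow> s' x = s x"
  by (simp add: same_except_def)

lemma same_exceptI: "(\<And>x. x \<notin> W \<Longrightarrow> s' x = s x) \<Longrightarrow> same_except W s s'"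
  by (simp add: same_except_def)

lemma same_except_trans:
  "same_except V s s' \<Longrightarrow> same_except W s' s'' \<Longrightarrow> V \<subseteq> U \<Longrightarrow> W \<subseteq> U \<Longrightarrow> same_except U s s''"
  unfolding same_except_def by (metis subsetD)

abbreviation var :: "vname \<Rightarrow> aexp" where
  "var x \<equiv> Read x (Const 0)"

abbreviation assign :: "vname \<Rightarrow> aexp \<Rightarrow> com" where
  "assign x a \<equiv> Assign x (Const 0) a"

section \<open>Testing all candidates\<close>

text \<open>
  The program keeps the following scalars. In \<open>k\<close>, \<open>n\<close>, \<open>P\<close>, \<open>y\<close>: the scale, \<open>4 ^ k\<close>, \<open>2 ^ n\<close> and the current candidate; in \<open>Q\<close>: the
  power \<open>2 ^ (4 n)\<close>; in \<open>b\<close>: the base; in \<open>e\<close>, \<open>f\<close>: the largest powers of \<open>b\<close> up to \<open>P\<close> and \<open>Q\<close>; in \<open>h\<close>: their quotient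
  \<open>b ^ H\<close>; in \<open>l\<close>: \<open>b ^ k\<close>; in \<open>v\<close>: the digits under test; in \<open>c\<close>, \<open>m\<close>, \<open>t\<close>: the grid point, the number of windows and the hits
  so far; in \<open>w\<close>: the power of \<open>b\<close> that selects the window; in \<open>z\<close>: a loop counter; in \<open>o\<close>: 1 as long as no test has failed,
  and 0 afterwards.
\<close>

definition largest_power :: "vname \<Rightarrow> vname \<Rightarrow> com" where
  "largest_power r q = Seq (assign r (Const 1))
     (While (Neg (Less (var q) (Mul (var r) (var ''b'')))) (assign r (Mul (var r) (var ''b''))))"

lemma reach_largest_power:
  assumes b: "b \<ge> 2" and s: "s ''b'' 0 = int b" "s q 0 = 2 ^ n" and r: "r \<noteq> q" "r \<noteq> ''b''"
    and X: "n \<le> X" "1 \<le> X"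
  shows "reach (largest_power r q) s (30 * X) (\<lambda>s'. same_except {r} s s' \<and> s' r 0 = int (b ^ precision b n))"
proof -
  define Inv where "Inv = (\<lambda>i s'. same_except {r} s s' \<and> s' r 0 = int (b ^ i))"
  have le: "b ^ Suc i \<le> 2 ^ n" if "i < precision b n" for i
  proof -
    have "b ^ Suc i \<le> b ^ precision b n" using that b by (intro power_increasing) auto
    also have "\<dots> \<le> 2 ^ n" by (rule precision_le[OF b])
    finally show ?thesis .
  qed
  have "reach (largest_power r q) s (3 + X * (7 + 2 * 9 + 2)) (Inv (precision b n))"
    unfolding largest_power_def
  proof (rule reach_Seq)
    show "reach (assign r (Const 1)) s 3 (Inv 0)"
      by (rule reach_loop_free) (auto simp: Inv_def same_except_def)
    fix s' assume s': "Inv 0 s'"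
    have "reach (While (Neg (Less (var q) (Mul (var r) (var ''b'')))) (assign r (Mul (var r) (var ''b'')))) s'
      (X * (7 + 2 * bops (Neg (Less (var q) (Mul (var r) (var ''b'')))) + 2)) (Inv (precision b n))"
    proof (rule reach_While[where Inv = Inv, OF s'])
      show "precision b n \<le> X" using precision_le_self[OF b, of n] X by simp
      show "1 \<le> X" by (rule X)
      fix i s'' assume i: "i < precision b n" and "Inv i s''"
      hence v: "s'' r 0 = int (b ^ i)" "s'' q 0 = 2 ^ n" "s'' ''b'' 0 = int b"
        using s r by (auto simp: Inv_def same_except_def)
      have "int (b ^ Suc i) \<le> int (2 ^ n)" using le[OF i] by (simp only: of_nat_le_iff)
      hence "\<not> 2 ^ n < int b ^ i * int b" by (simp add: mult.commute)
      hence "bval (Neg (Less (var q) (Mul (var r) (var ''b'')))) s''" by (simp add: v)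
      moreover have "reach (assign r (Mul (var r) (var ''b''))) s'' 7 (Inv (Suc i))"
        by (rule reach_loop_free) (use \<open>Inv i s''\<close> v in \<open>auto simp: Inv_def same_except_def\<close>)
      ultimately show "bval (Neg (Less (var q) (Mul (var r) (var ''b'')))) s'' \<and>
         reach (assign r (Mul (var r) (var ''b''))) s'' 7 (Inv (Suc i))" ..
    next
      fix s'' assume "Inv (precision b n) s''"
      hence v: "s'' r 0 = int (b ^ precision b n)" "s'' q 0 = 2 ^ n" "s'' ''b'' 0 = int b"
        using s r by (auto simp: Inv_def same_except_def)
      have "int (2 ^ n) < int (b ^ Suc (precision b n))" using precision_less[OF b, of n] by (simp only: of_nat_less_iff)
      thus "\<not> bval (Neg (Less (var q) (Mul (var r) (var ''b'')))) s''" by (simp add: v mult.commute)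
    qed
    thus "reach (While (Neg (Less (var q) (Mul (var r) (var ''b'')))) (assign r (Mul (var r) (var ''b'')))) s'
      (X * (7 + 2 * 9 + 2)) (Inv (precision b n))"
      by (rule reach_mono) auto
  qed
  thus ?thesis by (rule reach_mono) (use X in \<open>auto simp: Inv_def\<close>)
qed


definition window_size :: com where
  "window_size = Seq (assign ''l'' (Const 1)) (Seq (assign ''z'' (Const 0))
     (While (Less (var ''z'') (var ''k'')) (Seq (assign ''l'' (Mul (var ''l'') (var ''b''))) (assign ''z'' (Add (var ''z'') (Const 1))))))"

lemma reach_window_size:
  assumes s: "s ''b'' 0 = int b" "s ''k'' 0 = int k" and X: "k \<le> X" "1 \<le> X"
  shows "reach window_size s (40 * X) (\<lambda>s'. same_except {''l'', ''z''} s s' \<and> s' ''l'' 0 = int (b ^ k))"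
proof -
  define Inv where "Inv = (\<lambda>i s'. same_except {''l'', ''z''} s s' \<and> s' ''l'' 0 = int (b ^ i) \<and> s' ''z'' 0 = int i)"
  define g where "g = Less (var ''z'') (var ''k'')"
  define p where "p = Seq (assign ''l'' (Mul (var ''l'') (var ''b''))) (assign ''z'' (Add (var ''z'') (Const 1)))"
  have "reach window_size s (3 + (3 + X * (13 + 2 * bops g + 2))) (Inv k)"
    unfolding window_size_def g_def[symmetric] p_def[symmetric]
  proof (rule reach_Seq)
    show "reach (assign ''l'' (Const 1)) s 3 (\<lambda>s'. same_except {''l'', ''z''} s s' \<and> s' ''l'' 0 = 1)"
      by (rule reach_loop_free) (auto simp: same_except_def)
    fix s1 assume s1: "same_except {''l'', ''z''} s s1 \<and> s1 ''l'' 0 = 1"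
    show "reach (Seq (assign ''z'' (Const 0)) (While g p)) s1 (3 + X * (13 + 2 * bops g + 2)) (Inv k)"
    proof (rule reach_Seq)
      show "reach (assign ''z'' (Const 0)) s1 3 (Inv 0)"
        by (rule reach_loop_free) (use s1 in \<open>auto simp: Inv_def same_except_def\<close>)
      fix s2 assume s2: "Inv 0 s2"
      show "reach (While g p) s2 (X * (13 + 2 * bops g + 2)) (Inv k)"
      proof (rule reach_While[where Inv = Inv, OF s2 _ _ X])
        fix i s' assume i: "i < k" and I: "Inv i s'"
        have v: "s' ''b'' 0 = int b" "s' ''k'' 0 = int k" using I s by (auto simp: Inv_def same_except_def)
        have "reach p s' 13 (Inv (Suc i))" unfolding p_def
          by (rule reach_loop_free) (use I v in \<open>auto simp: Inv_def same_except_def\<close>)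
        thus "bval g s' \<and> reach p s' 13 (Inv (Suc i))" using i I v by (simp add: g_def Inv_def)
      next
        fix s' assume I: "Inv k s'"
        hence "s' ''k'' 0 = int k" using s by (auto simp: Inv_def same_except_def)
        thus "\<not> bval g s'" using I by (simp add: g_def Inv_def)
      qed
    qed
  qed
  thus ?thesis by (rule reach_mono) (use X in \<open>auto simp: Inv_def g_def\<close>)
qed

definition close_count :: "nat \<Rightarrow> nat \<Rightarrow> nat \<Rightarrow> nat \<Rightarrow> nat \<Rightarrow> nat \<Rightarrow> bool" where
  "close_count b k H v M c \<longleftrightarrow>
     (int (hits b k H v M c) * int (b ^ k) - int M * int c)\<^sup>2 \<le> 801\<^sup>2 * 4 ^ k * int b * (int (b ^ k))\<^sup>2"

lemma balanced_iff_close_count: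
  "balanced b k H v \<longleftrightarrow> (\<forall>c<b ^ k. \<forall>M\<le>H + 1 - k. close_count b k H v M c)"
  by (auto simp: balanced_def close_count_def)

lemma hits_0: "hits b k H v 0 c = 0" by (simp add: hits_def)

lemma hits_Suc: "hits b k H v (Suc M) c = hits b k H v M c + (if digit_word b H k v M < c then 1 else 0)"
proof -
  have "real (hits b k H v (Suc M) c) = real (hits b k H v M c) + of_bool (digit_word b H k v M < c)"
    by (simp only: hits_eq_sum sum.lessThan_Suc)
  thus ?thesis by (auto simp: of_bool_def simp flip: of_nat_Suc)
qed

lemma close_count_0: "close_count b k H v 0 c" by (simp add: close_count_def hits_0)

definition tally :: com where
  "tally = Seq (Cond (Less (Mod (Div (var ''v'') (var ''w'')) (var ''l'')) (var ''c'')) (assign ''t'' (Add (var ''t'') (Const 1))) Skip)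
    (Seq (assign ''m'' (Add (var ''m'') (Const 1)))
    (Seq (Cond (Less (Mul (Mul (Const (801\<^sup>2)) (var ''n'')) (Mul (var ''b'') (Mul (var ''l'') (var ''l''))))
                     (Mul (Sub (Mul (var ''t'') (var ''l'')) (Mul (var ''m'') (var ''c'')))
                          (Sub (Mul (var ''t'') (var ''l'')) (Mul (var ''m'') (var ''c'')))))
               (assign ''o'' (Const 0)) Skip)
      (assign ''w'' (Div (var ''w'') (var ''b'')))))"

definition scan_prefixes :: com where
  "scan_prefixes = Seq (Seq (assign ''t'' (Const 0)) (Seq (assign ''m'' (Const 0)) (assign ''w'' (Div (var ''h'') (var ''l'')))))
    (While (Less (Const 0) (var ''w'')) tally)"

text \<open>
  If \<open>H < k\<close> then \<open>w\<close> starts with 0 and the loop is not entered, in accordance with \<open>H + 1 - k = 0\<close>. Otherwise \<open>w\<close> runs through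
  \<open>b ^ (H - k), ..., b ^ 0\<close>, for the windows from left to right.
\<close>

lemma reach_scan_prefixes:
  assumes b: "b \<ge> 2"
    and s: "s ''b'' 0 = int b" "s ''n'' 0 = 4 ^ k" "s ''l'' 0 = int (b ^ k)" "s ''h'' 0 = int (b ^ H)"
      "s ''v'' 0 = int V" "s ''c'' 0 = int c"
    and X: "H + 1 \<le> X"
  shows "reach scan_prefixes s (120 * X) (\<lambda>s'. same_except {''t'', ''m'', ''w'', ''o''} s s' \<and>
    s' ''o'' 0 = (if \<forall>M\<le>H + 1 - k. close_count b k H V M c then s ''o'' 0 else 0))"
proof -
  define L where "L = H + 1 - k"
  define Inv where "Inv = (\<lambda>i s'. same_except {''t'', ''m'', ''w'', ''o''} s s' \<and>
    s' ''t'' 0 = int (hits b k H V i c) \<and> s' ''m'' 0 = int i \<and> s' ''w'' 0 = int (b ^ H div b ^ k div b ^ i) \<and>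
    s' ''o'' 0 = (if \<forall>M\<le>i. close_count b k H V M c then s ''o'' 0 else 0))"
  define g where "g = Less (Const 0) (var ''w'')"
  have w: "b ^ H div b ^ k div b ^ i = b ^ (H - k - i)" if "i < L" for i
  proof -
    have "k \<le> H" "i \<le> H - k" using that by (auto simp: L_def)
    thus ?thesis using b by (simp add: power_diff power_add div_mult2_eq)
  qed
  have wL: "b ^ H div b ^ k div b ^ L = 0"
  proof (cases "k \<le> H")
    case True
    hence "b ^ H div b ^ k = b ^ (H - k)" using b by (simp add: power_diff)
    moreover have "b ^ (H - k) < b ^ L" using b True by (intro power_strict_increasing) (auto simp: L_def)
    ultimately show ?thesis by simp
  next
    case False
    hence "b ^ H < b ^ k" using b by (intro power_strict_increasing) auto
    thus ?thesis by simp
  qed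
  have "reach scan_prefixes s (20 + X * (80 + 2 * bops g + 2)) (Inv L)"
    unfolding scan_prefixes_def g_def[symmetric]
  proof (rule reach_Seq)
    show "reach (Seq (assign ''t'' (Const 0)) (Seq (assign ''m'' (Const 0)) (assign ''w'' (Div (var ''h'') (var ''l''))))) s 20 (Inv 0)"
      by (rule reach_loop_free) (use s in \<open>auto simp: Inv_def same_except_def hits_0 close_count_0 zdiv_int\<close>)
    fix s1 assume s1: "Inv 0 s1"
    show "reach (While g tally) s1 (X * (80 + 2 * bops g + 2)) (Inv L)"
    proof (rule reach_While[where Inv = Inv, OF s1])
      show "L \<le> X" "1 \<le> X" using X by (auto simp: L_def)
      fix i s' assume i: "i < L" and I: "Inv i s'"
      have v: "s' ''b'' 0 = int b" "s' ''n'' 0 = 4 ^ k" "s' ''l'' 0 = int (b ^ k)" "s' ''v'' 0 = int V" "s' ''c'' 0 = int c"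
        using I s by (auto simp: Inv_def same_except_def)
      have I': "s' ''t'' 0 = int (hits b k H V i c)" "s' ''m'' 0 = int i" "s' ''w'' 0 = int (b ^ (H - k - i))"
        "s' ''o'' 0 = (if \<forall>M\<le>i. close_count b k H V M c then s ''o'' 0 else 0)"
        using I w[OF i] by (simp_all add: Inv_def)
      have dw: "int V div int (b ^ (H - k - i)) mod int (b ^ k) < int c \<longleftrightarrow> digit_word b H k V i < c"
        by (simp only: digit_word_def flip: zdiv_int zmod_int) simp
      define h where "h = int (hits b k H V (Suc i) c)"
      have h: "(if digit_word b H k V i < c then int (hits b k H V i c) + 1 else int (hits b k H V i c)) = h"
        by (simp add: h_def hits_Suc)
      define s2 where "s2 = run (Seq (Cond (Less (Mod (Div (var ''v'') (var ''w'')) (var ''l'')) (var ''c'')) (assign ''t'' (Add (var ''t'') (Const 1))) Skip)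
        (assign ''m'' (Add (var ''m'') (Const 1)))) s'"
      have s2: "s2 ''t'' 0 = h" "s2 ''m'' 0 = int (Suc i)" "\<And>x. x \<notin> {''t'', ''m''} \<Longrightarrow> s2 x = s' x"
        unfolding s2_def h[symmetric] using v I' dw by auto
      have wi: "close_count b k H V (Suc i) c \<longleftrightarrow> \<not> 801\<^sup>2 * 4 ^ k * (int b * (int (b ^ k) * int (b ^ k)))
           < (h * int (b ^ k) - int (Suc i) * int c) * (h * int (b ^ k) - int (Suc i) * int c)"
        unfolding close_count_def h_def by (simp only: power2_eq_square[of "int (b ^ k)"] power2_eq_square[of "_ - _"] not_less mult.assoc)
      have run: "run tally s' = run (Seq (Cond (Less (Mul (Mul (Const (801\<^sup>2)) (var ''n'')) (Mul (var ''b'') (Mul (var ''l'') (var ''l''))))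
                     (Mul (Sub (Mul (var ''t'') (var ''l'')) (Mul (var ''m'') (var ''c'')))
                          (Sub (Mul (var ''t'') (var ''l'')) (Mul (var ''m'') (var ''c'')))))
               (assign ''o'' (Const 0)) Skip)
          (assign ''w'' (Div (var ''w'') (var ''b'')))) s2"
        by (simp only: tally_def s2_def run.simps)
      have "b ^ H div b ^ k div b ^ Suc i = b ^ (H - k - i) div b"
        using w[OF i] by (metis div_mult2_eq power_Suc2)
      hence w': "int (b ^ H div b ^ k div b ^ Suc i) = int (b ^ (H - k - i)) div int b" by (simp only: zdiv_int)
      have all: "(\<forall>M\<le>Suc i. close_count b k H V M c) \<longleftrightarrow> (\<forall>M\<le>i. close_count b k H V M c) \<and> close_count b k H V (Suc i) c"
        by (auto simp: le_Suc_eq)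
      have "run tally s' x = s x" if "x \<notin> {''t'', ''m'', ''w'', ''o''}" for x
        using same_exceptD[of "{''t'', ''m'', ''w'', ''o''}" s s' x] I that by (simp add: run s2(3) Inv_def)
      moreover have "run tally s' ''t'' 0 = h" "run tally s' ''m'' 0 = int (Suc i)"
        by (simp_all add: run s2(1,2))
      moreover have "run tally s' ''w'' 0 = int (b ^ (H - k - i)) div int b"
        by (simp add: run s2(3) v I'(3))
      moreover have "run tally s' ''o'' 0 = (if close_count b k H V (Suc i) c then s' ''o'' 0 else 0)"
        unfolding wi by (simp add: run s2 v)
      ultimately have "Inv (Suc i) (run tally s')"
        unfolding Inv_def w' all I'(4) h_def by (auto intro!: same_exceptI)
      hence "reach tally s' 80 (Inv (Suc i))"
        by (rule reach_loop_free[rotated 2]) (simp_all add: tally_def)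
      moreover have "bval g s'" using b by (simp add: g_def I')
      ultimately show "bval g s' \<and> reach tally s' 80 (Inv (Suc i))" by blast
    next
      fix s' assume "Inv L s'"
      thus "\<not> bval g s'" unfolding g_def Inv_def wL by simp
    qed
  qed
  thus ?thesis by (rule reach_mono) (use X in \<open>auto simp: Inv_def g_def L_def\<close>)
qed

definition scan_word :: com where
  "scan_word = Seq (assign ''c'' (Const 0))
    (While (Less (var ''c'') (var ''l'')) (Seq scan_prefixes (assign ''c'' (Add (var ''c'') (Const 1)))))"

lemma reach_scan_word:
  assumes b: "b \<ge> 2"
    and s: "s ''b'' 0 = int b" "s ''n'' 0 = 4 ^ k" "s ''l'' 0 = int (b ^ k)" "s ''h'' 0 = int (b ^ H)"
      "s ''v'' 0 = int V"
    and X: "H + 1 \<le> X" "b ^ k \<le> X"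
  shows "reach scan_word s (150 * X ^ 2) (\<lambda>s'. same_except {''c'', ''t'', ''m'', ''w'', ''o''} s s' \<and>
    s' ''o'' 0 = (if balanced b k H V then s ''o'' 0 else 0))"
proof -
  define A where "A c \<longleftrightarrow> (\<forall>M\<le>H + 1 - k. close_count b k H V M c)" for c
  define Inv where "Inv = (\<lambda>i s'. same_except {''c'', ''t'', ''m'', ''w'', ''o''} s s' \<and> s' ''c'' 0 = int i \<and>
    s' ''o'' 0 = (if \<forall>c<i. A c then s ''o'' 0 else 0))"
  define g where "g = Less (var ''c'') (var ''l'')"
  define p where "p = Seq scan_prefixes (assign ''c'' (Add (var ''c'') (Const 1)))"
  have "reach scan_word s (3 + X * (120 * X + 6 + 2 * bops g + 2)) (Inv (b ^ k))"
    unfolding scan_word_def g_def[symmetric] p_def[symmetric]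
  proof (rule reach_Seq)
    show "reach (assign ''c'' (Const 0)) s 3 (Inv 0)"
      by (rule reach_loop_free) (auto simp: Inv_def same_except_def)
    fix s1 assume s1: "Inv 0 s1"
    show "reach (While g p) s1 (X * (120 * X + 6 + 2 * bops g + 2)) (Inv (b ^ k))"
    proof (rule reach_While[where Inv = Inv, OF s1])
      show "b ^ k \<le> X" "1 \<le> X" using X by auto
      fix i s' assume i: "i < b ^ k" and I: "Inv i s'"
      have v: "s' ''b'' 0 = int b" "s' ''n'' 0 = 4 ^ k" "s' ''l'' 0 = int (b ^ k)" "s' ''h'' 0 = int (b ^ H)"
        "s' ''v'' 0 = int V" "s' ''c'' 0 = int i"
        using I s by (auto simp: Inv_def same_except_def)
      have all: "(\<forall>c<Suc i. A c) \<longleftrightarrow> (\<forall>c<i. A c) \<and> A i"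
        by (auto simp: less_Suc_eq)
      have "reach p s' (120 * X + 6) (Inv (Suc i))"
        unfolding p_def
      proof (rule reach_Seq[OF reach_scan_prefixes[where s = s' and k = k and H = H and V = V and c = i, OF b v X(1)]])
        fix s2 assume s2: "same_except {''t'', ''m'', ''w'', ''o''} s' s2 \<and>
          s2 ''o'' 0 = (if \<forall>M\<le>H + 1 - k. close_count b k H V M i then s' ''o'' 0 else 0)"
        have o: "s2 ''o'' 0 = (if \<forall>c<Suc i. A c then s ''o'' 0 else 0)"
          using s2 I unfolding all Inv_def A_def[symmetric] by auto
        have "s2 x = s x" if "x \<notin> {''c'', ''t'', ''m'', ''w'', ''o''}" for x
          using same_exceptD[of "{''c'', ''t'', ''m'', ''w'', ''o''}" s s' x]
            same_exceptD[of "{''t'', ''m'', ''w'', ''o''}" s' s2 x] I s2 that by (simp add: Inv_def)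
        moreover have "s2 ''c'' 0 = int i"
          using same_exceptD[of "{''t'', ''m'', ''w'', ''o''}" s' s2 "''c''"] s2 v by simp
        ultimately have "Inv (Suc i) (run (assign ''c'' (Add (var ''c'') (Const 1))) s2)"
          unfolding Inv_def by (intro conjI same_exceptI) (simp_all add: o)
        thus "reach (assign ''c'' (Add (var ''c'') (Const 1))) s2 6 (Inv (Suc i))"
          by (rule reach_loop_free[rotated 2]) simp_all
      qed
      moreover have "bval g s'" using i by (simp add: g_def v del: of_nat_power)
      ultimately show "bval g s' \<and> reach p s' (120 * X + 6) (Inv (Suc i))" by simp
    next
      fix s' assume I: "Inv (b ^ k) s'"
      hence "s' ''l'' 0 = int (b ^ k)" using s by (auto simp: Inv_def same_except_def)
      thus "\<not> bval g s'" using I by (simp add: g_def Inv_def)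
    qed
  qed
  thus ?thesis
  proof (rule reach_mono)
    have "1 \<le> X" using X by simp
    hence "1 * 1 \<le> X * X" "1 * X \<le> X * X" by (intro mult_le_mono; simp)+
    moreover have "3 + X * (120 * X + 6 + 2 * bops g + 2) = 120 * (X * X) + 18 * X + 3"
      by (simp add: g_def algebra_simps)
    ultimately show "3 + X * (120 * X + 6 + 2 * bops g + 2) \<le> 150 * X ^ 2"
      unfolding power2_eq_square by linarith
  qed (simp add: Inv_def A_def balanced_iff_close_count)
qed

definition test_base :: com where
  "test_base = Seq (largest_power ''e'' ''P'') (Seq (largest_power ''f'' ''Q'') (Seq window_size
    (Seq (Seq (assign ''h'' (Div (var ''f'') (var ''e''))) (assign ''v'' (Div (Mul (var ''y'') (var ''f'')) (var ''Q''))))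
    (Seq scan_word
    (Seq (assign ''v'' (Div (Mul (Add (var ''y'') (Const 1)) (var ''f'')) (var ''Q'')))
    (Seq scan_word (assign ''b'' (Add (var ''b'') (Const 1)))))))))"

definition scratch :: "vname set" where
  "scratch = {''e'', ''f'', ''l'', ''z'', ''h'', ''v'', ''c'', ''t'', ''m'', ''w'', ''o'', ''b''}"

text \<open>
  The eight parts run in sequence; \<open>P2\<close> collects what remains true from the computation of \<open>h\<close> to the final
  increment of \<open>b\<close>.
\<close>

lemma reach_test_base:
  assumes b: "b \<ge> 2"
    and s: "s ''b'' 0 = int b" "s ''k'' 0 = int k" "s ''n'' 0 = 4 ^ k" "s ''P'' 0 = 2 ^ (4 ^ k)"
      "s ''Q'' 0 = 2 ^ (4 ^ Suc k)" "s ''y'' 0 = int y"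
    and X: "4 ^ Suc k + 1 \<le> X" "b ^ k \<le> X"
  shows "reach test_base s (500 * X ^ 2) (\<lambda>s'. same_except scratch s s' \<and> s' ''b'' 0 = int (Suc b) \<and>
     s' ''o'' 0 = (if passes k y b then s ''o'' 0 else 0))"
proof -
  let ?i = "assign ''b'' (Add (var ''b'') (Const 1))"
  let ?u = "assign ''v'' (Div (Mul (Add (var ''y'') (Const 1)) (var ''f'')) (var ''Q''))"
  let ?a = "Seq (assign ''h'' (Div (var ''f'') (var ''e''))) (assign ''v'' (Div (Mul (var ''y'') (var ''f'')) (var ''Q'')))"
  let ?p6 = "Seq scan_word ?i"
  let ?p5 = "Seq ?u ?p6"
  let ?p4 = "Seq scan_word ?p5"
  let ?p3 = "Seq ?a ?p4"
  let ?p2 = "Seq window_size ?p3"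
  let ?p1 = "Seq (largest_power ''f'' ''Q'') ?p2"
  let ?R = "\<lambda>s'. same_except scratch s s' \<and> s' ''b'' 0 = int (Suc b) \<and> s' ''o'' 0 = (if passes k y b then s ''o'' 0 else 0)"
  define e where "e = precision b (4 ^ k)"
  define f where "f = precision b (4 ^ Suc k)"
  define H where "H = block_length b k"
  define v1 where "v1 = base_digits b (4 ^ Suc k) y"
  define v2 where "v2 = base_digits b (4 ^ Suc k) (Suc y)"
  have f: "f = e + H" using precision_block[OF b, of k] by (simp only: e_def f_def H_def)
  have "f \<le> 4 ^ Suc k" unfolding f_def by (rule precision_le_self[OF b])
  hence HX: "H + 1 \<le> X" using X f by linarith
  have X1: "1 \<le> X" "4 ^ Suc k \<le> X" "4 ^ k \<le> X" using X by auto
  have kX: "k \<le> X"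
  proof -
    have "k \<le> 4 ^ k" by (rule less_imp_le[OF less_le_trans[OF less_exp power_mono]]) auto
    thus ?thesis using X1 by linarith
  qed
  have h: "int (b ^ f) div int (b ^ e) = int (b ^ H)"
    using b unfolding f power_add of_nat_mult by simp
  have v1: "int y * int (b ^ f) div 2 ^ (4 ^ Suc k) = int v1"
    by (simp only: v1_def base_digits_def f_def zdiv_int of_nat_mult of_nat_power of_nat_numeral)
  have v2: "(int y + 1) * int (b ^ f) div 2 ^ (4 ^ Suc k) = int v2"
    by (simp only: v2_def base_digits_def f_def zdiv_int of_nat_mult of_nat_power of_nat_numeral of_nat_Suc add.commute)
  have passes: "passes k y b \<longleftrightarrow> balanced b k H v1 \<and> balanced b k H v2"
    by (simp only: passes_def v1_def v2_def H_def) blast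
  define P2 where "P2 = (\<lambda>o2 s'. s' ''b'' 0 = int b \<and> s' ''n'' 0 = 4 ^ k \<and> s' ''l'' 0 = int (b ^ k) \<and>
    s' ''h'' 0 = int (b ^ H) \<and> s' ''y'' 0 = int y \<and> s' ''f'' 0 = int (b ^ f) \<and> s' ''Q'' 0 = 2 ^ (4 ^ Suc k) \<and>
    same_except scratch s s' \<and> s' ''o'' 0 = (o2 :: int))"
  have "reach test_base s (30 * X + (30 * X + (40 * X + (24 + (150 * X ^ 2 + (14 + (150 * X ^ 2 + 6)))))))
     (\<lambda>s'. same_except scratch s s' \<and> s' ''b'' 0 = int (Suc b) \<and>
     s' ''o'' 0 = (if passes k y b then s ''o'' 0 else 0))"
    unfolding test_base_def
  proof (rule reach_Seq)
    show "reach (largest_power ''e'' ''P'') s (30 * X) (\<lambda>s'. same_except {''e''} s s' \<and> s' ''e'' 0 = int (b ^ e))"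
      unfolding e_def using reach_largest_power[where s = s and q = "''P''" and r = "''e''" and X = X, OF b s(1) s(4)] X1 by simp
    fix s1 assume s1: "same_except {''e''} s s1 \<and> s1 ''e'' 0 = int (b ^ e)"
    have s1': "s1 ''b'' 0 = int b" "s1 ''Q'' 0 = 2 ^ (4 ^ Suc k)" using s1 s by (simp_all add: same_except_def del: power_Suc)
    show "reach (?p1) s1 (30 * X + (40 * X + (24 + (150 * X ^ 2 + (14 + (150 * X ^ 2 + 6)))))) ?R"
    proof (rule reach_Seq)
      show "reach (largest_power ''f'' ''Q'') s1 (30 * X) (\<lambda>s'. same_except {''f''} s1 s' \<and> s' ''f'' 0 = int (b ^ f))"
        unfolding f_def using reach_largest_power[where s = s1 and q = "''Q''" and r = "''f''" and X = X, OF b s1'] X1 by simp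
      fix s2 assume s2: "same_except {''f''} s1 s2 \<and> s2 ''f'' 0 = int (b ^ f)"
      have s2': "s2 ''b'' 0 = int b" "s2 ''k'' 0 = int k" using s1 s2 s by (simp_all add: same_except_def)
      show "reach (?p2) s2 (40 * X + (24 + (150 * X ^ 2 + (14 + (150 * X ^ 2 + 6))))) ?R"
      proof (rule reach_Seq[OF reach_window_size[where s = s2, OF s2' kX X1(1)]])
        fix s3 assume s3: "same_except {''l'', ''z''} s2 s3 \<and> s3 ''l'' 0 = int (b ^ k)"
        have r: "s3 ''e'' 0 = int (b ^ e)" "s3 ''f'' 0 = int (b ^ f)" "s3 ''l'' 0 = int (b ^ k)" "s3 ''b'' 0 = int b"
          "s3 ''y'' 0 = int y" "s3 ''n'' 0 = 4 ^ k" "s3 ''Q'' 0 = 2 ^ (4 ^ Suc k)" "s3 ''o'' = s ''o''"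
          using s1 s2 s3 s by (simp_all add: same_except_def del: power_Suc of_nat_power)
        have fr: "s3 x = s x" if "x \<notin> scratch" for x
          using s1 s2 s3 that by (simp add: same_except_def scratch_def)
        show "reach (?p3) s3 (24 + (150 * X ^ 2 + (14 + (150 * X ^ 2 + 6)))) ?R"
        proof (rule reach_Seq)
          have "P2 (s ''o'' 0) (run ?a s3)
             \<and> run ?a s3 ''v'' 0 = int v1"
            unfolding P2_def
            by (intro conjI same_exceptI)
              (auto simp: r s h v1 fr scratch_def simp del: power_Suc of_nat_power)
          thus "reach ?a s3 24
            (\<lambda>s'. P2 (s ''o'' 0) s' \<and> s' ''v'' 0 = int v1)"
            by (rule reach_loop_free[rotated 2]) simp_all
          fix s4 assume "P2 (s ''o'' 0) s4 \<and> s4 ''v'' 0 = int v1"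
          hence s4: "P2 (s ''o'' 0) s4" and v4: "s4 ''v'' 0 = int v1" by auto
          have r4: "s4 ''b'' 0 = int b" "s4 ''n'' 0 = 4 ^ k" "s4 ''l'' 0 = int (b ^ k)" "s4 ''h'' 0 = int (b ^ H)"
            using s4 unfolding P2_def by blast+
          show "reach (?p4) s4 (150 * X ^ 2 + (14 + (150 * X ^ 2 + 6))) ?R"
          proof (rule reach_Seq[OF reach_scan_word[where s = s4 and k = k and H = H and V = v1, OF b r4 v4 HX X(2)]])
            fix s5 assume s5: "same_except {''c'', ''t'', ''m'', ''w'', ''o''} s4 s5 \<and>
              s5 ''o'' 0 = (if balanced b k H v1 then s4 ''o'' 0 else 0)"
            define o5 where "o5 = (if balanced b k H v1 then s ''o'' 0 else 0)"
            have P5: "P2 o5 s5"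
            proof -
              have eq: "s5 x = s4 x" if "x \<notin> {''c'', ''t'', ''m'', ''w'', ''o''}" for x
                using s5 that by (blast dest: same_exceptD)
              have "same_except scratch s s4" using s4 by (simp only: P2_def)
              hence "same_except scratch s s5"
                by (rule same_except_trans[OF _ conjunct1[OF s5]]) (auto simp: scratch_def)
              moreover have "s5 ''o'' 0 = o5" using s5 s4 by (simp only: P2_def o5_def)
              moreover have "s5 ''b'' = s4 ''b''" "s5 ''n'' = s4 ''n''" "s5 ''l'' = s4 ''l''" "s5 ''h'' = s4 ''h''"
                "s5 ''y'' = s4 ''y''" "s5 ''f'' = s4 ''f''" "s5 ''Q'' = s4 ''Q''"
                by (rule eq; simp)+
              ultimately show ?thesis using s4 by (simp only: P2_def)
            qed
            show "reach (?p5) s5 (14 + (150 * X ^ 2 + 6)) ?R"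
            proof (rule reach_Seq)
              have r5: "s5 ''y'' 0 = int y" "s5 ''f'' 0 = int (b ^ f)" "s5 ''Q'' 0 = 2 ^ (4 ^ Suc k)"
                using P5 unfolding P2_def by blast+
              have "run ?u s5 ''v'' 0 = int v2"
                by (simp add: r5 v2 del: power_Suc of_nat_power)
              moreover have "P2 o5 (run ?u s5)"
              proof -
                have eq: "run ?u s5 x = s5 x" if "x \<noteq> ''v''" for x
                  using that by simp
                have "same_except scratch s s5" using P5 by (simp only: P2_def)
                moreover have "same_except {''v''} s5 (run ?u s5)" using eq by (intro same_exceptI) blast
                ultimately have "same_except scratch s (run ?u s5)"
                  by (rule same_except_trans) (auto simp: scratch_def)
                moreover have "run ?u s5 ''b'' = s5 ''b''" "run ?u s5 ''n'' = s5 ''n''" "run ?u s5 ''l'' = s5 ''l''" "run ?u s5 ''h'' = s5 ''h''"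
                  "run ?u s5 ''y'' = s5 ''y''" "run ?u s5 ''f'' = s5 ''f''" "run ?u s5 ''Q'' = s5 ''Q''" "run ?u s5 ''o'' = s5 ''o''"
                  by (rule eq; simp)+
                ultimately show ?thesis using P5 by (simp only: P2_def)
              qed
              ultimately show "reach ?u s5 14
                 (\<lambda>s'. P2 o5 s' \<and> s' ''v'' 0 = int v2)"
                by (intro reach_loop_free conjI) simp_all
              fix s6 assume "P2 o5 s6 \<and> s6 ''v'' 0 = int v2"
              hence s6: "P2 o5 s6" and v6: "s6 ''v'' 0 = int v2" by auto
              have r6: "s6 ''b'' 0 = int b" "s6 ''n'' 0 = 4 ^ k" "s6 ''l'' 0 = int (b ^ k)" "s6 ''h'' 0 = int (b ^ H)"
                using s6 unfolding P2_def by blast+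
              show "reach (?p6) s6 (150 * X ^ 2 + 6) ?R"
              proof (rule reach_Seq[OF reach_scan_word[where s = s6 and k = k and H = H and V = v2, OF b r6 v6 HX X(2)]])
                fix s7 assume s7: "same_except {''c'', ''t'', ''m'', ''w'', ''o''} s6 s7 \<and>
                  s7 ''o'' 0 = (if balanced b k H v2 then s6 ''o'' 0 else 0)"
                have o7: "s7 ''o'' 0 = (if passes k y b then s ''o'' 0 else 0)"
                  using s7 s6 by (simp add: P2_def o5_def passes)
                have b7: "s7 ''b'' 0 = int b" using s7 s6 by (simp add: P2_def same_except_def)
                have f7: "s7 x = s x" if "x \<notin> scratch" for x
                  using s7 s6 that by (simp add: P2_def same_except_def scratch_def)
                have "same_except scratch s (run ?i s7)"
                  using f7 by (intro same_exceptI) (auto simp: scratch_def)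
                thus "reach ?i s7 6
                   (\<lambda>s'. same_except scratch s s' \<and> s' ''b'' 0 = int (Suc b) \<and> s' ''o'' 0 = (if passes k y b then s ''o'' 0 else 0))"
                  by (intro reach_loop_free conjI) (simp_all add: b7 o7)
              qed
            qed
          qed
        qed
      qed
    qed
  qed
  thus ?thesis
  proof (rule reach_mono)
    have "1 * 1 \<le> X * X" "1 * X \<le> X * X" using X1 by (intro mult_le_mono; simp)+
    thus "30 * X + (30 * X + (40 * X + (24 + (150 * X ^ 2 + (14 + (150 * X ^ 2 + 6)))))) \<le> 500 * X ^ 2"
      unfolding power2_eq_square by linarith
  qed simp
qed

definition test_all :: com where
  "test_all = Seq (Seq (assign ''o'' (Const 1)) (assign ''b'' (Const 2)))
    (While (Neg (Less (var ''k'') (var ''b''))) test_base)"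

text \<open>
  The number of grid points of a base under test is at most exponential in the number of bits.
\<close>

lemma power_le_tower:
  assumes "b \<le> k"
  shows "b ^ k \<le> 2 ^ (4 ^ k)"
proof -
  have "b ^ k \<le> (2 ^ k) ^ k" using assms less_exp[of k] by (intro power_mono) linarith+
  also have "\<dots> = 2 ^ (k * k)" by (simp add: power_mult)
  also have "\<dots> \<le> 2 ^ (2 ^ k * 2 ^ k)"
    by (intro power_increasing mult_le_mono less_imp_le[OF less_exp]) auto
  also have "(2::nat) ^ k * 2 ^ k = 4 ^ k" by (simp flip: power_mult_distrib)
  finally show ?thesis .
qed

lemma reach_test_all:
  assumes k: "k \<ge> 1"
    and s: "s ''k'' 0 = int k" "s ''n'' 0 = 4 ^ k" "s ''P'' 0 = 2 ^ (4 ^ k)"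
      "s ''Q'' 0 = 2 ^ (4 ^ Suc k)" "s ''y'' 0 = int y"
    and X: "2 ^ (4 ^ Suc k) \<le> X"
  shows "reach test_all s (540 * X ^ 3) (\<lambda>s'. same_except scratch s s' \<and> s' ''o'' 0 = (if good k y then 1 else 0))"
proof -
  define Inv where "Inv = (\<lambda>i s'. same_except scratch s s' \<and> s' ''b'' 0 = int (2 + i) \<and>
    s' ''o'' 0 = (if \<forall>b\<in>{2..<2 + i}. passes k y b then 1 else 0))"
  define g where "g = Neg (Less (var ''k'') (var ''b''))"
  have X1: "4 ^ Suc k + 1 \<le> X" using Suc_leI[OF less_exp[of "4 ^ Suc k"]] X by linarith
  have X2: "2 ^ (4 ^ k) \<le> X"
  proof -
    have "(2::nat) ^ (4 ^ k) \<le> 2 ^ (4 ^ Suc k)" by (intro power_increasing) auto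
    thus ?thesis using X by linarith
  qed
  have X3: "1 \<le> X" "k \<le> X"
  proof -
    have "k < 4 ^ k" by (rule less_le_trans[OF less_exp power_mono]) auto
    thus "1 \<le> X" "k \<le> X" using X1 by simp_all
  qed
  have "reach test_all s (6 + X * (500 * X ^ 2 + 2 * bops g + 2)) (Inv (k - 1))"
    unfolding test_all_def g_def[symmetric]
  proof (rule reach_Seq)
    show "reach (Seq (assign ''o'' (Const 1)) (assign ''b'' (Const 2))) s 6 (Inv 0)"
      by (rule reach_loop_free) (auto simp: Inv_def same_except_def scratch_def)
    fix s1 assume s1: "Inv 0 s1"
    show "reach (While g test_base) s1 (X * (500 * X ^ 2 + 2 * bops g + 2)) (Inv (k - 1))"
    proof (rule reach_While[where Inv = Inv, OF s1])
      show "k - 1 \<le> X" "1 \<le> X" using X3 by auto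
      fix i s' assume i: "i < k - 1" and I: "Inv i s'"
      have v: "s' ''k'' 0 = int k" "s' ''n'' 0 = 4 ^ k" "s' ''P'' 0 = 2 ^ (4 ^ k)"
        "s' ''Q'' 0 = 2 ^ (4 ^ Suc k)" "s' ''y'' 0 = int y"
        using I s by (simp_all add: Inv_def same_except_def scratch_def del: power_Suc)
      have vb: "s' ''b'' 0 = int (2 + i)" using I by (simp add: Inv_def)
      have "(2 + i) ^ k \<le> 2 ^ (4 ^ k)" using i by (intro power_le_tower) simp
      hence bk: "(2 + i) ^ k \<le> X" using X2 by linarith
      have all: "(\<forall>b\<in>{2..<2 + Suc i}. passes k y b) \<longleftrightarrow> (\<forall>b\<in>{2..<2 + i}. passes k y b) \<and> passes k y (2 + i)"
        by (auto simp: less_Suc_eq)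
      have "reach test_base s' (500 * X ^ 2) (\<lambda>s''. same_except scratch s' s'' \<and> s'' ''b'' 0 = int (Suc (2 + i)) \<and>
         s'' ''o'' 0 = (if passes k y (2 + i) then s' ''o'' 0 else 0))"
        by (rule reach_test_base[where s = s', OF _ vb v X1 bk]) simp
      hence "reach test_base s' (500 * X ^ 2) (Inv (Suc i))"
      proof (rule reach_mono)
        fix s'' assume s'': "same_except scratch s' s'' \<and> s'' ''b'' 0 = int (Suc (2 + i)) \<and>
         s'' ''o'' 0 = (if passes k y (2 + i) then s' ''o'' 0 else 0)"
        have "same_except scratch s s''"
          using s'' I same_except_trans[of scratch s s' scratch s'' scratch] by (simp add: Inv_def)
        moreover have "s'' ''o'' 0 = (if \<forall>b\<in>{2..<2 + Suc i}. passes k y b then 1 else 0)"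
          unfolding all using s'' I unfolding Inv_def by auto
        ultimately show "Inv (Suc i) s''" using s'' by (simp add: Inv_def)
      qed simp
      moreover have "bval g s'" using i by (simp add: g_def v vb)
      ultimately show "bval g s' \<and> reach test_base s' (500 * X ^ 2) (Inv (Suc i))" by blast
    next
      fix s' assume I: "Inv (k - 1) s'"
      hence "s' ''k'' 0 = int k" using s by (simp add: Inv_def same_except_def scratch_def)
      thus "\<not> bval g s'" using I k by (simp add: g_def Inv_def)
    qed
  qed
  thus ?thesis
  proof (rule reach_mono)
    have "1 * 1 \<le> X * (X * X)" "X * 1 \<le> X * (X * X)" using X3 by (intro mult_le_mono; simp)+
    moreover have "6 + X * (500 * X ^ 2 + 2 * bops g + 2) = 500 * (X * (X * X)) + X * 14 + 6"
      by (simp add: g_def algebra_simps power2_eq_square)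
    ultimately show "6 + X * (500 * X ^ 2 + 2 * bops g + 2) \<le> 540 * X ^ 3"
      unfolding power3_eq_cube mult.assoc by linarith
    fix s' assume "Inv (k - 1) s'"
    moreover have "{2..<2 + (k - 1)} = {2..k}" using k by auto
    ultimately show "same_except scratch s s' \<and> s' ''o'' 0 = (if good k y then 1 else 0)"
      by (simp only: Inv_def good_def)
  qed
qed

definition search :: com where
  "search = Seq test_all (While (Equal (var ''o'') (Const 0)) (Seq (assign ''y'' (Add (var ''y'') (Const 1))) test_all))"

lemma reach_search:
  assumes k: "k \<ge> 1"
    and s: "s ''k'' 0 = int k" "s ''n'' 0 = 4 ^ k" "s ''P'' 0 = 2 ^ (4 ^ k)"
      "s ''Q'' 0 = 2 ^ (4 ^ Suc k)" "s ''y'' 0 = int y"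
    and X: "2 ^ (4 ^ Suc k) \<le> X"
    and y': "y \<le> y'" "good k y'" "\<And>z. y \<le> z \<Longrightarrow> z < y' \<Longrightarrow> \<not> good k z" "y' - y \<le> X"
  shows "reach search s (1100 * X ^ 4) (\<lambda>s'. same_except (insert ''y'' scratch) s s' \<and> s' ''y'' 0 = int y')"
proof -
  define Inv where "Inv = (\<lambda>i s'. same_except (insert ''y'' scratch) s s' \<and> s' ''y'' 0 = int (y + i) \<and>
    s' ''o'' 0 = (if good k (y + i) then 1 else 0))"
  define g where "g = Equal (var ''o'') (Const 0)"
  define p where "p = Seq (assign ''y'' (Add (var ''y'') (Const 1))) test_all"
  have X1: "1 \<le> X" using X by (metis le_trans one_le_numeral one_le_power)
  have "reach search s (540 * X ^ 3 + X * (6 + 540 * X ^ 3 + 2 * bops g + 2)) (Inv (y' - y))"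
    unfolding search_def g_def[symmetric] p_def[symmetric]
  proof (rule reach_Seq[OF reach_test_all[where s = s, OF k s X]])
    fix s1 assume s1: "same_except scratch s s1 \<and> s1 ''o'' 0 = (if good k y then 1 else 0)"
    have "Inv 0 s1" using s1 s unfolding Inv_def
      by (intro conjI same_exceptI) (simp_all add: same_except_def scratch_def)
    thus "reach (While g p) s1 (X * (6 + 540 * X ^ 3 + 2 * bops g + 2)) (Inv (y' - y))"
    proof (rule reach_While[where Inv = Inv])
      show "y' - y \<le> X" "1 \<le> X" by (rule y' X1)+
      fix i s' assume i: "i < y' - y" and I: "Inv i s'"
      have "reach p s' (6 + 540 * X ^ 3) (Inv (Suc i))"
        unfolding p_def
      proof (rule reach_Seq)
        have f1: "s' x = s x" if "x \<notin> insert ''y'' scratch" for x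
          using I that by (simp add: Inv_def same_except_def)
        show "reach (assign ''y'' (Add (var ''y'') (Const 1))) s' 6
          (\<lambda>s2. same_except (insert ''y'' scratch) s s2 \<and> s2 ''y'' 0 = int (y + Suc i))"
        proof (rule reach_loop_free)
          show "same_except (insert ''y'' scratch) s (run (assign ''y'' (Add (var ''y'') (Const 1))) s') \<and>
              run (assign ''y'' (Add (var ''y'') (Const 1))) s' ''y'' 0 = int (y + Suc i)"
            using I by (intro conjI same_exceptI) (auto simp: f1 Inv_def)
        qed simp_all
        fix s2 assume s2: "same_except (insert ''y'' scratch) s s2 \<and> s2 ''y'' 0 = int (y + Suc i)"
        have v: "s2 ''k'' 0 = int k" "s2 ''n'' 0 = 4 ^ k" "s2 ''P'' 0 = 2 ^ (4 ^ k)"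
          "s2 ''Q'' 0 = 2 ^ (4 ^ Suc k)"
          using s2 s by (simp_all add: same_except_def scratch_def del: power_Suc)
        have vy: "s2 ''y'' 0 = int (y + Suc i)" using s2 by blast
        show "reach test_all s2 (540 * X ^ 3) (Inv (Suc i))"
        proof (rule reach_mono[OF reach_test_all[where s = s2, OF k v vy X]])
          fix s3 assume s3: "same_except scratch s2 s3 \<and> s3 ''o'' 0 = (if good k (y + Suc i) then 1 else 0)"
          have "s3 ''y'' = s2 ''y''" using s3 by (simp add: same_except_def scratch_def)
          moreover have "same_except (insert ''y'' scratch) s s3"
            using s2 s3 by (simp add: same_except_def)
          ultimately show "Inv (Suc i) s3" using s3 vy by (simp only: Inv_def)
        qed simp
      qed
      moreover have "bval g s'" using I y'(3)[of "y + i"] i by (simp add: g_def Inv_def)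
      ultimately show "bval g s' \<and> reach p s' (6 + 540 * X ^ 3) (Inv (Suc i))" by blast
    next
      fix s' assume "Inv (y' - y) s'"
      thus "\<not> bval g s'" using y'(1,2) by (simp add: g_def Inv_def)
    qed
  qed
  thus ?thesis
  proof (rule reach_mono)
    have c: "X ^ 3 \<le> X ^ 4" "X ^ 1 \<le> X ^ 4" "X ^ 0 \<le> X ^ 4" using X1 by (intro power_increasing; simp)+
    have "X * (6 + 540 * X ^ 3 + 2 * bops g + 2) = 540 * X ^ 4 + 16 * X ^ 1"
      by (simp add: g_def algebra_simps power4_eq_xxxx power3_eq_cube)
    thus "540 * X ^ 3 + X * (6 + 540 * X ^ 3 + 2 * bops g + 2) \<le> 1100 * X ^ 4"
      using c by linarith
    fix s' assume "Inv (y' - y) s'"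
    thus "same_except (insert ''y'' scratch) s s' \<and> s' ''y'' 0 = int y'" using y'(1) by (simp add: Inv_def)
  qed
qed

section \<open>A stage of the construction and the whole program\<close>

definition stage :: com where
  "stage = Seq (Seq (assign ''y'' (Mul (Mul (var ''y'') (var ''P'')) (Mul (var ''P'') (var ''P''))))
                    (assign ''Q'' (Mul (Mul (var ''P'') (var ''P'')) (Mul (var ''P'') (var ''P'')))))
    (Seq search
    (Seq (assign ''P'' (var ''Q'')) (Seq (assign ''n'' (Mul (var ''n'') (Const 4))) (assign ''k'' (Add (var ''k'') (Const 1))))))"

definition stage_vars :: "vname set" where
  "stage_vars = scratch \<union> {''y'', ''Q'', ''P'', ''n'', ''k''}"

definition represents :: "nat \<Rightarrow> store \<Rightarrow> bool" where
  "represents i s \<longleftrightarrow> s ''k'' 0 = int (30 + i) \<and> s ''n'' 0 = int (bits i) \<and> s ''P'' 0 = 2 ^ bits i \<and>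
    s ''y'' 0 = int (approximant i)"

text \<open>
  What the search relies on: where it stops, and that it stops after no more steps than there are
  extensions.
\<close>

lemma approximant_search:
  fixes i :: nat
  defines "a \<equiv> approximant i * 2 ^ (3 * 4 ^ (30 + i))"
  shows "a \<le> approximant (Suc i)" "good (30 + i) (approximant (Suc i))"
    "\<And>z. a \<le> z \<Longrightarrow> z < approximant (Suc i) \<Longrightarrow> \<not> good (30 + i) z"
    "approximant (Suc i) - a \<le> 2 ^ (3 * 4 ^ (30 + i))"
proof -
  show "a \<le> approximant (Suc i)" "good (30 + i) (approximant (Suc i))"
    using approximant_Suc[of i] by (simp_all only: a_def)
  show "\<not> good (30 + i) z" if "a \<le> z" "z < approximant (Suc i)" for z
    using that not_less_Least[of z "\<lambda>y. a \<le> y \<and> good (30 + i) y"] by (auto simp: a_def)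
  have "Suc (approximant (Suc i)) < a + 2 ^ (3 * 4 ^ (30 + i))"
    using approximant_Suc(3)[of i] unfolding a_def mult_Suc by (simp only: add.commute)
  thus "approximant (Suc i) - a \<le> 2 ^ (3 * 4 ^ (30 + i))" by linarith
qed

lemma reach_stage:
  assumes s: "represents i s" and X: "2 ^ bits (Suc i) \<le> X"
  shows "reach stage s (1200 * X ^ 4) (\<lambda>s'. same_except stage_vars s s' \<and> represents (Suc i) s')"
proof -
  define k where "k = 30 + i"
  define a where "a = approximant i * 2 ^ (3 * 4 ^ k)"
  have bits: "bits i = 4 ^ k" "bits (Suc i) = 4 ^ Suc k" by (simp_all add: bits_def k_def)
  have k1: "k \<ge> 1" by (simp add: k_def)
  have X': "2 ^ (4 ^ Suc k) \<le> X" using X by (simp only: bits)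
  have X1: "1 \<le> X" using X by (metis le_trans one_le_numeral one_le_power)
  have v: "s ''k'' 0 = int k" "s ''n'' 0 = 4 ^ k" "s ''P'' 0 = 2 ^ (4 ^ k)" "s ''y'' 0 = int (approximant i)"
    using s unfolding represents_def by (simp_all only: k_def[symmetric] bits of_nat_power of_nat_numeral)
  have P3: "2 ^ (4 ^ k) * (2 ^ (4 ^ k) * 2 ^ (4 ^ k)) = (2::int) ^ (3 * 4 ^ k)"
    by (simp flip: power_add)
  have P4: "2 ^ (4 ^ k) * 2 ^ (4 ^ k) * (2 ^ (4 ^ k) * 2 ^ (4 ^ k)) = (2::int) ^ (4 ^ Suc k)"
    by (simp flip: power_add)
  note ap = approximant_search[of i, folded k_def, folded a_def]
  let ?init = "Seq (assign ''y'' (Mul (Mul (var ''y'') (var ''P'')) (Mul (var ''P'') (var ''P''))))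
                    (assign ''Q'' (Mul (Mul (var ''P'') (var ''P'')) (Mul (var ''P'') (var ''P''))))"
  let ?fin = "Seq (assign ''P'' (var ''Q'')) (Seq (assign ''n'' (Mul (var ''n'') (Const 4))) (assign ''k'' (Add (var ''k'') (Const 1))))"
  have "reach stage s (26 + (1100 * X ^ 4 + 20)) (\<lambda>s'. same_except stage_vars s s' \<and> represents (Suc i) s')"
    unfolding stage_def
  proof (rule reach_Seq)
    show "reach ?init s 26 (\<lambda>s'. s' = run ?init s)" by (rule reach_loop_free) simp_all
    fix s1 assume s1: "s1 = run ?init s"
    have fr1: "s1 x = s x" if "x \<noteq> ''y''" "x \<noteq> ''Q''" for x using that by (simp add: s1)
    have v1: "s1 ''k'' 0 = int k" "s1 ''n'' 0 = 4 ^ k" "s1 ''P'' 0 = 2 ^ (4 ^ k)"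
      by (simp_all add: fr1 v)
    have Q1: "s1 ''Q'' 0 = 2 ^ (4 ^ Suc k)" unfolding P4[symmetric] by (simp add: s1 v)
    have "s1 ''y'' 0 = int (approximant i) * (2 ^ (4 ^ k) * (2 ^ (4 ^ k) * 2 ^ (4 ^ k)))" by (simp add: s1 v)
    hence y1: "s1 ''y'' 0 = int a" unfolding P3 by (simp only: a_def of_nat_mult of_nat_power of_nat_numeral)
    have aX: "approximant (Suc i) - a \<le> X"
    proof -
      have "(2::nat) ^ (3 * 4 ^ k) \<le> 2 ^ (4 ^ Suc k)" by (intro power_increasing) auto
      thus ?thesis using ap(4) X' by linarith
    qed
    show "reach (Seq search ?fin) s1 (1100 * X ^ 4 + 20) (\<lambda>s'. same_except stage_vars s s' \<and> represents (Suc i) s')"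
    proof (rule reach_Seq[OF reach_search[where s = s1, OF k1 v1 Q1 y1 X' ap(1-3) aX]])
      fix s2 assume s2: "same_except (insert ''y'' scratch) s1 s2 \<and> s2 ''y'' 0 = int (approximant (Suc i))"
      have fr2: "s2 x = s1 x" if "x \<notin> insert ''y'' scratch" for x using s2 that by (blast dest: same_exceptD)
      have e: "s2 ''k'' = s1 ''k''" "s2 ''n'' = s1 ''n''" "s2 ''Q'' = s1 ''Q''"
        by (rule fr2; simp add: scratch_def)+
      define s3 where "s3 = run ?fin s2"
      have "s3 x = s x" if "x \<notin> stage_vars" for x
      proof -
        have "s3 x = s2 x" using that by (simp add: s3_def stage_vars_def)
        also have "\<dots> = s1 x" using that by (intro fr2) (simp add: stage_vars_def)
        also have "\<dots> = s x" using that by (intro fr1) (auto simp: stage_vars_def)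
        finally show ?thesis .
      qed
      moreover have "represents (Suc i) s3"
        unfolding represents_def
      proof (intro conjI)
        show "s3 ''k'' 0 = int (30 + Suc i)" by (simp add: s3_def e v1) (simp add: k_def)
        show "s3 ''n'' 0 = int (bits (Suc i))" unfolding bits by (simp add: s3_def e v1)
        show "s3 ''P'' 0 = 2 ^ bits (Suc i)" unfolding bits Q1[symmetric] by (simp add: s3_def e)
        show "s3 ''y'' 0 = int (approximant (Suc i))" using s2 by (simp add: s3_def)
      qed
      ultimately have "same_except stage_vars s s3 \<and> represents (Suc i) s3" by (blast intro: same_exceptI)
      thus "reach ?fin s2 20 (\<lambda>s'. same_except stage_vars s s' \<and> represents (Suc i) s')"
        unfolding s3_def by (rule reach_loop_free[rotated 2]) simp_all
    qed
  qed
  moreover have "26 + (1100 * X ^ 4 + 20) \<le> 1200 * X ^ 4"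
  proof -
    have "1 \<le> X ^ 4" using X1 by (rule one_le_power)
    thus ?thesis by linarith
  qed
  ultimately show ?thesis by (rule reach_mono)
qed

text \<open>
  The constants start the program at scale 30; the candidate, initially 0, stands for the first \<open>4 ^ 30\<close> bits. In the last loop \<open>c\<close> is the index of
  the digit and \<open>P\<close> runs through \<open>2 ^ (n - 1), 2 ^ (n - 2), ...\<close>.
\<close>

definition normal_digits :: com where
  "normal_digits = Seq (Seq (assign ''k'' (Const 30)) (Seq (assign ''n'' (Const (int (bits 0)))) (assign ''P'' (Const (2 ^ bits 0)))))
    (Seq (While (Less (var ''n'') (var ''N'')) stage)
    (Seq (assign ''c'' (Const 0))
    (While (Less (var ''c'') (var ''N''))
      (Seq (assign ''P'' (Div (var ''P'') (Const 2)))
      (Seq (Assign ''d'' (var ''c'') (Mod (Div (var ''y'') (var ''P'')) (Const 2)))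
           (assign ''c'' (Add (var ''c'') (Const 1))))))))"

text \<open>
  Here it matters that the number lies strictly below the right end \<open>upper i\<close> of its interval: at the end point itself the
  bits would differ from those of the approximant.
\<close>

lemma digit_normal_number:
  assumes j: "j < bits i"
  shows "digit 2 normal_number j = int (approximant i) div 2 ^ (bits i - Suc j) mod 2"
proof -
  define n where "n = bits i"
  have fl: "\<lfloor>2 ^ n * normal_number\<rfloor> = int (approximant i)"
  proof (rule floor_unique)
    show "of_int (int (approximant i)) \<le> 2 ^ n * normal_number"
      using lower_le_normal_number[of i] by (simp add: lower_def n_def divide_le_eq mult.commute)
    show "2 ^ n * normal_number < of_int (int (approximant i)) + 1"
      using normal_number_less_upper[of i] by (simp add: upper_def n_def less_divide_eq mult.commute add.commute)
  qed
  have "2 ^ n * normal_number / 2 ^ (n - Suc j) = 2 ^ Suc j * normal_number"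
  proof -
    have "n = Suc j + (n - Suc j)" using j by (simp add: n_def)
    hence "(2::real) ^ n = 2 ^ Suc j * 2 ^ (n - Suc j)" by (metis power_add)
    thus ?thesis by simp
  qed
  hence "\<lfloor>2 ^ Suc j * normal_number\<rfloor> = \<lfloor>2 ^ n * normal_number\<rfloor> div 2 ^ (n - Suc j)"
    using floor_divide_real_eq_div[of "2 ^ (n - Suc j)" "2 ^ n * normal_number"] by simp
  thus ?thesis unfolding digit_def fl by (simp add: n_def)
qed

lemma le_bits: "i \<le> bits i"
proof -
  have "i < 4 ^ i" by (rule less_le_trans[OF less_exp power_mono]) auto
  also have "\<dots> \<le> bits i" unfolding bits_def by (intro power_increasing) auto
  finally show ?thesis by simp
qed

text \<open>
  The loop stops after the first stage with \<open>N \<le> bits m\<close>. Each stage that is executed starts with fewer than \<open>N\<close> bits,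
  so that \<open>X = 2 ^ (4 N)\<close> bounds every iteration count, and the total is at most \<open>2048 X ^ 5 = 2 ^ (20 N + 11)\<close>.
\<close>

lemma reach_normal_digits:
  "reach normal_digits (input_store N) (2 ^ (20 * N + 11)) (\<lambda>s. \<forall>k<N. s ''d'' (int k) = digit 2 normal_number k)"
proof -
  define X where "X = (2::nat) ^ (4 * N)"
  define m where "m = (LEAST i. N \<le> bits i)"
  define Inv where "Inv = (\<lambda>i s. same_except stage_vars (input_store N) s \<and> represents i s)"
  let ?init = "Seq (assign ''k'' (Const 30)) (Seq (assign ''n'' (Const (int (bits 0)))) (assign ''P'' (Const (2 ^ bits 0))))"
  let ?g = "Less (var ''n'') (var ''N'')"
  let ?h = "Less (var ''c'') (var ''N'')"
  let ?out = "Seq (assign ''P'' (Div (var ''P'') (Const 2)))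
      (Seq (Assign ''d'' (var ''c'') (Mod (Div (var ''y'') (var ''P'')) (Const 2)))
           (assign ''c'' (Add (var ''c'') (Const 1))))"
  let ?R = "\<lambda>s. \<forall>k<N. s ''d'' (int k) = digit 2 normal_number k"
  have X1: "1 \<le> X" by (simp add: X_def)
  have NX: "N \<le> X"
  proof -
    have "N < 2 ^ N" by (rule less_exp)
    also have "(2::nat) ^ N \<le> X" unfolding X_def by (intro power_increasing) auto
    finally show ?thesis by simp
  qed
  have m: "N \<le> bits m" unfolding m_def by (rule LeastI[of _ N]) (rule le_bits)
  have mN: "m \<le> N" unfolding m_def by (rule Least_le) (rule le_bits)
  have less_m: "bits i < N" if "i < m" for i
    using not_less_Least[of i "\<lambda>i. N \<le> bits i"] that by (simp add: m_def)
  have init0: "input_store N ''y'' 0 = 0" "input_store N ''N'' 0 = int N" by (simp_all add: input_store_def)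
  have vars: "x \<notin> stage_vars" if "x = ''N'' \<or> x = ''d''" for x
    using that by (auto simp: stage_vars_def scratch_def)
  have "reach normal_digits (input_store N)
    (9 + (X * (1200 * X ^ 4 + 2 * bops ?g + 2) + (3 + X * (30 + 2 * bops ?h + 2)))) ?R"
    unfolding normal_digits_def
  proof (rule reach_Seq)
    have "Inv 0 (run ?init (input_store N))"
      unfolding Inv_def represents_def
      by (intro conjI same_exceptI) (auto simp: init0 stage_vars_def)
    thus "reach ?init (input_store N) 9 (Inv 0)" by (rule reach_loop_free[rotated 2]) simp_all
    fix s1 assume s1: "Inv 0 s1"
    show "reach (Seq (While ?g stage) (Seq (assign ''c'' (Const 0)) (While ?h ?out))) s1
      (X * (1200 * X ^ 4 + 2 * bops ?g + 2) + (3 + X * (30 + 2 * bops ?h + 2))) ?R"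
    proof (rule reach_Seq)
      show "reach (While ?g stage) s1 (X * (1200 * X ^ 4 + 2 * bops ?g + 2)) (Inv m)"
      proof (rule reach_While[where Inv = Inv, OF s1])
        show "m \<le> X" "1 \<le> X" using mN NX X1 by auto
        fix i s assume i: "i < m" and I: "Inv i s"
        have "s ''N'' = input_store N ''N''" using I vars unfolding Inv_def by (blast dest: same_exceptD)
        hence "bval ?g s" using I less_m[OF i] unfolding Inv_def represents_def by (simp add: init0)
        moreover have "bits (Suc i) \<le> 4 * N" using less_m[OF i] unfolding bits_def add_Suc_right power_Suc by simp
        hence "2 ^ bits (Suc i) \<le> X" unfolding X_def by (intro power_increasing) auto
        with I have "reach stage s (1200 * X ^ 4) (\<lambda>s'. same_except stage_vars s s' \<and> represents (Suc i) s')"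
          unfolding Inv_def by (intro reach_stage) auto
        hence "reach stage s (1200 * X ^ 4) (Inv (Suc i))"
          by (rule reach_mono) (use I in \<open>auto simp: Inv_def intro: same_except_trans\<close>)
        ultimately show "bval ?g s \<and> reach stage s (1200 * X ^ 4) (Inv (Suc i))" by blast
      next
        fix s assume I: "Inv m s"
        have "s ''N'' = input_store N ''N''" using I vars unfolding Inv_def by (blast dest: same_exceptD)
        thus "\<not> bval ?g s" using I m unfolding Inv_def represents_def by (simp add: init0)
      qed
      fix s2 assume s2: "Inv m s2"
      have y2: "s2 ''y'' 0 = int (approximant m)" and P2: "s2 ''P'' 0 = 2 ^ bits m"
        using s2 by (simp_all add: Inv_def represents_def)
      have N2: "s2 ''N'' 0 = int N"
        using s2 vars init0 unfolding Inv_def by (metis same_exceptD)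
      define Out where "Out = (\<lambda>j s. s ''c'' 0 = int j \<and> s ''N'' 0 = int N \<and> s ''y'' 0 = int (approximant m) \<and>
        s ''P'' 0 = 2 ^ (bits m - j) \<and> (\<forall>k<j. s ''d'' (int k) = digit 2 normal_number k))"
      have "reach (Seq (assign ''c'' (Const 0)) (While ?h ?out)) s2 (3 + X * (30 + 2 * bops ?h + 2)) (Out N)"
      proof (rule reach_Seq)
        show "reach (assign ''c'' (Const 0)) s2 3 (Out 0)"
          by (rule reach_loop_free) (simp_all add: Out_def y2 P2 N2)
        fix s3 assume s3: "Out 0 s3"
        show "reach (While ?h ?out) s3 (X * (30 + 2 * bops ?h + 2)) (Out N)"
        proof (rule reach_While[where Inv = Out, OF s3 _ _ NX X1])
          fix j s assume j: "j < N" and O: "Out j s"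
          have jm: "j < bits m" using j m by simp
          have v: "s ''c'' 0 = int j" "s ''N'' 0 = int N" "s ''y'' 0 = int (approximant m)"
            "s ''P'' 0 = 2 ^ (bits m - j)" "\<And>k. k < j \<Longrightarrow> s ''d'' (int k) = digit 2 normal_number k"
            using O unfolding Out_def by blast+
          have "bits m - j = Suc (bits m - Suc j)" using jm by simp
          hence half: "2 ^ (bits m - j) div 2 = (2::int) ^ (bits m - Suc j)" by simp
          have "Out (Suc j) (run ?out s)"
            unfolding Out_def
          proof (intro conjI allI impI)
            fix k assume "k < Suc j"
            thus "run ?out s ''d'' (int k) = digit 2 normal_number k"
              using v(5)[of k] by (cases "k = j") (simp_all add: v(1-4) half digit_normal_number[OF jm])
          qed (simp_all add: v(1-4) half)
          hence "reach ?out s 30 (Out (Suc j))" by (rule reach_loop_free[rotated 2]) simp_all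
          thus "bval ?h s \<and> reach ?out s 30 (Out (Suc j))" using j by (simp add: v(1,2))
        next
          fix s assume "Out N s"
          thus "\<not> bval ?h s" by (simp add: Out_def)
        qed
      qed
      thus "reach (Seq (assign ''c'' (Const 0)) (While ?h ?out)) s2 (3 + X * (30 + 2 * bops ?h + 2)) ?R"
        by (rule reach_mono) (simp_all add: Out_def)
    qed
  qed
  moreover have "9 + (X * (1200 * X ^ 4 + 2 * bops ?g + 2) + (3 + X * (30 + 2 * bops ?h + 2))) \<le> 2 ^ (20 * N + 11)"
  proof -
    have c: "X \<le> X ^ 5" "1 \<le> X ^ 5" using X1 by (auto intro: self_le_power)
    have e: "X * (1200 * X ^ 4 + 2 * bops ?g + 2) = 1200 * X ^ 5 + 12 * X"
      "X * (30 + 2 * bops ?h + 2) = 42 * X"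
      by (simp_all add: algebra_simps flip: power_Suc)
    have "9 + (X * (1200 * X ^ 4 + 2 * bops ?g + 2) + (3 + X * (30 + 2 * bops ?h + 2))) \<le> 2048 * X ^ 5"
      unfolding e using c by linarith
    also have "\<dots> = 2 ^ (20 * N + 11)" by (simp add: X_def power_add flip: power_mult)
    finally show ?thesis .
  qed
  ultimately show ?thesis by (rule reach_mono)
qed

lemma computes_normal_number:
  "\<exists>T. computes_digits normal_digits 2 normal_number T \<and> exponentially_bounded T"
proof -
  have "\<forall>N. \<exists>t. t \<le> 2 ^ (20 * N + 11) \<and>
    (\<exists>s. exec normal_digits (input_store N) t s \<and> (\<forall>k<N. s ''d'' (int k) = digit 2 normal_number k))"
    using reach_normal_digits unfolding reach_def by blast
  then obtain T where T: "\<And>N. T N \<le> 2 ^ (20 * N + 11)"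
    "\<And>N. \<exists>s. exec normal_digits (input_store N) (T N) s \<and> (\<forall>k<N. s ''d'' (int k) = digit 2 normal_number k)"
    by metis
  have "(\<lambda>N. real (20 * N + 11)) \<in> O(\<lambda>N. real N)"
    by (rule bigoI[where c = 31]) (auto simp: eventually_at_top_linorder intro!: exI[of _ 1])
  moreover have "real (T N) \<le> 2 powr real (20 * N + 11)" for N
  proof -
    have "real (T N) \<le> real (2 ^ (20 * N + 11))" by (rule of_nat_mono[OF T(1)])
    also have "\<dots> = 2 powr real (20 * N + 11)" by (subst powr_realpow) auto
    finally show ?thesis .
  qed
  ultimately have "exponentially_bounded T" 
    unfolding exponentially_bounded_def by (intro bexI[of _ "\<lambda>N. real (20 * N + 11)"] allI)
  moreover have "computes_digits normal_digits 2 normal_number T" unfolding computes_digits_def using T(2) by blast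
  ultimately show ?thesis by blast
qed

theorem theorem1:
  "\<exists>x::real.
     absolutely_normal x \<and>
     (\<forall>b::nat. b \<ge> 2 \<longrightarrow>
        (\<exists>N\<^sub>0. \<forall>N\<ge>N\<^sub>0.
           discrepancy (\<lambda>j. frac (real b ^ j * x)) N \<le> 3433 * real b / sqrt (real N))) \<and>
     (\<exists>c T. computes_digits c 2 x T \<and> exponentially_bounded T)"
  using absolutely_normal_normal_number discrepancy_normal_number computes_normal_number by metis

end
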